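(* Let $A$ be a $C^*$-algebra and $H$ a Hilbert space of dimension $d$ which is large enough to contain strictly a copy of every cyclic representation of $A$, i.e. $d\ge\dim K$ for every cyclic representation of $A$ on a Hilbert space $K$, and, if the supremum $s$ of these dimensions is finite, $d>s$. Let $\xi\in H$ be a unit vector. Then the map $$\theta_\xi: rep(A:H)\to Q(A),\qquad \pi\mapsto\langle\pi(-)\xi,\xi\rangle$$ is a quotient map (continuous, surjective, and a subset $D\subset Q(A)$ is open iff $\theta_\xi^{-1}(D)$ is open).
   Context: $rep(A:H)$ denotes the set of all (possibly degenerate) representations of $A$ on $H$, i.e. all $*$-homomorphisms $A\to B(H)$, with the topology of pointwise convergence for the weak operator topology on $B(H)$: $\pi_j\to\pi$ iff $\pi_j(a)\to\pi(a)$ in the weak operator topology for every $a\in A$ (this coincides with the pointwise topologies for the strong operator, $\sigma$-weak and $\sigma$-strong topologies). $Q(A)=\{\varphi\in A^*:\varphi\ge 0,\ \|\varphi\|\le 1\}$ is the set of quasi-states, with the weak-$*$ topology. *)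

theory Defs
  imports "HOL-Analysis.Analysis"
begin

record 'v cvs =
  vcarrier :: "'v set"
  vzero :: 'v
  vadd :: "'v \<Rightarrow> 'v \<Rightarrow> 'v"
  vscale :: "complex \<Rightarrow> 'v \<Rightarrow> 'v"

definition vdiff :: "('v, 'b) cvs_scheme \<Rightarrow> 'v \<Rightarrow> 'v \<Rightarrow> 'v" where
  "vdiff V x y = vadd V x (vscale V (-1) y)"

definition complex_vector_space :: "('v, 'b) cvs_scheme \<Rightarrow> bool" where
  "complex_vector_space V \<longleftrightarrow>
     vzero V \<in> vcarrier V \<and>
     (\<forall>x\<in>vcarrier V. \<forall>y\<in>vcarrier V. vadd V x y \<in> vcarrier V) \<and>
     (\<forall>c. \<forall>x\<in>vcarrier V. vscale V c x \<in> vcarrier V) \<and>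
     (\<forall>x\<in>vcarrier V. \<forall>y\<in>vcarrier V. \<forall>z\<in>vcarrier V.
        vadd V (vadd V x y) z = vadd V x (vadd V y z)) \<and>
     (\<forall>x\<in>vcarrier V. \<forall>y\<in>vcarrier V. vadd V x y = vadd V y x) \<and>
     (\<forall>x\<in>vcarrier V. vadd V (vzero V) x = x) \<and>
     (\<forall>x\<in>vcarrier V. vadd V x (vscale V (-1) x) = vzero V) \<and>
     (\<forall>c. \<forall>x\<in>vcarrier V. \<forall>y\<in>vcarrier V.
        vscale V c (vadd V x y) = vadd V (vscale V c x) (vscale V c y)) \<and>
     (\<forall>c d. \<forall>x\<in>vcarrier V. vscale V (c + d) x = vadd V (vscale V c x) (vscale V d x)) \<and>
     (\<forall>c d. \<forall>x\<in>vcarrier V. vscale V c (vscale V d x) = vscale V (c * d) x) \<and>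
     (\<forall>x\<in>vcarrier V. vscale V 1 x = x)"

record 'v hilb = "'v cvs" +
  hinner :: "'v \<Rightarrow> 'v \<Rightarrow> complex"

definition hnorm :: "('v, 'b) hilb_scheme \<Rightarrow> 'v \<Rightarrow> real" where
  "hnorm H x = sqrt (Re (hinner H x x))"

definition hilbert_space :: "('v, 'b) hilb_scheme \<Rightarrow> bool" where
  "hilbert_space H \<longleftrightarrow>
     complex_vector_space H \<and>
     (\<forall>x\<in>vcarrier H. \<forall>y\<in>vcarrier H. \<forall>z\<in>vcarrier H.
        hinner H (vadd H x y) z = hinner H x z + hinner H y z) \<and>
     (\<forall>c. \<forall>x\<in>vcarrier H. \<forall>y\<in>vcarrier H. hinner H (vscale H c x) y = c * hinner H x y) \<and>
     (\<forall>x\<in>vcarrier H. \<forall>y\<in>vcarrier H. hinner H y x = cnj (hinner H x y)) \<and>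
     (\<forall>x\<in>vcarrier H. 0 \<le> Re (hinner H x x)) \<and>
     (\<forall>x\<in>vcarrier H. hinner H x x = 0 \<longrightarrow> x = vzero H) \<and>
     \<comment> \<open>completeness: every Cauchy sequence converges\<close>
     (\<forall>X :: nat \<Rightarrow> _. (\<forall>n. X n \<in> vcarrier H) \<and>
          (\<forall>e>0. \<exists>N. \<forall>m\<ge>N. \<forall>n\<ge>N. hnorm H (vdiff H (X m) (X n)) < e) \<longrightarrow>
          (\<exists>l\<in>vcarrier H. \<forall>e>0. \<exists>N. \<forall>n\<ge>N. hnorm H (vdiff H (X n) l) < e))"

definition orthonormal_basis :: "('v, 'b) hilb_scheme \<Rightarrow> 'v set \<Rightarrow> bool" where
  "orthonormal_basis H B \<longleftrightarrow>
     B \<subseteq> vcarrier H \<and>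
     (\<forall>x\<in>B. hinner H x x = 1) \<and>
     (\<forall>x\<in>B. \<forall>y\<in>B. x \<noteq> y \<longrightarrow> hinner H x y = 0) \<and>
     (\<forall>x\<in>vcarrier H. (\<forall>b\<in>B. hinner H x b = 0) \<longrightarrow> x = vzero H)"

text \<open>Hilbert dimension comparison (the Hilbert dimension of a space is the cardinality
  of any of its orthonormal bases).\<close>

definition hdim_le :: "('v, 'b) hilb_scheme \<Rightarrow> ('w, 'c) hilb_scheme \<Rightarrow> bool" where
  "hdim_le K H \<longleftrightarrow>
     (\<forall>B B'. orthonormal_basis K B \<longrightarrow> orthonormal_basis H B' \<longrightarrow>
        (\<exists>f. inj_on f B \<and> f ` B \<subseteq> B'))"

definition hdim_less :: "('v, 'b) hilb_scheme \<Rightarrow> ('w, 'c) hilb_scheme \<Rightarrow> bool" where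
  "hdim_less K H \<longleftrightarrow> hdim_le K H \<and> \<not> hdim_le H K"

record 'a cstar = "'a cvs" +
  amult :: "'a \<Rightarrow> 'a \<Rightarrow> 'a"
  astar :: "'a \<Rightarrow> 'a"
  anorm :: "'a \<Rightarrow> real"

definition cstar_algebra :: "('a, 'b) cstar_scheme \<Rightarrow> bool" where
  "cstar_algebra A \<longleftrightarrow>
     complex_vector_space A \<and>
     (\<forall>x\<in>vcarrier A. \<forall>y\<in>vcarrier A. amult A x y \<in> vcarrier A) \<and>
     (\<forall>x\<in>vcarrier A. astar A x \<in> vcarrier A) \<and>
     (\<forall>x\<in>vcarrier A. \<forall>y\<in>vcarrier A. \<forall>z\<in>vcarrier A.
        amult A (amult A x y) z = amult A x (amult A y z)) \<and>
     (\<forall>x\<in>vcarrier A. \<forall>y\<in>vcarrier A. \<forall>z\<in>vcarrier A.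
        amult A x (vadd A y z) = vadd A (amult A x y) (amult A x z) \<and>
        amult A (vadd A x y) z = vadd A (amult A x z) (amult A y z)) \<and>
     (\<forall>c. \<forall>x\<in>vcarrier A. \<forall>y\<in>vcarrier A.
        amult A (vscale A c x) y = vscale A c (amult A x y) \<and>
        amult A x (vscale A c y) = vscale A c (amult A x y)) \<and>
     (\<forall>x\<in>vcarrier A. astar A (astar A x) = x) \<and>
     (\<forall>x\<in>vcarrier A. \<forall>y\<in>vcarrier A. astar A (vadd A x y) = vadd A (astar A x) (astar A y)) \<and>
     (\<forall>c. \<forall>x\<in>vcarrier A. astar A (vscale A c x) = vscale A (cnj c) (astar A x)) \<and>
     (\<forall>x\<in>vcarrier A. \<forall>y\<in>vcarrier A. astar A (amult A x y) = amult A (astar A y) (astar A x)) \<and>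
     (\<forall>x\<in>vcarrier A. 0 \<le> anorm A x \<and> (anorm A x = 0 \<longleftrightarrow> x = vzero A)) \<and>
     (\<forall>x\<in>vcarrier A. \<forall>y\<in>vcarrier A. anorm A (vadd A x y) \<le> anorm A x + anorm A y) \<and>
     (\<forall>c. \<forall>x\<in>vcarrier A. anorm A (vscale A c x) = cmod c * anorm A x) \<and>
     (\<forall>x\<in>vcarrier A. \<forall>y\<in>vcarrier A. anorm A (amult A x y) \<le> anorm A x * anorm A y) \<and>
     (\<forall>x\<in>vcarrier A. anorm A (amult A (astar A x) x) = (anorm A x)\<^sup>2) \<and>
     (\<forall>X :: nat \<Rightarrow> _. (\<forall>n. X n \<in> vcarrier A) \<and>
          (\<forall>e>0. \<exists>N. \<forall>m\<ge>N. \<forall>n\<ge>N. anorm A (vdiff A (X m) (X n)) < e) \<longrightarrow>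
          (\<exists>l\<in>vcarrier A. \<forall>e>0. \<exists>N. \<forall>n\<ge>N. anorm A (vdiff A (X n) l) < e))"

text \<open>A (possibly degenerate) representation of \<open>A\<close> on \<open>H\<close>: a *-homomorphism
  \<open>A \<rightarrow> B(H)\<close>.\<close>

definition is_rep :: "('a, 'b) cstar_scheme \<Rightarrow> ('v, 'c) hilb_scheme \<Rightarrow> ('a \<Rightarrow> 'v \<Rightarrow> 'v) \<Rightarrow> bool" where
  "is_rep A H \<pi> \<longleftrightarrow>
     \<comment> \<open>each \<open>\<pi> a\<close> is a bounded linear operator on \<open>H\<close>\<close>
     (\<forall>a\<in>vcarrier A. \<forall>x\<in>vcarrier H. \<pi> a x \<in> vcarrier H) \<and>
     (\<forall>a\<in>vcarrier A. \<forall>x\<in>vcarrier H. \<forall>y\<in>vcarrier H. \<pi> a (vadd H x y) = vadd H (\<pi> a x) (\<pi> a y)) \<and>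
     (\<forall>a\<in>vcarrier A. \<forall>c. \<forall>x\<in>vcarrier H. \<pi> a (vscale H c x) = vscale H c (\<pi> a x)) \<and>
     (\<forall>a\<in>vcarrier A. \<exists>C. \<forall>x\<in>vcarrier H. hnorm H (\<pi> a x) \<le> C * hnorm H x) \<and>
     \<comment> \<open>\<open>\<pi>\<close> is a *-homomorphism\<close>
     (\<forall>a\<in>vcarrier A. \<forall>b\<in>vcarrier A. \<forall>x\<in>vcarrier H. \<pi> (vadd A a b) x = vadd H (\<pi> a x) (\<pi> b x)) \<and>
     (\<forall>c. \<forall>a\<in>vcarrier A. \<forall>x\<in>vcarrier H. \<pi> (vscale A c a) x = vscale H c (\<pi> a x)) \<and>
     (\<forall>a\<in>vcarrier A. \<forall>b\<in>vcarrier A. \<forall>x\<in>vcarrier H. \<pi> (amult A a b) x = \<pi> a (\<pi> b x)) \<and>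
     (\<forall>a\<in>vcarrier A. \<forall>x\<in>vcarrier H. \<forall>y\<in>vcarrier H.
        hinner H (\<pi> (astar A a) x) y = hinner H x (\<pi> a y))"

definition rep :: "('a, 'b) cstar_scheme \<Rightarrow> ('v, 'c) hilb_scheme \<Rightarrow> ('a \<Rightarrow> 'v \<Rightarrow> 'v) set" where
  "rep A H = {\<pi>. is_rep A H \<pi>}"

text \<open>Topology of pointwise weak-operator convergence: the initial topology for the maps
  \<open>\<pi> \<mapsto> \<langle>\<pi>(a)x, y\<rangle>\<close>.\<close>

definition rep_topology :: "('a, 'b) cstar_scheme \<Rightarrow> ('v, 'c) hilb_scheme \<Rightarrow> ('a \<Rightarrow> 'v \<Rightarrow> 'v) topology" where
  "rep_topology A H =
     pullback_topology (rep A H) (\<lambda>\<pi> (a, x, y). hinner H (\<pi> a x) y)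
       (product_topology (\<lambda>_. euclidean) UNIV)"

definition cyclic_rep :: "('a, 'b) cstar_scheme \<Rightarrow> ('v, 'c) hilb_scheme \<Rightarrow> ('a \<Rightarrow> 'v \<Rightarrow> 'v) \<Rightarrow> bool" where
  "cyclic_rep A K \<pi> \<longleftrightarrow> is_rep A K \<pi> \<and>
     (\<exists>\<eta>\<in>vcarrier K. \<forall>x\<in>vcarrier K. \<forall>e>0. \<exists>a\<in>vcarrier A. hnorm K (vdiff K x (\<pi> a \<eta>)) < e)"

definition quasi_states :: "('a, 'b) cstar_scheme \<Rightarrow> ('a \<Rightarrow> complex) set" where
  "quasi_states A = {\<phi>.
     (\<forall>x\<in>vcarrier A. \<forall>y\<in>vcarrier A. \<phi> (vadd A x y) = \<phi> x + \<phi> y) \<and>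
     (\<forall>c. \<forall>x\<in>vcarrier A. \<phi> (vscale A c x) = c * \<phi> x) \<and>
     \<comment> \<open>positivity: \<open>\<phi>(b* b) \<ge> 0\<close> (the positive elements are exactly the \<open>b* b\<close>)\<close>
     (\<forall>b\<in>vcarrier A. Im (\<phi> (amult A (astar A b) b)) = 0 \<and> 0 \<le> Re (\<phi> (amult A (astar A b) b))) \<and>
     \<comment> \<open>\<open>\<parallel>\<phi>\<parallel> \<le> 1\<close>\<close>
     (\<forall>x\<in>vcarrier A. cmod (\<phi> x) \<le> anorm A x)}"

definition qs_topology :: "('a, 'b) cstar_scheme \<Rightarrow> ('a \<Rightarrow> complex) topology" where
  "qs_topology A = subtopology (product_topology (\<lambda>_. euclidean) UNIV) (quasi_states A)"

definition theta :: "('v, 'c) hilb_scheme \<Rightarrow> 'v \<Rightarrow> ('a \<Rightarrow> 'v \<Rightarrow> 'v) \<Rightarrow> ('a \<Rightarrow> complex)" where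
  "theta H \<xi> \<pi> = (\<lambda>a. hinner H (\<pi> a \<xi>) \<xi>)"

end

theory Submission
  imports Defs
begin

text \<open>
  For \<open>\<phi>\<close> in \<open>Q(A)\<close> the GNS space of \<open>\<phi>\<close> embeds isometrically into \<open>H\<close>; since \<open>H\<close> is strictly larger, the
  embedding can be rotated so that the adjoint maps \<open>\<xi>\<close> to the GNS vector, and extending by \<open>0\<close> gives a
  representation on \<open>H\<close> with vector functional \<open>\<phi>\<close>.  Contractivity of representations, boundedness of the
  GNS operators and \<open>|\<phi>(a)|\<^sup>2 \<le> \<phi>(a\<^sup>* a)\<close> come from square roots \<open>1 - h = (1 - g)\<^sup>2\<close>, obtained as fixed points
  of \<open>g \<mapsto> (h + g\<^sup>2)/2\<close>, and from the approximate unit \<open>h\<^sup>2 (h\<^sup>2 + \<epsilon>)\<^sup>-\<^sup>1\<close>, so that no functional calculus is needed.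

  If \<open>H\<close> is finite-dimensional, \<open>rep(A:H)\<close> is compact and the map is closed.  If \<open>H\<close> is infinite-dimensional,
  the embeddings can be chosen with infinite-dimensional complement.  For \<open>\<psi>\<close> close to \<open>\<phi>\<close>, finitely many
  vectors in \<open>\<pi>\<^sub>\<psi>(A)\<xi> + \<complex>\<xi>\<close> and in its complement have almost the Gram matrix of the corresponding vectors for
  \<open>\<phi>\<close>, so a unitary fixing \<open>\<xi>\<close> moves the former close to the latter.  Conjugating by it, \<open>\<psi>\<close> has a lift close to
  that of \<open>\<phi>\<close>; thus the map is open at suitable points of every fibre.
\<close>

section \<open>Semi-inner product spaces and Hilbert spaces\<close>

text \<open>The GNS vector of a quasi-state may be shorter than 1, while \<open>\<xi>\<close> is a
  unit vector: the missing length has to be placed orthogonally to the embedded GNS space, and the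
  strictness of the dimension hypothesis provides the room. In infinite dimension the complement has
  a second task: vectors orthogonal to \<open>\<pi>(A)\<xi> + \<complex>\<xi>\<close> need
  counterparts for every nearby \<open>\<psi>\<close>, and orthonormal null vectors of the lift of
  \<open>\<psi>\<close> serve as these. The dimension hypothesis speaks only of spaces carried by
  \<open>nat \<Rightarrow> 'a\<close>, so the GNS space must be realised on exactly this type;
  injectively chosen Cauchy sequences do it. Since \<open>A\<close> may lack a unit, formulas with
  \<open>1\<close> are applied to an element or rearranged until the \<open>1\<close> cancels. The
  weak-* topology need not be first countable, so limits are taken along filters. One notion of
  semi-inner product space covers Hilbert spaces, non-closed subspaces and the degenerate form
  \<open>\<phi>(b\<^sup>* a)\<close>; vectors are therefore compared through inner products.\<close>

locale semi_inner =
  fixes C :: "'v set" and add :: "'v \<Rightarrow> 'v \<Rightarrow> 'v" (infixl "\<oplus>" 65)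
    and scale :: "complex \<Rightarrow> 'v \<Rightarrow> 'v" (infixr "\<odot>" 75)
    and ip :: "'v \<Rightarrow> 'v \<Rightarrow> complex"
  assumes nonempty: "C \<noteq> {}"
    and add_closed [simp, intro]: "x \<in> C \<Longrightarrow> y \<in> C \<Longrightarrow> x \<oplus> y \<in> C"
    and scale_closed [simp, intro]: "x \<in> C \<Longrightarrow> c \<odot> x \<in> C"
    and ip_add_left [simp]: "x \<in> C \<Longrightarrow> y \<in> C \<Longrightarrow> z \<in> C \<Longrightarrow> ip (x \<oplus> y) z = ip x z + ip y z"
    and ip_scale_left [simp]: "x \<in> C \<Longrightarrow> y \<in> C \<Longrightarrow> ip (c \<odot> x) y = c * ip x y"
    and ip_cnj: "x \<in> C \<Longrightarrow> y \<in> C \<Longrightarrow> ip y x = cnj (ip x y)"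
    and ip_nonneg: "x \<in> C \<Longrightarrow> 0 \<le> Re (ip x x)"
begin

definition dif :: "'v \<Rightarrow> 'v \<Rightarrow> 'v" (infixl "\<ominus>" 65) where "x \<ominus> y = x \<oplus> (-1) \<odot> y"
definition nrm :: "'v \<Rightarrow> real" where "nrm x = sqrt (Re (ip x x))"
definition Cauchy_seq :: "(nat \<Rightarrow> 'v) \<Rightarrow> bool" where
  "Cauchy_seq X \<longleftrightarrow> (\<forall>n. X n \<in> C) \<and> (\<forall>e>0. \<exists>N. \<forall>m\<ge>N. \<forall>n\<ge>N. nrm (X m \<ominus> X n) < e)"

lemma dif_closed [simp, intro]: "x \<in> C \<Longrightarrow> y \<in> C \<Longrightarrow> x \<ominus> y \<in> C"
  by (simp add: dif_def)

lemma ip_dif_left [simp]: "x \<in> C \<Longrightarrow> y \<in> C \<Longrightarrow> z \<in> C \<Longrightarrow> ip (x \<ominus> y) z = ip x z - ip y z"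
  by (simp add: dif_def)

lemma ip_add_right [simp]:
  assumes "x \<in> C" "y \<in> C" "z \<in> C" shows "ip z (x \<oplus> y) = ip z x + ip z y"
  using assms ip_cnj[of "x \<oplus> y" z] ip_cnj[of x z] ip_cnj[of y z] by simp

lemma ip_scale_right [simp]: "x \<in> C \<Longrightarrow> y \<in> C \<Longrightarrow> ip y (c \<odot> x) = cnj c * ip y x"
  using ip_cnj[of "c \<odot> x" y] ip_cnj[of x y] by simp

lemma ip_dif_right [simp]: "x \<in> C \<Longrightarrow> y \<in> C \<Longrightarrow> z \<in> C \<Longrightarrow> ip z (x \<ominus> y) = ip z x - ip z y"
  by (simp add: dif_def)

lemma ip_swap_0: "x \<in> C \<Longrightarrow> y \<in> C \<Longrightarrow> ip x y = 0 \<Longrightarrow> ip y x = 0"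
  using ip_cnj[of x y] by simp

lemma nrm_ge0 [simp]: "x \<in> C \<Longrightarrow> 0 \<le> nrm x"
  by (simp add: nrm_def ip_nonneg)

lemma nrm_sq: "x \<in> C \<Longrightarrow> (nrm x)\<^sup>2 = Re (ip x x)"
  by (simp add: nrm_def ip_nonneg)

lemma ip_self: "x \<in> C \<Longrightarrow> ip x x = of_real ((nrm x)\<^sup>2)"
proof -
  assume x: "x \<in> C"
  have "Im (ip x x) = Im (cnj (ip x x))" by (rule arg_cong[OF ip_cnj[OF x x]])
  then have "Im (ip x x) = 0" unfolding cnj.sel by linarith
  then show ?thesis using x by (simp add: complex_eq_iff nrm_sq)
qed

lemma nrm_scale [simp]: "x \<in> C \<Longrightarrow> nrm (c \<odot> x) = cmod c * nrm x"
proof -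
  assume x: "x \<in> C"
  have "ip (c \<odot> x) (c \<odot> x) = (c * cnj c) * ip x x" using x by simp
  also have "\<dots> = of_real ((cmod c * nrm x)\<^sup>2)"
    unfolding power_mult_distrib of_real_mult complex_norm_square ip_self[OF x] ..
  finally show ?thesis using x unfolding nrm_def[of "c \<odot> x"] by simp
qed

lemma Re_cnj_ip: "x \<in> C \<Longrightarrow> y \<in> C \<Longrightarrow> Re (ip y x) = Re (ip x y)"
  using ip_cnj[of x y] by simp

lemma nrm_add_sq:
  assumes "x \<in> C" "y \<in> C"
  shows "(nrm (x \<oplus> y))\<^sup>2 = (nrm x)\<^sup>2 + 2 * Re (ip x y) + (nrm y)\<^sup>2"
  using assms Re_cnj_ip[of x y] by (simp add: nrm_sq)

lemma nrm_dif_sq: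
  assumes "x \<in> C" "y \<in> C"
  shows "(nrm (x \<ominus> y))\<^sup>2 = (nrm x)\<^sup>2 - 2 * Re (ip x y) + (nrm y)\<^sup>2"
  using assms Re_cnj_ip[of x y] by (simp add: nrm_sq)

lemma cauchy_schwarz:
  assumes x: "x \<in> C" and y: "y \<in> C"
  shows "cmod (ip x y) \<le> nrm x * nrm y"
proof -
  define m where "m = (cmod (ip x y))\<^sup>2"
  define p where "p = (nrm x)\<^sup>2"
  define q where "q = (nrm y)\<^sup>2"
  \<comment> \<open>Expand \<open>\<parallel>x - r \<langle>x,y\<rangle> y\<parallel>^2\<close>. The
    form is only semidefinite, so \<open>q\<close> may vanish for a nonzero \<open>y\<close>;
    keeping \<open>r\<close> free treats both cases.\<close>
  have *: "0 \<le> p - 2 * r * m + r\<^sup>2 * m * q" for r :: real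
  proof -
    let ?t = "- (of_real r * ip x y)"
    have "0 \<le> (nrm (x \<oplus> ?t \<odot> y))\<^sup>2" by simp
    also have "\<dots> = p + 2 * Re (cnj ?t * ip x y) + (cmod ?t)\<^sup>2 * q"
      using x y by (subst nrm_add_sq) (auto simp: p_def q_def power_mult_distrib)
    also have "cnj ?t * ip x y = of_real (- r * m)"
      by (simp add: m_def complex_norm_square mult.commute del: of_real_power)
    also have "(cmod ?t)\<^sup>2 = r\<^sup>2 * m"
      by (simp add: m_def norm_mult power_mult_distrib)
    finally show ?thesis by simp
  qed
  have m0: "m \<ge> 0" and q0: "q \<ge> 0" and p0: "p \<ge> 0" by (auto simp: m_def q_def p_def)
  have "m \<le> p * q"
  proof (cases "q = 0")
    case True
    have "m = 0"
    proof (rule ccontr)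
      assume "m \<noteq> 0"
      \<comment> \<open>With \<open>q = 0\<close> the bound is affine in \<open>r\<close>; this
        \<open>r\<close> turns it into \<open>0 <= -1\<close>.\<close>
      then have "0 \<le> p - 2 * ((p + 1) / (2 * m)) * m" using *[of "(p+1)/(2*m)"] True by simp
      then show False using \<open>m \<noteq> 0\<close> by (simp add: field_simps)
    qed
    then show ?thesis using p0 q0 by simp
  next
    case False
    then have "0 \<le> p - m / q" using *[of "1/q"] by (simp add: power2_eq_square field_simps)
    then show ?thesis using False q0 by (simp add: field_simps)
  qed
  then have "(cmod (ip x y))\<^sup>2 \<le> (nrm x * nrm y)\<^sup>2"
    by (simp add: m_def p_def q_def power_mult_distrib)
  then show ?thesis by (rule power2_le_imp_le) (simp add: x y)
qed

lemma nrm_triangle: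
  assumes "x \<in> C" "y \<in> C" shows "nrm (x \<oplus> y) \<le> nrm x + nrm y"
proof (rule power2_le_imp_le)
  have "Re (ip x y) \<le> nrm x * nrm y"
    using cauchy_schwarz[OF assms] complex_Re_le_cmod[of "ip x y"] by linarith
  then show "(nrm (x \<oplus> y))\<^sup>2 \<le> (nrm x + nrm y)\<^sup>2"
    using assms by (simp add: nrm_add_sq power2_sum)
qed (use assms in auto)

lemma nrm_cong: "x \<in> C \<Longrightarrow> y \<in> C \<Longrightarrow> ip x x = ip y y \<Longrightarrow> nrm x = nrm y"
  by (simp add: nrm_def)

lemma nrm_dif_commute: "x \<in> C \<Longrightarrow> y \<in> C \<Longrightarrow> nrm (x \<ominus> y) = nrm (y \<ominus> x)"
  by (intro nrm_cong) auto

lemma nrm_rev_triangle: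
  assumes "x \<in> C" "y \<in> C" shows "\<bar>nrm x - nrm y\<bar> \<le> nrm (x \<ominus> y)"
proof -
  have "nrm x \<le> nrm y + nrm (x \<ominus> y)" if "x \<in> C" "y \<in> C" for x y
  proof -
    have "nrm x = nrm (y \<oplus> (x \<ominus> y))"
      using that by (intro nrm_cong) (auto simp: algebra_simps)
    then show ?thesis using nrm_triangle[of y "x \<ominus> y"] that by simp
  qed
  from this[of x y] this[of y x] show ?thesis using assms nrm_dif_commute[of x y] by simp
qed

lemma Cauchy_seqD: "Cauchy_seq X \<Longrightarrow> X n \<in> C" by (simp add: Cauchy_seq_def)

text \<open>A minimising sequence of \<open>\<parallel>v\<parallel>\<^sup>2 - 2 Re (f v)\<close> is Cauchy by the parallelogram law.\<close>

lemma riesz_sequence: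
  assumes f_add: "\<And>x y. x \<in> C \<Longrightarrow> y \<in> C \<Longrightarrow> f (x \<oplus> y) = f x + f y"
    and f_scale: "\<And>c x. x \<in> C \<Longrightarrow> f (c \<odot> x) = c * f x"
    and f_bound: "\<And>x. x \<in> C \<Longrightarrow> cmod (f x) \<le> B * nrm x"
  shows "\<exists>X. Cauchy_seq X \<and> (\<forall>v\<in>C. (\<lambda>n. ip v (X n)) \<longlonglongrightarrow> f v)"
proof -
  define J where "J v = (nrm v)\<^sup>2 - 2 * Re (f v)" for v
  define m where "m = Inf (J ` C)"
  have lower: "- (B\<^sup>2) \<le> J v" if "v \<in> C" for v
  proof -
    have "Re (f v) \<le> B * nrm v"
      using f_bound[OF that] complex_Re_le_cmod[of "f v"] by linarith
    moreover have "0 \<le> (nrm v - B)\<^sup>2" by simp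
    ultimately show ?thesis by (simp add: J_def power2_diff algebra_simps)
  qed
  have bdd: "bdd_below (J ` C)" using lower by (intro bdd_belowI2)
  have mle: "m \<le> J v" if "v \<in> C" for v
    unfolding m_def using bdd that by (intro cInf_lower) auto
  have "\<exists>v\<in>C. J v < m + 1 / (real n + 1)" for n
  proof -
    have "Inf (J ` C) < m + 1 / (real n + 1)" by (simp add: m_def)
    then show ?thesis using cInf_lessD[of "J ` C"] nonempty by blast
  qed
  then obtain X where XC: "\<And>n. X n \<in> C" and XJ: "\<And>n. J (X n) < m + 1 / (real n + 1)"
    by metis
  have par: "(nrm (u \<ominus> v))\<^sup>2 \<le> 2 * (J u - m) + 2 * (J v - m)" if u: "u \<in> C" and v: "v \<in> C" for u v
  proof -
    define w where "w = (1/2) \<odot> (u \<oplus> v)"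
    have "m \<le> J w" using u v unfolding w_def by (intro mle) auto
    moreover have "4 * J w = 2 * J u + 2 * J v - (nrm (u \<ominus> v))\<^sup>2"
    proof -
      have n: "nrm w = nrm (u \<oplus> v) / 2" using u v unfolding w_def by (subst nrm_scale) auto
      have "f (u \<oplus> v) = 2 * f w" using u v f_scale[of "u \<oplus> v" "1/2"] unfolding w_def by (simp only: add_closed) simp
      then have "Re (f u + f v) = 2 * Re (f w)" using u v by (simp add: f_add[symmetric])
      then show ?thesis unfolding J_def n power_divide nrm_add_sq[OF u v] nrm_dif_sq[OF u v]
        by (simp add: field_simps)
    qed
    ultimately show ?thesis by (simp add: algebra_simps)
  qed
  have cau: "Cauchy_seq X"
    unfolding Cauchy_seq_def
  proof (intro conjI allI impI XC)
    fix e :: real assume e: "e > 0"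
    obtain N :: nat where N: "4 / e\<^sup>2 < real N" using reals_Archimedean2 by blast
    show "\<exists>N. \<forall>m\<ge>N. \<forall>n\<ge>N. nrm (X m \<ominus> X n) < e"
    proof (intro exI[of _ N] allI impI)
      fix i j assume ij: "N \<le> i" "N \<le> j"
      have K: "1 / (real k + 1) < e\<^sup>2 / 4" if "N \<le> k" for k
      proof -
        have "4 / e\<^sup>2 < real k + 1" using N that by linarith
        then show ?thesis using e by (simp add: field_simps)
      qed
      have "(nrm (X i \<ominus> X j))\<^sup>2 < e\<^sup>2"
        using par[OF XC[of i] XC[of j]] XJ[of i] XJ[of j] K[OF ij(1)] K[OF ij(2)] by argo
      then show "nrm (X i \<ominus> X j) < e" using e by (simp add: power2_less_imp_less)
    qed
  qed
  have lim: "(\<lambda>n. ip v (X n)) \<longlonglongrightarrow> f v" if v: "v \<in> C" for v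
  proof -
    \<comment> \<open>Perturb \<open>X n\<close> by \<open>r cnj z v\<close>, where \<open>z\<close>
      is the defect \<open>f v - ip v (X n)\<close>. Near-minimality of \<open>J\<close> bounds the
      linear gain \<open>2 r |z|^2\<close> by \<open>1/(n+1)\<close> plus a quadratic term;
      \<open>r (nrm v)^2 <= 1\<close> lets half of the gain absorb that term.\<close>
    define r where "r = 1 / ((nrm v)\<^sup>2 + 1)"
    have r0: "r > 0" unfolding r_def by (simp add: add_nonneg_pos)
    have rr: "r * (nrm v)\<^sup>2 \<le> 1" unfolding r_def using zero_le_power2[of "nrm v"] by (simp add: divide_le_eq_1 add_nonneg_pos)
    have bound: "(cmod (ip v (X n) - f v))\<^sup>2 \<le> (1 / (real n + 1)) / r" for n
    proof -
      define z where "z = f v - ip v (X n)"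
      define k where "k = (cmod z)\<^sup>2"
      let ?t = "of_real r * cnj z"
      have "m \<le> J (X n \<oplus> ?t \<odot> v)" using v XC by (intro mle) auto
      also have "J (X n \<oplus> ?t \<odot> v) = J (X n) + 2 * Re (ip (X n) (?t \<odot> v)) + (cmod ?t)\<^sup>2 * (nrm v)\<^sup>2 - 2 * Re (?t * f v)"
        using v XC by (simp add: J_def nrm_add_sq f_add f_scale power_mult_distrib)
      also have "Re (ip (X n) (?t \<odot> v)) = Re (?t * ip v (X n))"
        using v XC[of n] ip_cnj[of v "X n"] by simp
      also have "J (X n) + 2 * Re (?t * ip v (X n)) + (cmod ?t)\<^sup>2 * (nrm v)\<^sup>2 - 2 * Re (?t * f v)
        = J (X n) - 2 * Re (?t * z) + (cmod ?t)\<^sup>2 * (nrm v)\<^sup>2"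
        by (simp add: z_def algebra_simps)
      also have "?t * z = of_real (r * k)"
        unfolding k_def by (simp add: complex_norm_square mult.commute mult.left_commute del: of_real_power)
      also have "(cmod ?t)\<^sup>2 = r\<^sup>2 * k" by (simp add: k_def norm_mult power_mult_distrib)
      finally have 1: "2 * (r * k) \<le> 1 / (real n + 1) + r\<^sup>2 * k * (nrm v)\<^sup>2" using XJ[of n] by simp
      have "(r * k) * (r * (nrm v)\<^sup>2) \<le> (r * k) * 1"
        using rr r0 by (intro mult_left_mono) (auto simp: k_def)
      then have "r\<^sup>2 * k * (nrm v)\<^sup>2 \<le> r * k" by (simp add: power2_eq_square ac_simps)
      with 1 have "r * k \<le> 1 / (real n + 1)" by linarith
      then have "k \<le> (1 / (real n + 1)) / r" using r0 by (simp add: pos_le_divide_eq mult.commute)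
      then show ?thesis by (simp add: k_def z_def norm_minus_commute)
    qed
    have "(\<lambda>n. (1 / (real n + 1)) / r) \<longlonglongrightarrow> 0 / r"
      using LIMSEQ_inverse_real_of_nat r0
      by (intro tendsto_divide) (auto simp: inverse_eq_divide add.commute)
    then have lim0: "(\<lambda>n. (1 / (real n + 1)) / r) \<longlonglongrightarrow> 0" by simp
    have "(\<lambda>n. (cmod (ip v (X n) - f v))\<^sup>2) \<longlonglongrightarrow> 0"
      by (rule Lim_null_comparison[OF always_eventually lim0]) (simp only: bound real_norm_def abs_power2 simp_thms)
    then have "(\<lambda>n. sqrt ((cmod (ip v (X n) - f v))\<^sup>2)) \<longlonglongrightarrow> sqrt 0" by (rule tendsto_real_sqrt)
    then have "(\<lambda>n. cmod (ip v (X n) - f v)) \<longlonglongrightarrow> 0" by simp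
    then have "(\<lambda>n. ip v (X n) - f v) \<longlonglongrightarrow> 0" by (rule tendsto_norm_zero_cancel)
    then show ?thesis by (rule LIM_zero_cancel)
  qed
  show ?thesis using cau lim by blast
qed

lemma Cauchy_seq_ip_limit:
  assumes X: "\<And>n. X n \<in> C" and x: "x \<in> C" and v: "v \<in> C"
    and lim: "\<And>e. e > 0 \<Longrightarrow> \<exists>N. \<forall>n\<ge>N. nrm (X n \<ominus> x) < e"
  shows "(\<lambda>n. ip v (X n)) \<longlonglongrightarrow> ip v x"
proof -
  have "(\<lambda>n. nrm (X n \<ominus> x)) \<longlonglongrightarrow> 0"
    using lim X x by (auto simp: LIMSEQ_iff)
  then have 0: "(\<lambda>n. nrm v * nrm (X n \<ominus> x)) \<longlonglongrightarrow> 0" using tendsto_mult_right_zero by blast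
  have "cmod (ip v (X n) - ip v x) \<le> nrm v * nrm (X n \<ominus> x)" for n
    using cauchy_schwarz[of v "X n \<ominus> x"] X x v by simp
  then have "(\<lambda>n. ip v (X n) - ip v x) \<longlonglongrightarrow> 0" 
    by (intro Lim_null_comparison[OF _ 0]) auto
  then show ?thesis by (rule LIM_zero_cancel)
qed

end

locale hilb =
  fixes H :: "('v, 'b) hilb_scheme"
  assumes hilb: "hilbert_space H"

lemma (in hilb) vs: "complex_vector_space H" using hilb unfolding hilbert_space_def by (rule conjunct1)

lemma (in hilb) zero_in [simp]: "vzero H \<in> vcarrier H"
  using vs unfolding complex_vector_space_def by (rule conjunct1)

lemma (in hilb) hilb_axioms:
  "\<forall>x\<in>vcarrier H. \<forall>y\<in>vcarrier H. \<forall>z\<in>vcarrier H. hinner H (vadd H x y) z = hinner H x z + hinner H y z"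
  "\<forall>c. \<forall>x\<in>vcarrier H. \<forall>y\<in>vcarrier H. hinner H (vscale H c x) y = c * hinner H x y"
  "\<forall>x\<in>vcarrier H. \<forall>y\<in>vcarrier H. hinner H y x = cnj (hinner H x y)"
  "\<forall>x\<in>vcarrier H. 0 \<le> Re (hinner H x x)"
  "\<forall>x\<in>vcarrier H. hinner H x x = 0 \<longrightarrow> x = vzero H"
  "\<forall>X :: nat \<Rightarrow> _. (\<forall>n. X n \<in> vcarrier H) \<and>
          (\<forall>e>0. \<exists>N. \<forall>m\<ge>N. \<forall>n\<ge>N. hnorm H (vdiff H (X m) (X n)) < e) \<longrightarrow>
          (\<exists>l\<in>vcarrier H. \<forall>e>0. \<exists>N. \<forall>n\<ge>N. hnorm H (vdiff H (X n) l) < e)"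
  by (insert hilb, unfold hilbert_space_def, (elim conjE, assumption)+)

lemma (in hilb) vs_axioms:
  "\<forall>x\<in>vcarrier H. \<forall>y\<in>vcarrier H. vadd H x y \<in> vcarrier H"
  "\<forall>c. \<forall>x\<in>vcarrier H. vscale H c x \<in> vcarrier H"
  "\<forall>u\<in>vcarrier H. \<forall>v\<in>vcarrier H. \<forall>w\<in>vcarrier H. vadd H (vadd H u v) w = vadd H u (vadd H v w)"
  "\<forall>u\<in>vcarrier H. \<forall>v\<in>vcarrier H. vadd H u v = vadd H v u"
  "\<forall>u\<in>vcarrier H. vadd H (vzero H) u = u"
  "\<forall>u\<in>vcarrier H. vadd H u (vscale H (-1) u) = vzero H"
  by (insert vs, unfold complex_vector_space_def, (elim conjE, assumption)+)

sublocale hilb \<subseteq> semi_inner "vcarrier H" "vadd H" "vscale H" "hinner H"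
proof
  show "vcarrier H \<noteq> {}" using zero_in by blast
  show "\<And>x y. x \<in> vcarrier H \<Longrightarrow> y \<in> vcarrier H \<Longrightarrow> hinner H y x = cnj (hinner H x y)"
    by (rule hilb_axioms(3)[rule_format])
qed (simp_all add: hilb_axioms(1,2,4) vs_axioms)

context hilb
begin

lemma hnorm_eq: "hnorm H x = nrm x" by (simp add: hnorm_def nrm_def)
lemma vdiff_eq: "vdiff H x y = dif x y" by (simp add: vdiff_def dif_def)

lemma ip_zero_imp: "x \<in> vcarrier H \<Longrightarrow> hinner H x x = 0 \<Longrightarrow> x = vzero H"
  using hilb_axioms(5) by blast

lemma zero_eq: "x \<in> vcarrier H \<Longrightarrow> dif x x = vzero H"
  by (rule ip_zero_imp) auto

lemma ip_zero_left [simp]: "y \<in> vcarrier H \<Longrightarrow> hinner H (vzero H) y = 0"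
  using zero_eq[of y] ip_dif_left[of y y y] by simp

lemma ip_zero_right [simp]: "y \<in> vcarrier H \<Longrightarrow> hinner H y (vzero H) = 0"
  using ip_swap_0 by simp

lemma ip_ext:
  assumes x: "x \<in> vcarrier H" and y: "y \<in> vcarrier H"
    and eq: "\<And>z. z \<in> vcarrier H \<Longrightarrow> hinner H x z = hinner H y z"
  shows "x = y"
proof -
  have "dif x y = vzero H" using x y eq by (intro ip_zero_imp) auto
  then have e: "vadd H x (vscale H (-1) y) = vzero H" by (simp add: dif_def)
  note a = vs_axioms(3) and c = vs_axioms(4) and z = vs_axioms(5) and i = vs_axioms(6)
  have "x = vadd H (vzero H) x" using z x by simp
  also have "\<dots> = vadd H x (vadd H y (vscale H (-1) y))" using i c x y by simp
  also have "\<dots> = vadd H x (vadd H (vscale H (-1) y) y)" using c y by simp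
  also have "\<dots> = vadd H (vadd H x (vscale H (-1) y)) y" using a x y by simp
  also have "\<dots> = y" using e z y by simp
  finally show ?thesis .
qed

lemma nrm_zero_iff: "x \<in> vcarrier H \<Longrightarrow> nrm x = 0 \<longleftrightarrow> x = vzero H"
  using ip_self[of x] ip_zero_imp[of x] by (auto simp: nrm_def)

lemma complete:
  assumes "Cauchy_seq X" shows "\<exists>l\<in>vcarrier H. \<forall>e>0. \<exists>N. \<forall>n\<ge>N. nrm (dif (X n) l) < e"
  using hilb_axioms(6) assms unfolding Cauchy_seq_def hnorm_eq vdiff_eq by simp

lemma riesz:
  assumes "\<And>x y. x \<in> vcarrier H \<Longrightarrow> y \<in> vcarrier H \<Longrightarrow> f (vadd H x y) = f x + f y"
    and "\<And>c x. x \<in> vcarrier H \<Longrightarrow> f (vscale H c x) = c * f x"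
    and "\<And>x. x \<in> vcarrier H \<Longrightarrow> cmod (f x) \<le> B * nrm x"
  shows "\<exists>l\<in>vcarrier H. \<forall>v\<in>vcarrier H. hinner H v l = f v"
proof -
  obtain X where X: "Cauchy_seq X" and lim: "\<And>v. v \<in> vcarrier H \<Longrightarrow> (\<lambda>n. hinner H v (X n)) \<longlonglongrightarrow> f v"
    using riesz_sequence[OF assms] by blast
  obtain l where l: "l \<in> vcarrier H" and ll: "\<forall>e>0. \<exists>N. \<forall>n\<ge>N. nrm (dif (X n) l) < e"
    using complete[OF X] by blast
  have "hinner H v l = f v" if v: "v \<in> vcarrier H" for v
  proof -
    have "(\<lambda>n. hinner H v (X n)) \<longlonglongrightarrow> hinner H v l"
      by (rule Cauchy_seq_ip_limit) (use X l v ll Cauchy_seqD in auto)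
    then show ?thesis using lim[OF v] LIMSEQ_unique by blast
  qed
  then show ?thesis using l by blast
qed

end

section \<open>Square roots and approximate units in C*-algebras\<close>

locale cstar =
  fixes A :: "'a cstar"
  assumes cs: "cstar_algebra A" and univ: "vcarrier A = UNIV"
begin

abbreviation A_add (infixl "+." 65) where "x +. y \<equiv> vadd A x y"
abbreviation A_diff (infixl "-." 65) where "x -. y \<equiv> vdiff A x y"
abbreviation A_mult (infixl "*." 70) where "x *. y \<equiv> amult A x y"
abbreviation A_scale (infixr "\<cdot>" 75) where "c \<cdot> x \<equiv> vscale A c x"
abbreviation st where "st \<equiv> astar A"
abbreviation N where "N \<equiv> anorm A"

lemmas cs' = cs[unfolded cstar_algebra_def complex_vector_space_def univ ball_UNIV bex_UNIV]

lemma vs_axioms: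
  "\<forall>x y z. x +. y +. z = x +. (y +. z)"
  "\<forall>x y. x +. y = y +. x"
  "\<forall>x. vzero A +. x = x"
  "\<forall>x. x +. (-1) \<cdot> x = vzero A"
  "\<forall>c x y. c \<cdot> (x +. y) = c \<cdot> x +. c \<cdot> y"
  "\<forall>c d x. (c + d) \<cdot> x = c \<cdot> x +. d \<cdot> x"
  "\<forall>c d x. c \<cdot> d \<cdot> x = (c * d) \<cdot> x"
  "\<forall>x. 1 \<cdot> x = x"
  by (insert cs', (elim conjE, assumption)+)

lemma ring_axioms:
  "\<forall>x y z. x *. y *. z = x *. (y *. z)"
  "\<forall>x y z. x *. (y +. z) = x *. y +. x *. z \<and> (x +. y) *. z = x *. z +. y *. z"
  "\<forall>c x y. (c \<cdot> x) *. y = c \<cdot> (x *. y) \<and> x *. (c \<cdot> y) = c \<cdot> (x *. y)"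
  by (insert cs', (elim conjE, assumption)+)

lemma star_axioms:
  "\<forall>x. st (st x) = x"
  "\<forall>x y. st (x +. y) = st x +. st y"
  "\<forall>c x. st (c \<cdot> x) = cnj c \<cdot> st x"
  "\<forall>x y. st (x *. y) = st y *. st x"
  by (insert cs', (elim conjE, assumption)+)

lemma norm_axioms:
  "\<forall>x. 0 \<le> N x \<and> (N x = 0 \<longleftrightarrow> x = vzero A)"
  "\<forall>x y. N (x +. y) \<le> N x + N y"
  "\<forall>c x. N (c \<cdot> x) = cmod c * N x"
  "\<forall>x y. N (x *. y) \<le> N x * N y"
  "\<forall>x. N (st x *. x) = (N x)\<^sup>2"
  "\<forall>X :: nat \<Rightarrow> _. (\<forall>n. X n \<in> UNIV) \<and>
          (\<forall>e>0. \<exists>M. \<forall>m\<ge>M. \<forall>n\<ge>M. N (X m -. X n) < e) \<longrightarrow>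
          (\<exists>l. \<forall>e>0. \<exists>M. \<forall>n\<ge>M. N (X n -. l) < e)"
  by (insert cs', (elim conjE, assumption)+)

lemmas ax = vs_axioms[rule_format] ring_axioms[rule_format] star_axioms[rule_format] norm_axioms[rule_format]
lemmas N_zero_iff = ax(16)[THEN conjunct2]

lemma scale_mult [simp]: "(c \<cdot> x) *. y = c \<cdot> (x *. y)" "x *. (c \<cdot> y) = c \<cdot> (x *. y)"
  using ax(11) by auto

lemmas [simp] = ax(7,8,12-15,18)
lemmas scale_add = ax(5)

lemma scale_diff: "c \<cdot> (x -. y) = c \<cdot> x -. c \<cdot> y"
  by (simp add: vdiff_def scale_add)

lemma st_diff [simp]: "st (x -. y) = st x -. st y"
  by (simp add: vdiff_def)

lemma N_diff: "N (x -. y) \<le> N x + N y"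
  using ax(17)[of x "(-1) \<cdot> y"] by (simp add: vdiff_def)


end

text \<open>\<open>ring\<close> has no unit, as suits a possibly non-unital \<open>A\<close>; the
  interpretation makes \<open>algebra_simps\<close> usable for the record operations.\<close>

sublocale cstar \<subseteq> R: ring where plus = "vadd A" and zero = "vzero A" and minus = "vdiff A"
  and uminus = "vscale A (-1)" and times = "amult A"
proof
  fix x y z
  show "x +. y +. z = x +. (y +. z)" by (rule ax(1))
  show "x +. y = y +. x" by (rule ax(2))
  show "vzero A +. x = x" by (rule ax(3))
  show "(-1) \<cdot> x +. x = vzero A" using ax(2,4) by metis
  show "x -. y = x +. (-1) \<cdot> y" by (rule vdiff_def)
  show "x *. y *. z = x *. (y *. z)" by (rule ax(9))
  show "(x +. y) *. z = x *. z +. y *. z" using ax(10) by blast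
  show "x *. (y +. z) = x *. y +. x *. z" using ax(10) by blast
qed

context cstar
begin

section \<open>Norm, involution and formal unitaries\<close>

lemma scale_zero_left [simp]: "0 \<cdot> x = vzero A"
  using ax(6)[of 0 0 x] by simp

lemma double: "x +. x = 2 \<cdot> x"
  using ax(6)[of 1 1 x] by simp

lemma N_nonneg [simp]: "0 \<le> N x" using ax(16) by blast

lemma N_zero [simp]: "N (vzero A) = 0" using N_zero_iff by blast

lemma N_diff_commute: "N (x -. y) = N (y -. x)"
proof -
  have "x -. y = (-1) \<cdot> (y -. x)" by (simp only: R.minus_diff_eq)
  then show ?thesis by (simp only: ax(18)) simp
qed

lemma N_diff_triangle: "N (x -. z) \<le> N (x -. y) + N (y -. z)"
proof -
  have "x -. z = (x -. y) +. (y -. z)" by (simp add: R.diff_add_eq R.diff_add_cancel R.add_diff_eq)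
  then show ?thesis using ax(17) by metis
qed

lemma N_st [simp]: "N (st x) = N x"
proof -
  have *: "N x \<le> N (st x)" for x
  proof (cases "N x = 0")
    case False
    then have "N x > 0" using N_nonneg[of x] by linarith
    moreover have "N x * N x \<le> N (st x) * N x"
      using ax(19)[of "st x" x] ax(20)[of x] by (simp add: power2_eq_square)
    ultimately show ?thesis by simp
  qed simp
  show ?thesis using *[of x] *[of "st x"] by simp
qed

lemma N_mult_st: "N (x *. st x) = (N x)\<^sup>2"
  using ax(20)[of "st x"] by simp

text \<open>With \<open>w = 1 - p + \<i> q\<close> formally unitary, left multiplication by \<open>w\<close> and by \<open>w\<^sup>*\<close> is isometric.\<close>

lemma norm_diff_mult_le:
  assumes p: "st p = p" and q: "st q = q" and pq: "p *. q = q *. p"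
    and eq: "p *. p +. q *. q = p +. p"
  shows "N (b -. p *. b) \<le> N b"
proof -
  define U where "U = b -. p *. b"
  define V where "V = q *. b"
  have UV: "st U *. V = st V *. U"
    unfolding U_def V_def using p q pq by (simp add: R.left_diff_distrib R.right_diff_distrib ax(9)) (metis ax(9))
  have "st U *. U +. st V *. V = st b *. b -. st b *. (p +. p) *. b +. st b *. (p *. p +. q *. q) *. b"
    unfolding U_def V_def using p q by (simp add: algebra_simps)
  then have sum: "st U *. U +. st V *. V = st b *. b"
    unfolding eq by (simp add: R.diff_add_cancel)
  have W: "N (U +. c \<cdot> V) = N b" if c: "c * cnj c = 1" "cnj c = - c" for c
  proof -
    have "st (U +. c \<cdot> V) *. (U +. c \<cdot> V)
       = (st U *. U +. st V *. V) +. (c \<cdot> (st U *. V) +. (-1) \<cdot> c \<cdot> (st V *. U))"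
      using c by (simp add: R.distrib_left R.distrib_right scale_add R.add_ac mult.commute)
    also have "\<dots> = st b *. b" unfolding sum UV by (simp add: ax(4) del: ax(7))
    finally have "(N (U +. c \<cdot> V))\<^sup>2 = (N b)\<^sup>2" using ax(20) by metis
    then show ?thesis by (simp add: power2_eq_iff_nonneg)
  qed
  \<comment> \<open>\<open>b - p b\<close> is the mean of \<open>w b\<close> and
    \<open>w\<^sup>* b\<close>, both of norm \<open>N b\<close>.\<close>
  have "2 \<cdot> U = (U +. \<i> \<cdot> V) +. (U +. (- \<i>) \<cdot> V)"
    unfolding double[symmetric] using ax(6)[of \<i> "-\<i>" V] by (simp add: R.add_ac)
  then have "N (2 \<cdot> U) \<le> N b + N b" using ax(17)[of "U +. \<i> \<cdot> V" "U +. (- \<i>) \<cdot> V"] W[of \<i>] W[of "-\<i>"] by simp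
  then show ?thesis by (simp add: U_def)
qed

text \<open>Banach's theorem on the closed set \<open>P\<close>: every property the solution must
  have (norm bound, selfadjointness, commutation) goes into \<open>P\<close> and thereby passes to
  the limit. It takes the place of power series.\<close>

lemma fixed_point:
  assumes P0: "P x0" and PT: "\<And>x. P x \<Longrightarrow> P (T x)"
    and con: "\<And>x y. P x \<Longrightarrow> P y \<Longrightarrow> N (T x -. T y) \<le> q * N (x -. y)" and q: "q < 1"
    and closed: "\<And>x. (\<And>e. e > 0 \<Longrightarrow> \<exists>y. P y \<and> N (x -. y) < e) \<Longrightarrow> P x"
  shows "\<exists>x. P x \<and> T x = x"
proof -
  let ?d = "\<lambda>x y. N (x -. y)"
  interpret M: Metric_space "{x. P x}" ?d
    by unfold_locales (auto simp: N_diff_commute N_zero_iff N_diff_triangle)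
  have "M.mcomplete"
    unfolding M.mcomplete_def
  proof (intro allI impI)
    fix X assume "M.MCauchy X"
    then have P: "\<And>n. P (X n)" and C: "\<forall>e>0. \<exists>M. \<forall>m n. M \<le> m \<longrightarrow> M \<le> n \<longrightarrow> N (X m -. X n) < e"
      unfolding M.MCauchy_def by auto
    then obtain l where l: "\<forall>e>0. \<exists>M. \<forall>n\<ge>M. N (X n -. l) < e"
      using ax(21)[of X] by (simp del: N_diff_commute) blast
    have "P l"
    proof (rule closed)
      fix e :: real assume "e > 0"
      then obtain n where "N (X n -. l) < e" using l by blast
      then show "\<exists>y. P y \<and> N (l -. y) < e" using P N_diff_commute by metis
    qed
    then show "\<exists>x. limitin M.mtopology X x sequentially"
      using l P \<open>P l\<close> unfolding M.limit_metric_sequentially by (intro exI[of _ l]) simp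
  qed
  then show ?thesis
    using M.Banach_fixedpoint_thm[of T q] P0 PT con q by (metis (no_types, lifting) Pi_I empty_iff mem_Collect_eq)
qed

section \<open>Selfadjoint elements of the bicommutant\<close>

lemma commute_closed:
  assumes "\<And>e. e > 0 \<Longrightarrow> \<exists>y. k *. y = y *. k \<and> N (x -. y) < e"
  shows "k *. x = x *. k"
proof -
  have "N (k *. x -. x *. k) \<le> 0 + e" if e: "e > 0" for e
  proof -
    have "0 < e / (2 * N k + 1)" using e by (simp add: add_nonneg_pos)
    then obtain y where y: "k *. y = y *. k" and d: "N (x -. y) < e / (2 * N k + 1)" using assms by blast
    have e: "k *. x -. x *. k = k *. (x -. y) -. (x -. y) *. k"
      using y by (simp add: algebra_simps)
    have "N (k *. x -. x *. k) \<le> N k * N (x -. y) + N (x -. y) * N k"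
      unfolding e using N_diff[of "k *. (x -. y)" "(x -. y) *. k"] ax(19)[of k "x -. y"] ax(19)[of "x -. y" k] by linarith
    also have "\<dots> \<le> N (x -. y) * (2 * N k + 1)" by (simp add: algebra_simps)
    also have "\<dots> \<le> e" using d by (simp add: pos_less_divide_eq add_nonneg_pos)
    finally show ?thesis by simp
  qed
  then have "N (k *. x -. x *. k) \<le> 0" by (rule field_le_epsilon)
  then have "N (k *. x -. x *. k) = 0" using N_nonneg order_antisym by blast
  then show ?thesis unfolding N_zero_iff by simp
qed

lemma st_closed:
  assumes "\<And>e. e > 0 \<Longrightarrow> \<exists>y. st y = y \<and> N (x -. y) < e"
  shows "st x = x"
proof -
  have "N (x -. st x) \<le> 0 + e" if e: "e > 0" for e
  proof -
    obtain y where y: "st y = y" and d: "N (x -. y) < e / 2" using assms[of "e/2"] e by auto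
    have "N (y -. st x) = N (st (y -. x))" using y by simp
    also have "\<dots> = N (x -. y)" unfolding N_st by (rule N_diff_commute)
    finally show ?thesis using N_diff_triangle[of x "st x" y] d by simp
  qed
  then have "N (x -. st x) \<le> 0" by (rule field_le_epsilon)
  then have "N (x -. st x) = 0" using N_nonneg order_antisym by blast
  then show ?thesis unfolding N_zero_iff by simp
qed

text \<open>The selfadjoint part of the bicommutant of \<open>h\<close>, standing in for real
  functions of \<open>h\<close>: closed under limits and under the operations used below, and any
  two members commute, since each of them commutes with \<open>h\<close>.\<close>

definition bicomm :: "'a \<Rightarrow> 'a \<Rightarrow> bool" where
  "bicomm h g \<longleftrightarrow> st g = g \<and> (\<forall>k. k *. h = h *. k \<longrightarrow> k *. g = g *. k)"

lemma bicomm_closed: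
  assumes "\<And>e. e > 0 \<Longrightarrow> \<exists>y. bicomm h y \<and> N (x -. y) < e"
  shows "bicomm h x"
  unfolding bicomm_def
proof (intro conjI allI impI)
  show "st x = x" using assms unfolding bicomm_def by (intro st_closed) blast
  fix k assume "k *. h = h *. k"
  then show "k *. x = x *. k" using assms unfolding bicomm_def by (intro commute_closed) blast
qed

lemma bicomm_self: "bicomm h g \<Longrightarrow> h *. g = g *. h" by (simp add: bicomm_def)

lemma bicomm_zero: "bicomm h (vzero A)"
  using R.diff_self st_diff unfolding bicomm_def by (metis R.mult_zero_left R.mult_zero_right)

lemma bicomm_add: "bicomm h x \<Longrightarrow> bicomm h y \<Longrightarrow> bicomm h (x +. y)"
  by (simp add: bicomm_def R.distrib_left R.distrib_right)

lemma bicomm_diff: "bicomm h x \<Longrightarrow> bicomm h y \<Longrightarrow> bicomm h (x -. y)"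
  by (simp add: bicomm_def R.left_diff_distrib R.right_diff_distrib)

lemma bicomm_scale: "bicomm h x \<Longrightarrow> bicomm h (of_real c \<cdot> x)"
  by (simp add: bicomm_def)

text \<open>\<open>y\<close> commutes with \<open>h\<close>, so it is among the \<open>k\<close>
  tested by \<open>bicomm h x\<close>; thus \<open>x\<close> and \<open>y\<close> commute and their
  product is selfadjoint.\<close>

lemma bicomm_mult:
  assumes h: "st h = h" and x: "bicomm h x" and y: "bicomm h y" shows "bicomm h (x *. y)"
proof -
  have "x *. y = y *. x" using x y bicomm_self unfolding bicomm_def by metis
  then show ?thesis using x y unfolding bicomm_def by (metis ax(9,15))
qed

lemma bicomm_refl: "st h = h \<Longrightarrow> bicomm h h" by (simp add: bicomm_def)

section \<open>Square roots, resolvents and the approximate unit\<close>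

lemma sqrt_exists:
  assumes h: "st h = h" and Nh: "N h < 1"
  shows "\<exists>g. bicomm h g \<and> g +. g = h +. g *. g"
proof -
  \<comment> \<open>The smaller root of \<open>r^2 - 2 r + N h = 0\<close>: the ball of radius
    \<open>r\<close> is mapped into itself, and \<open>r < 1\<close> is a Lipschitz constant of
    \<open>T\<close> there.\<close>
  define r where "r = 1 - sqrt (1 - N h)"
  have r: "0 \<le> r" "r < 1" using Nh by (auto simp: r_def)
  have rr: "N h + r * r = 2 * r"
    using Nh by (simp add: r_def algebra_simps)
  define T where "T g = of_real (1/2) \<cdot> (h +. g *. g)" for g
  have "\<exists>x. (N x \<le> r \<and> bicomm h x) \<and> T x = x"
  proof (rule fixed_point[where P = "\<lambda>x. N x \<le> r \<and> bicomm h x" and q = r])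
    show "N (vzero A) \<le> r \<and> bicomm h (vzero A)" using r bicomm_zero by simp
  next
    fix x assume x: "N x \<le> r \<and> bicomm h x"
    have "N (h +. x *. x) \<le> N h + r * r"
      using ax(17)[of h "x *. x"] ax(19)[of x x] mult_mono[of "N x" r "N x" r] x r by simp
    then have "N (T x) \<le> r" unfolding T_def ax(18) using rr by simp
    moreover have "bicomm h (T x)"
      unfolding T_def using x h by (intro bicomm_scale bicomm_add bicomm_mult bicomm_refl) auto
    ultimately show "N (T x) \<le> r \<and> bicomm h (T x)" by blast
  next
    fix x y assume x: "N x \<le> r \<and> bicomm h x" and y: "N y \<le> r \<and> bicomm h y"
    have "T x -. T y = of_real (1/2) \<cdot> (x *. (x -. y) +. (x -. y) *. y)"
      unfolding T_def scale_diff[symmetric]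
      by (rule arg_cong[of _ _ "vscale A (complex_of_real (1/2))"]) (simp add: algebra_simps)
    then have "N (T x -. T y) = 1/2 * N (x *. (x -. y) +. (x -. y) *. y)" by simp
    also have "\<dots> \<le> 1/2 * (N x * N (x -. y) + N (x -. y) * N y)"
      using ax(17)[of "x *. (x -. y)" "(x -. y) *. y"] ax(19)[of x "x -. y"] ax(19)[of "x -. y" y] by simp
    also have "\<dots> \<le> 1/2 * (r * N (x -. y) + N (x -. y) * r)"
      using x y by (intro mult_left_mono add_mono mult_right_mono) auto
    finally show "N (T x -. T y) \<le> r * N (x -. y)" by simp
  next
    fix x assume c: "\<And>e. e > 0 \<Longrightarrow> \<exists>y. (N y \<le> r \<and> bicomm h y) \<and> N (x -. y) < e"
    have "N x \<le> r + e" if e: "e > 0" for e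
    proof -
      obtain y where y: "N y \<le> r" and d: "N (x -. y) < e" using c e by blast
      have "x = y +. (x -. y)" by (metis R.diff_add_cancel ax(2))
      then show ?thesis using ax(17)[of y "x -. y"] y d by simp
    qed
    then have "N x \<le> r" by (rule field_le_epsilon)
    moreover have "bicomm h x" using c by (intro bicomm_closed) blast
    ultimately show "N x \<le> r \<and> bicomm h x" by blast
  qed (use r in auto)
  then obtain g where g: "bicomm h g" and T: "T g = g" by blast
  have "2 \<cdot> g = 2 \<cdot> T g" by (simp only: T)
  also have "\<dots> = h +. g *. g" by (simp add: T_def)
  finally show ?thesis using g double by metis
qed

text \<open>Formally \<open>1 - h^2 = (1 - g)^2\<close> with \<open>(1 - g)^2 + h^2 = 1\<close>, so
  \<open>norm_diff_mult_le\<close> with \<open>q = h\<close> makes multiplication by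
  \<open>1 - g\<close> contractive; it is applied twice.\<close>

lemma norm_diff_square_mult_le:
  assumes h: "st h = h" and Nh: "N h < 1"
  shows "N (b -. h *. h *. b) \<le> N b"
proof -
  have "N (h *. h) < 1"
    using ax(20)[of h] h Nh by (simp add: power_less_one_iff)
  then obtain g where g: "bicomm (h *. h) g" and e: "g +. g = h *. h +. g *. g"
    using sqrt_exists[of "h *. h"] h by auto
  have hg: "h *. g = g *. h" using g ax(9) unfolding bicomm_def by metis
  have le: "N (b -. g *. b) \<le> N b" for b
  proof (rule norm_diff_mult_le[OF _ h])
    show "st g = g" using g by (simp add: bicomm_def)
    show "g *. h = h *. g" using hg by simp
    show "g *. g +. h *. h = g +. g" unfolding e by (rule ax(2))
  qed
  have "(b -. g *. b) -. g *. (b -. g *. b) = b -. (g +. g) *. b +. g *. g *. b"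
    by (simp add: algebra_simps)
  also have "\<dots> = b -. h *. h *. b"
    unfolding e by (simp add: algebra_simps)
  finally show ?thesis using le[of "b -. g *. b"] le[of b] by simp
qed

text \<open>Here \<open>u = h\<^sup>2 (h\<^sup>2 + e)\<^sup>-\<^sup>1\<close>, written without a unit of the algebra.\<close>

lemma resolvent_exists:
  assumes h: "st h = h" and Nh: "N h < 1" and e: "e > 0"
  shows "\<exists>u. bicomm h u \<and> of_real e \<cdot> u = h *. h -. h *. h *. u"
proof -
  \<comment> \<open>Fixed points of \<open>T\<close> solve
    \<open>(1 + e) u = h^2 + (u - h^2 u)\<close>, the desired equation with \<open>u\<close> added.
    By \<open>norm_diff_square_mult_le\<close> the right side is nonexpansive in \<open>u\<close>,
    so \<open>1 / (1 + e)\<close> is a contraction constant.\<close>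
  define T where "T u = of_real (1 / (1 + e)) \<cdot> (h *. h +. (u -. h *. h *. u))" for u
  have "\<exists>x. bicomm h x \<and> T x = x"
  proof (rule fixed_point[where q = "1 / (1 + e)"])
    show "bicomm h (vzero A)" by (rule bicomm_zero)
    show "\<And>x. bicomm h x \<Longrightarrow> bicomm h (T x)"
      unfolding T_def using h by (intro bicomm_scale bicomm_add bicomm_diff bicomm_mult bicomm_refl) auto
    show "N (T x -. T y) \<le> 1 / (1 + e) * N (x -. y)" for x y
    proof -
      have "T x -. T y = of_real (1 / (1 + e)) \<cdot> ((x -. y) -. h *. h *. (x -. y))"
        unfolding T_def scale_diff[symmetric]
        by (rule arg_cong[of _ _ "vscale A (complex_of_real (1/(1+e)))"]) (simp add: algebra_simps)
      then have "N (T x -. T y) = 1 / (1 + e) * N ((x -. y) -. h *. h *. (x -. y))"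
        using e by (simp only: ax(18) norm_of_real) simp
      also have "\<dots> \<le> 1 / (1 + e) * N (x -. y)"
        using norm_diff_square_mult_le[OF h Nh] e by (intro mult_left_mono) auto
      finally show ?thesis .
    qed
    show "\<And>x. (\<And>e. 0 < e \<Longrightarrow> \<exists>y. bicomm h y \<and> N (x -. y) < e) \<Longrightarrow> bicomm h x"
      by (rule bicomm_closed)
  qed (use e in auto)
  then obtain u where u: "bicomm h u" and T: "T u = u" by blast
  have "of_real (1 + e) \<cdot> u = of_real (1 + e) \<cdot> T u" by (simp only: T)
  also have "\<dots> = (of_real (1 + e) * of_real (1 / (1 + e))) \<cdot> (h *. h +. (u -. h *. h *. u))"
    unfolding T_def ax(7) ..
  also have "of_real (1 + e) * of_real (1 / (1 + e)) = (1 :: complex)"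
    using e by (simp only: of_real_mult[symmetric]) simp
  finally have "u +. of_real e \<cdot> u = u +. (h *. h -. h *. h *. u)"
    using ax(6)[of 1 "of_real e" u] by (simp add: algebra_simps)
  then show ?thesis using u R.add_left_cancel by blast
qed

text \<open>From \<open>(1 - u) h^2 = e u\<close> follows
  \<open>((1 - u) h)^2 = e u (1 - u)\<close>. It yields the unitarity relation in
  \<open>resolvent_norm\<close> and the smallness of \<open>(1 - u) h\<close> in
  \<open>approximate_unit\<close>.\<close>

lemma resolvent_square:
  assumes h: "st h = h" and u: "bicomm h u" and eq: "of_real e \<cdot> u = h *. h -. h *. h *. u"
  shows "(h -. u *. h) *. (h -. u *. h) = of_real e \<cdot> (u -. u *. u)"
proof -
  have hu: "h *. u = u *. h" by (rule bicomm_self[OF u])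
  have "(h -. u *. h) *. (h -. u *. h) = (h -. u *. h) *. (h -. h *. u)" by (simp only: hu)
  also have "\<dots> = (h *. h -. h *. h *. u) -. u *. (h *. h -. h *. h *. u)"
    by (simp add: algebra_simps)
  also have "\<dots> = of_real e \<cdot> (u -. u *. u)" unfolding eq[symmetric] by (simp add: scale_diff)
  finally show ?thesis .
qed

text \<open>\<open>2 u - 1\<close> is the real part of the Cayley transform \<open>(h + \<i>\<surd>e) (h - \<i>\<surd>e)\<^sup>-\<^sup>1\<close>.\<close>

lemma resolvent_norm:
  assumes h: "st h = h" and e: "e > 0" and u: "bicomm h u"
    and eq: "of_real e \<cdot> u = h *. h -. h *. h *. u"
  shows "N u \<le> 1"
proof -
  \<comment> \<open>As \<open>1 - u = e (h^2 + e)^-1\<close>, this \<open>c\<close> makes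
    \<open>q\<close> the imaginary part \<open>2 sqrt e h (h^2 + e)^-1\<close> of the Cayley
    transform.\<close>
  define c where "c = 2 / sqrt e"
  define q where "q = of_real c \<cdot> (h -. u *. h)"
  have cc: "c * c * e = 4" using e by (simp add: c_def)
  have uh: "bicomm h (h -. u *. h)" using h u by (intro bicomm_diff bicomm_mult bicomm_refl)
  have bq: "bicomm h q" unfolding q_def using uh by (rule bicomm_scale)
  have bp: "bicomm h (u +. u)" using u bicomm_add by blast
  have "q *. q = (of_real c * of_real c) \<cdot> ((h -. u *. h) *. (h -. u *. h))" by (simp add: q_def)
  also have "\<dots> = of_real (c * c * e) \<cdot> (u -. u *. u)"
    unfolding resolvent_square[OF h u eq] by simp
  finally have qq: "q *. q = 4 \<cdot> (u -. u *. u)" unfolding cc by simp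
  have pp: "(u +. u) *. (u +. u) = 4 \<cdot> (u *. u)" unfolding double by simp
  \<comment> \<open>\<open>norm_diff_mult_le\<close> with \<open>p = 2 u\<close> and
    \<open>b = u\<close>: the bound \<open>N (u - 2 u^2) <= N u\<close> gives
    \<open>2 N (u^2) <= 2 N u\<close>, and \<open>N (u^2) = (N u)^2\<close>.\<close>
  have "N (u -. (u +. u) *. u) \<le> N u"
  proof (rule norm_diff_mult_le)
    show "st (u +. u) = u +. u" "st q = q" using bp bq by (auto simp: bicomm_def)
    show "(u +. u) *. q = q *. (u +. u)" using bp bq bicomm_self unfolding bicomm_def by metis
    show "(u +. u) *. (u +. u) +. q *. q = u +. u +. (u +. u)"
    proof -
      have "u *. u +. (u -. u *. u) = u" by (metis R.diff_add_cancel ax(2))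
      then show ?thesis unfolding pp qq scale_add[symmetric] by (simp add: double)
    qed
  qed
  moreover have "2 \<cdot> (u *. u) = u -. (u -. (u +. u) *. u)"
    by (simp add: double algebra_simps)
  ultimately have "N (2 \<cdot> (u *. u)) \<le> N u + N u" using N_diff[of u "u -. (u +. u) *. u"] by simp
  moreover have "st u = u" using u by (simp add: bicomm_def)
  ultimately have "N u * N u \<le> N u * 1" using ax(20)[of u] by (simp add: power2_eq_square)
  then show ?thesis using N_nonneg[of u] by (cases "N u = 0") (auto simp: mult_le_cancel_left)
qed

text \<open>With \<open>h = t a (st a)\<close> one has
  \<open>t (N ((1 - u) a))^2 = N ((1 - u) h (1 - u))\<close>, which is at most
  \<open>2 N ((1 - u) h)\<close>, and this is small by \<open>resolvent_square\<close>.\<close>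

lemma approximate_unit:
  assumes e: "e > 0"
  shows "\<exists>u. st u = u \<and> N u \<le> 1 \<and> N (a -. u *. a) \<le> e"
proof -
  define t where "t = 1 / ((N a)\<^sup>2 + 1)"
  have t: "t > 0" by (simp add: t_def add_nonneg_pos)
  define h where "h = of_real t \<cdot> (a *. st a)"
  have h: "st h = h" by (simp add: h_def)
  have "N h = t * (N a)\<^sup>2" using t by (simp add: h_def N_mult_st)
  also have "\<dots> < 1" by (simp add: t_def divide_less_eq add_nonneg_pos)
  finally have Nh: "N h < 1" .
  \<comment> \<open>Below, \<open>(N y)^2 <= 2 d\<close>; this \<open>d\<close> makes
    \<open>2 N y <= t e^2\<close>, and the factor \<open>t\<close> cancels at the end.\<close>
  define d where "d = (t * e\<^sup>2 / 2)\<^sup>2 / 2"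
  have d: "d > 0" using t e by (simp add: d_def)
  obtain u where u: "bicomm h u" and eq: "of_real d \<cdot> u = h *. h -. h *. h *. u"
    using resolvent_exists[OF h Nh d] by blast
  have Nu: "N u \<le> 1" by (rule resolvent_norm[OF h d u eq])
  have stu: "st u = u" using u by (simp add: bicomm_def)
  define y where "y = h -. u *. h"
  have sty: "st y = y" unfolding y_def using h stu bicomm_self[OF u] by simp
  have uu: "N (u *. u) \<le> 1" using ax(19)[of u u] mult_mono[OF Nu Nu] by simp
  have "(N y)\<^sup>2 = N (of_real d \<cdot> (u -. u *. u))"
    using ax(20)[of y] resolvent_square[OF h u eq] sty unfolding y_def by simp
  also have "\<dots> = d * N (u -. u *. u)" using d by simp
  also have "\<dots> \<le> d * 2" using N_diff[of u "u *. u"] Nu uu d by (intro mult_left_mono) auto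
  also have "\<dots> = (t * e\<^sup>2 / 2)\<^sup>2" by (simp add: d_def)
  finally have Ny: "N y \<le> t * e\<^sup>2 / 2" by (rule power2_le_imp_le) (use t in simp)
  have "y -. y *. u = of_real t \<cdot> ((a -. u *. a) *. st (a -. u *. a))"
    using stu by (simp add: y_def h_def scale_diff scale_add algebra_simps)
  then have "t * (N (a -. u *. a))\<^sup>2 = N (y -. y *. u)"
    using t by (simp only: ax(18) N_mult_st norm_of_real abs_of_pos)
  also have "\<dots> \<le> N y + N y * N u" using N_diff[of y "y *. u"] ax(19)[of y u] by simp
  also have "\<dots> \<le> N y + N y * 1" using Nu by (intro add_left_mono mult_left_mono) auto
  also have "\<dots> \<le> t * e\<^sup>2" using Ny by simp
  finally have "(N (a -. u *. a))\<^sup>2 \<le> e\<^sup>2" using t by simp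
  then have "N (a -. u *. a) \<le> e" by (rule power2_le_imp_le) (use e in simp)
  then show ?thesis using stu Nu by blast
qed

text \<open>For \<open>\<parallel>a\<parallel> < 1\<close> write \<open>1 - a\<^sup>* a = (1 - g)\<^sup>2\<close>; then \<open>\<parallel>x\<parallel>\<^sup>2 - \<parallel>\<pi>(a) x\<parallel>\<^sup>2 = \<parallel>x - \<pi>(g) x\<parallel>\<^sup>2\<close>.\<close>

lemma star_rep_contractive:
  fixes ip :: "'v \<Rightarrow> 'v \<Rightarrow> complex" and add :: "'v \<Rightarrow> 'v \<Rightarrow> 'v" and scale :: "complex \<Rightarrow> 'v \<Rightarrow> 'v"
  assumes "semi_inner C add scale ip"
    and cl: "\<And>a x. x \<in> C \<Longrightarrow> \<pi> a x \<in> C"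
    and pa: "\<And>a b x y. x \<in> C \<Longrightarrow> y \<in> C \<Longrightarrow> ip (\<pi> (a +. b) x) y = ip (\<pi> a x) y + ip (\<pi> b x) y"
    and ps: "\<And>c a x y. x \<in> C \<Longrightarrow> y \<in> C \<Longrightarrow> ip (\<pi> (c \<cdot> a) x) y = c * ip (\<pi> a x) y"
    and pm: "\<And>a b x y. x \<in> C \<Longrightarrow> y \<in> C \<Longrightarrow> ip (\<pi> (a *. b) x) y = ip (\<pi> a (\<pi> b x)) y"
    and pst: "\<And>a x y. x \<in> C \<Longrightarrow> y \<in> C \<Longrightarrow> ip (\<pi> (st a) x) y = ip x (\<pi> a y)"
    and x: "x \<in> C"
  shows "semi_inner.nrm ip (\<pi> a x) \<le> N a * semi_inner.nrm ip x"
proof -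
  interpret S: semi_inner C add scale ip by fact
  have small: "S.nrm (\<pi> a x) \<le> S.nrm x" if a: "N a < 1" for a
  proof -
    define h where "h = st a *. a"
    have h: "st h = h" by (simp add: h_def)
    have "N h < 1" using a ax(20)[of a] power_less_one_iff[of "N a" 2] by (simp add: h_def)
    then obtain g where g: "bicomm h g" and e: "g +. g = h +. g *. g"
      using sqrt_exists[OF h] by blast
    have stg: "st g = g" using g by (simp add: bicomm_def)
    have g1: "ip x (\<pi> g x) = ip (\<pi> g x) x" using pst[of x x g] x stg by simp
    have g2: "ip (\<pi> g x) (\<pi> g x) = ip (\<pi> (g *. g) x) x"
      using pst[of "\<pi> g x" x g] pm[of x x g g] x stg cl by simp
    have "ip (\<pi> g x) x + ip (\<pi> g x) x = ip (\<pi> h x) x + ip (\<pi> (g *. g) x) x"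
      using arg_cong[OF e, of "\<lambda>z. ip (\<pi> z x) x"] x by (simp add: pa)
    moreover have "ip (\<pi> h x) x = ip (\<pi> a x) (\<pi> a x)"
      using pst[of "\<pi> a x" x a] pm[of x x "st a" a] x cl by (simp add: h_def)
    ultimately have "ip (S.dif x (\<pi> g x)) (S.dif x (\<pi> g x)) = ip x x - ip (\<pi> a x) (\<pi> a x)"
      using x cl g1 g2 by (simp add: algebra_simps)
    then have "Re (ip x x - ip (\<pi> a x) (\<pi> a x)) \<ge> 0"
      using S.ip_nonneg[of "S.dif x (\<pi> g x)"] x cl by (simp only: S.dif_closed)
    then have "Re (ip (\<pi> a x) (\<pi> a x)) \<le> Re (ip x x)" by simp
    then show ?thesis by (simp add: S.nrm_def)
  qed
  have big: "S.nrm (\<pi> a x) \<le> s * S.nrm x" if s: "N a < s" for s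
  proof -
    have s0: "s > 0" using s N_nonneg[of a] by linarith
    have "N (of_real (1/s) \<cdot> a) < 1" using s s0 by (simp add: norm_divide)
    then have "S.nrm (\<pi> (of_real (1/s) \<cdot> a) x) \<le> S.nrm x" by (rule small)
    \<comment> \<open>Homogeneity of \<open>\<pi>\<close> is given only under \<open>ip\<close>, so
      the two vectors may differ; their inner products with every vector agree, hence also their
      norms.\<close>
    moreover have "S.nrm (\<pi> (of_real (1/s) \<cdot> a) x) = S.nrm (scale (of_real (1/s)) (\<pi> a x))"
    proof (rule S.nrm_cong)
      let ?y = "\<pi> (of_real (1/s) \<cdot> a) x"
      have *: "ip ?y z = ip (scale (of_real (1/s)) (\<pi> a x)) z" if "z \<in> C" for z
        using that x cl ps by simp
      have "ip ?y ?y = ip (scale (of_real (1/s)) (\<pi> a x)) ?y" using x cl * by blast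
      also have "\<dots> = cnj (ip ?y (scale (of_real (1/s)) (\<pi> a x)))" using x cl by (intro S.ip_cnj) auto
      also have "\<dots> = cnj (ip (scale (of_real (1/s)) (\<pi> a x)) (scale (of_real (1/s)) (\<pi> a x)))"
        by (subst *) (use x cl in auto)
      also have "\<dots> = ip (scale (of_real (1/s)) (\<pi> a x)) (scale (of_real (1/s)) (\<pi> a x))"
        using x cl by (intro S.ip_cnj[symmetric]) auto
      finally show "ip ?y ?y = ip (scale (of_real (1/s)) (\<pi> a x)) (scale (of_real (1/s)) (\<pi> a x))" .
    qed (use x cl in auto)
    ultimately have "1/s * S.nrm (\<pi> a x) \<le> S.nrm x" using x cl s0 by (simp add: norm_divide)
    then show ?thesis using s0 by (simp add: field_simps)
  qed
  show ?thesis
  proof (rule field_le_epsilon)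
    fix e :: real assume e: "e > 0"
    have n: "0 \<le> S.nrm x" using x by simp
    have "S.nrm (\<pi> a x) \<le> (N a + e / (S.nrm x + 1)) * S.nrm x" using e n by (intro big) simp
    also have "\<dots> = N a * S.nrm x + e * (S.nrm x / (S.nrm x + 1))" by (simp add: algebra_simps)
    also have "\<dots> \<le> N a * S.nrm x + e * 1" using e n by (intro add_left_mono mult_left_mono) auto
    finally show "S.nrm (\<pi> a x) \<le> N a * S.nrm x + e" by simp
  qed
qed

end

section \<open>Completion of a semi-inner product space\<close>

context semi_inner begin

lemma Cauchy_seq_const: "a \<in> C \<Longrightarrow> Cauchy_seq (\<lambda>_. a)"
  using nrm_sq[of "a \<ominus> a"] by (simp add: Cauchy_seq_def)

lemma Cauchy_seq_bounded:
  assumes "Cauchy_seq Y" shows "\<exists>R\<ge>0. \<forall>n. nrm (Y n) \<le> R"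
proof -
  have YC: "Y n \<in> C" for n using assms by (rule Cauchy_seqD)
  have "Cauchy (\<lambda>n. nrm (Y n))"
    unfolding Cauchy_def dist_real_def
  proof (intro allI impI)
    fix e :: real assume "e > 0"
    then obtain M where "\<forall>m\<ge>M. \<forall>n\<ge>M. nrm (Y m \<ominus> Y n) < e" using assms unfolding Cauchy_seq_def by blast
    then show "\<exists>M. \<forall>m\<ge>M. \<forall>n\<ge>M. \<bar>nrm (Y m) - nrm (Y n)\<bar> < e"
      using nrm_rev_triangle[OF YC YC] by (meson order_le_less_trans)
  qed
  then have "Bseq (\<lambda>n. nrm (Y n))" by (intro Cauchy_Bseq)
  then obtain R where "R > 0" and R: "\<And>n. norm (nrm (Y n)) \<le> R" unfolding Bseq_def by blast
  have "nrm (Y n) \<le> R" for n using R[of n] by simp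
  then show ?thesis using \<open>R > 0\<close> by (intro exI[of _ R]) simp
qed

end

locale semi_inner_univ = semi_inner UNIV add scale ip
  for add :: "'v \<Rightarrow> 'v \<Rightarrow> 'v" (infixl "\<oplus>" 65)
    and scale :: "complex \<Rightarrow> 'v \<Rightarrow> 'v" (infixr "\<odot>" 75)
    and ip :: "'v \<Rightarrow> 'v \<Rightarrow> complex"
begin

text \<open>The completion is realised as the space of bounded antilinear functionals:
  \<open>x\<close> corresponds to \<open>\<langle>x, -\<rangle>\<close>.\<close>

definition adual :: "('v \<Rightarrow> complex) set" where
  "adual = {k. (\<exists>B. \<forall>b. cmod (k b) \<le> B * nrm b) \<and> (\<forall>a b. k (a \<oplus> b) = k a + k b)
      \<and> (\<forall>c a. k (c \<odot> a) = cnj c * k a)}"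
definition repr :: "(nat \<Rightarrow> 'v) \<Rightarrow> ('v \<Rightarrow> complex) \<Rightarrow> bool" where
  "repr X k \<longleftrightarrow> Cauchy_seq X \<and> (\<forall>v. (\<lambda>n. ip (X n) v) \<longlonglongrightarrow> k v)"
text \<open>Injective on \<open>adual\<close> (\<open>inj_repseq\<close>), so these sequences also
  serve as new names for the points of the completion.\<close>

definition repseq :: "('v \<Rightarrow> complex) \<Rightarrow> nat \<Rightarrow> 'v" where "repseq k = (SOME X. repr X k)"
text \<open>\<open>k\<close> stands for \<open>\<langle>k, -\<rangle>\<close>, so its values along a
  sequence representing \<open>l\<close> tend to \<open>\<langle>k, l\<rangle>\<close>;
  \<open>adual_ip_lim\<close> removes the dependence on the chosen sequence.\<close>

definition adual_ip :: "('v \<Rightarrow> complex) \<Rightarrow> ('v \<Rightarrow> complex) \<Rightarrow> complex" where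
  "adual_ip k l = lim (\<lambda>n. k (repseq l n))"
definition adual_norm :: "('v \<Rightarrow> complex) \<Rightarrow> real" where "adual_norm k = sqrt (Re (adual_ip k k))"
definition completion :: "('v \<Rightarrow> complex) hilb" where
  "completion = \<lparr>vcarrier = adual, vzero = (\<lambda>_. 0), vadd = (\<lambda>k l b. k b + l b),
     vscale = (\<lambda>c k b. c * k b), hinner = adual_ip\<rparr>"

lemma adual_add: "k \<in> adual \<Longrightarrow> k (a \<oplus> b) = k a + k b" by (simp add: adual_def)
lemma adual_scale: "k \<in> adual \<Longrightarrow> k (c \<odot> a) = cnj c * k a" by (simp add: adual_def)
lemma adual_dif: "k \<in> adual \<Longrightarrow> k (a \<ominus> b) = k a - k b" by (simp add: adual_add adual_scale dif_def)
lemma adual_bound: "k \<in> adual \<Longrightarrow> \<exists>B\<ge>0. \<forall>b. cmod (k b) \<le> B * nrm b"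
proof -
  assume "k \<in> adual"
  then obtain B where B: "\<And>b. cmod (k b) \<le> B * nrm b" unfolding adual_def by blast
  have "cmod (k b) \<le> \<bar>B\<bar> * nrm b" for b
    by (rule order_trans[OF B[of b] mult_right_mono[OF abs_ge_self nrm_ge0[OF UNIV_I]]])
  then show ?thesis by (intro exI[of _ "\<bar>B\<bar>"]) simp
qed

lemma adualI:
  assumes "\<And>b. cmod (k b) \<le> B * nrm b" "\<And>a b. k (a \<oplus> b) = k a + k b" "\<And>c a. k (c \<odot> a) = cnj c * k a"
  shows "k \<in> adual"
  using assms unfolding adual_def by blast

lemma adual_plus: assumes k: "k \<in> adual" and l: "l \<in> adual" shows "(\<lambda>b. k b + l b) \<in> adual"
proof -
  obtain B B' where "\<And>b. cmod (k b) \<le> B * nrm b" "\<And>b. cmod (l b) \<le> B' * nrm b"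
    using adual_bound[OF k] adual_bound[OF l] by blast
  then have "cmod (k b + l b) \<le> (B + B') * nrm b" for b
    using norm_triangle_ineq[of "k b" "l b"] by (smt (verit) distrib_right)
  then show ?thesis using k l by (intro adualI[where B = "B + B'"]) (auto simp: adual_add adual_scale algebra_simps)
qed

lemma adual_times: assumes k: "k \<in> adual" shows "(\<lambda>b. c * k b) \<in> adual"
proof -
  obtain B where "\<And>b. cmod (k b) \<le> B * nrm b" using adual_bound[OF k] by blast
  then have "cmod (c * k b) \<le> (cmod c * B) * nrm b" for b
    by (simp add: norm_mult mult.assoc mult_left_mono)
  then show ?thesis using k by (intro adualI[where B = "cmod c * B"]) (auto simp: adual_add adual_scale algebra_simps)
qed

lemma adual_zero: "(\<lambda>_. 0) \<in> adual" by (rule adualI[where B = 0]) auto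

lemma adual_minus: assumes k: "k \<in> adual" and l: "l \<in> adual" shows "(\<lambda>b. k b - l b) \<in> adual"
  using adual_plus[OF k adual_times[OF l, of "-1"]] by simp

lemma repseq: assumes k: "k \<in> adual" shows "repr (repseq k) k"
proof -
  obtain B where B: "\<And>b. cmod (k b) \<le> B * nrm b" using adual_bound[OF k] by blast
  have "\<exists>X. Cauchy_seq X \<and> (\<forall>v\<in>UNIV. (\<lambda>n. ip v (X n)) \<longlonglongrightarrow> cnj (k v))"
    by (rule riesz_sequence[where B = B]) (use k B in \<open>auto simp: adual_add adual_scale\<close>)
  then obtain X where X: "Cauchy_seq X" and lim: "\<And>v. (\<lambda>n. ip v (X n)) \<longlonglongrightarrow> cnj (k v)" by blast
  have "(\<lambda>n. ip (X n) v) \<longlonglongrightarrow> k v" for v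
    using tendsto_cnj[OF lim[of v]] ip_cnj[of v "X _"] by (simp add: fun_eq_iff) 
  then have "repr X k" using X by (simp add: repr_def)
  then show ?thesis unfolding repseq_def by (rule someI[of "\<lambda>X. repr X k"])
qed

text \<open>Cauchy-Schwarz turns the Cauchy property into an estimate for all \<open>b\<close> at
  once, so the pointwise limit is uniform on bounded sets.\<close>

lemma repr_approx:
  assumes X: "repr X k" and e: "e > 0"
  shows "\<exists>M. \<forall>n\<ge>M. \<forall>b. cmod (k b - ip (X n) b) \<le> e * nrm b"
proof -
  obtain M where M: "\<And>m n. m \<ge> M \<Longrightarrow> n \<ge> M \<Longrightarrow> nrm (X m \<ominus> X n) < e"
    using X e unfolding repr_def Cauchy_seq_def by blast
  have "cmod (k b - ip (X n) b) \<le> e * nrm b" if n: "n \<ge> M" for n b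
  proof (rule tendsto_upperbound)
    show "(\<lambda>m. cmod (ip (X m) b - ip (X n) b)) \<longlonglongrightarrow> cmod (k b - ip (X n) b)"
      using X unfolding repr_def by (intro tendsto_intros) blast
    have "cmod (ip (X m) b - ip (X n) b) \<le> e * nrm b" if "m \<ge> M" for m
    proof -
      have "cmod (ip (X m) b - ip (X n) b) \<le> nrm (X m \<ominus> X n) * nrm b"
        using cauchy_schwarz[of "X m \<ominus> X n" b] by simp
      also have "\<dots> \<le> e * nrm b" using M[OF that n] by (intro mult_right_mono) auto
      finally show ?thesis .
    qed
    then show "eventually (\<lambda>m. cmod (ip (X m) b - ip (X n) b) \<le> e * nrm b) sequentially"
      unfolding eventually_sequentially by blast
  qed simp
  then show ?thesis by blast
qed

lemma pair_lim:
  assumes X: "repr X k" and Y: "Cauchy_seq Y"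
  shows "(\<lambda>n. k (Y n) - ip (X n) (Y n)) \<longlonglongrightarrow> 0"
  unfolding LIMSEQ_iff
proof (intro allI impI)
  fix e :: real assume e: "e > 0"
  obtain R where R: "R \<ge> 0" "\<And>n. nrm (Y n) \<le> R" using Cauchy_seq_bounded[OF Y] by blast
  have e': "e / (R + 1) > 0" using e R by simp
  obtain M where M: "\<And>n b. n \<ge> M \<Longrightarrow> cmod (k b - ip (X n) b) \<le> e / (R + 1) * nrm b"
    using repr_approx[OF X e'] by blast
  have "cmod (k (Y n) - ip (X n) (Y n) - 0) < e" if "n \<ge> M" for n
  proof -
    have "cmod (k (Y n) - ip (X n) (Y n)) \<le> e / (R + 1) * nrm (Y n)" by (rule M[OF that])
    also have "\<dots> \<le> e / (R + 1) * R" using e' R by (intro mult_left_mono) auto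
    also have "\<dots> < e" using e R by (simp add: field_simps)
    finally show ?thesis by simp
  qed
  then show "\<exists>M. \<forall>n\<ge>M. cmod (k (Y n) - ip (X n) (Y n) - 0) < e" by blast
qed

lemma adual_convergent:
  assumes k: "k \<in> adual" and Y: "Cauchy_seq Y" shows "convergent (\<lambda>n. k (Y n))"
proof -
  obtain B where B: "B \<ge> 0" "\<And>b. cmod (k b) \<le> B * nrm b" using adual_bound[OF k] by blast
  have "Cauchy (\<lambda>n. k (Y n))"
    unfolding Cauchy_def dist_norm
  proof (intro allI impI)
    fix e :: real assume e: "e > 0"
    then obtain M where M: "\<And>m n. m \<ge> M \<Longrightarrow> n \<ge> M \<Longrightarrow> nrm (Y m \<ominus> Y n) < e / (B + 1)"
      using Y B unfolding Cauchy_seq_def by (meson add_nonneg_pos divide_pos_pos zero_less_one)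
    have "cmod (k (Y m) - k (Y n)) < e" if "m \<ge> M" "n \<ge> M" for m n
    proof -
      have "cmod (k (Y m) - k (Y n)) \<le> B * nrm (Y m \<ominus> Y n)" using B(2)[of "Y m \<ominus> Y n"] adual_dif[OF k] by simp
      also have "\<dots> \<le> B * (e / (B + 1))" using M[OF that] B by (intro mult_left_mono) auto
      also have "\<dots> < e" using e B by (simp add: field_simps)
      finally show ?thesis .
    qed
    then show "\<exists>M. \<forall>m\<ge>M. \<forall>n\<ge>M. cmod (k (Y m) - k (Y n)) < e" by blast
  qed
  then show ?thesis by (simp add: Cauchy_convergent_iff)
qed

text \<open>By \<open>pair_lim\<close>, \<open>k (Y n)\<close> and the conjugate of
  \<open>l (X n)\<close> both differ from \<open>ip (X n) (Y n)\<close> by null sequences. This is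
  the source of hermitian symmetry and of independence of the representing sequence.\<close>

lemma swap_lim:
  assumes k: "k \<in> adual" and X: "repr X k" and l: "l \<in> adual" and Y: "repr Y l" and L: "(\<lambda>n. k (Y n)) \<longlonglongrightarrow> L"
  shows "(\<lambda>n. l (X n)) \<longlonglongrightarrow> cnj L" "(\<lambda>n. ip (X n) (Y n)) \<longlonglongrightarrow> L"
proof -
  have CX: "Cauchy_seq X" and CY: "Cauchy_seq Y" using X Y by (auto simp: repr_def)
  show 1: "(\<lambda>n. ip (X n) (Y n)) \<longlonglongrightarrow> L"
    using tendsto_diff[OF L pair_lim[OF X CY]] by simp
  have "(\<lambda>n. ip (Y n) (X n)) = (\<lambda>n. cnj (ip (X n) (Y n)))" using ip_cnj by blast
  then have "(\<lambda>n. ip (Y n) (X n)) \<longlonglongrightarrow> cnj L" using tendsto_cnj[OF 1] by simp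
  from tendsto_add[OF pair_lim[OF Y CX] this] show "(\<lambda>n. l (X n)) \<longlonglongrightarrow> cnj L" by simp
qed

lemma adual_ip_lim:
  assumes k: "k \<in> adual" and l: "l \<in> adual" and Y: "repr Y l"
  shows "(\<lambda>n. k (Y n)) \<longlonglongrightarrow> adual_ip k l"
proof -
  have lim: "\<exists>L. (\<lambda>n. k (Z n)) \<longlonglongrightarrow> L" if "repr Z l" for Z
    using adual_convergent[OF k] that unfolding repr_def convergent_def by blast
  obtain L where L: "(\<lambda>n. k (Y n)) \<longlonglongrightarrow> L" using lim[OF Y] by blast
  obtain L0 where L0: "(\<lambda>n. k (repseq l n)) \<longlonglongrightarrow> L0" using lim[OF repseq[OF l]] by blast
  \<comment> \<open>Two sequences representing \<open>l\<close> are compared through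
    \<open>l (repseq k n)\<close>, which involves neither of them.\<close>
  have "cnj L = cnj L0"
    using swap_lim(1)[OF k repseq[OF k] l Y L] swap_lim(1)[OF k repseq[OF k] l repseq[OF l] L0] 
    by (rule LIMSEQ_unique)
  then have "L = L0" by simp
  moreover have "adual_ip k l = L0" unfolding adual_ip_def using L0 by (rule limI)
  ultimately show ?thesis using L by simp
qed

lemma adual_ip_cnj: assumes k: "k \<in> adual" and l: "l \<in> adual" shows "adual_ip l k = cnj (adual_ip k l)"
  using swap_lim(1)[OF k repseq[OF k] l repseq[OF l] adual_ip_lim[OF k l repseq[OF l]]]
    adual_ip_lim[OF l k repseq[OF k]] LIMSEQ_unique by blast

lemma emb_adual: "ip a \<in> adual"
  by (rule adualI[where B = "nrm a"]) (auto simp: cauchy_schwarz)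

lemma emb_repr: "repr (\<lambda>_. a) (ip a)" by (simp add: repr_def Cauchy_seq_const)

lemma adual_ip_emb: assumes k: "k \<in> adual" shows "adual_ip k (ip a) = k a"
  using adual_ip_lim[OF k emb_adual emb_repr] LIMSEQ_unique tendsto_const by blast

lemma adual_ip_self_lim: 
  assumes k: "k \<in> adual" and X: "repr X k" 
  shows "(\<lambda>n. (nrm (X n))\<^sup>2) \<longlonglongrightarrow> Re (adual_ip k k)" 
  using tendsto_Re[OF swap_lim(2)[OF k X k X adual_ip_lim[OF k k X]]] by (simp add: nrm_sq)

lemma adual_ip_nonneg: assumes k: "k \<in> adual" shows "0 \<le> Re (adual_ip k k)"
  by (rule tendsto_lowerbound[OF adual_ip_self_lim[OF k repseq[OF k]]]) auto

lemma adual_ip_self: assumes k: "k \<in> adual" shows "adual_ip k k = of_real ((adual_norm k)\<^sup>2)"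
proof -
  have "Im (adual_ip k k) = Im (cnj (adual_ip k k))" by (rule arg_cong[OF adual_ip_cnj[OF k k]])
  then have "Im (adual_ip k k) = 0" unfolding cnj.sel by linarith
  then show ?thesis using adual_ip_nonneg[OF k] by (simp add: adual_norm_def complex_eq_iff)
qed

lemma adual_norm_nonneg: assumes k: "k \<in> adual" shows "0 \<le> adual_norm k" using adual_ip_nonneg[OF k] by (simp add: adual_norm_def)

lemma adual_norm_lim: assumes k: "k \<in> adual" and X: "repr X k" shows "(\<lambda>n. nrm (X n)) \<longlonglongrightarrow> adual_norm k"
  using tendsto_real_sqrt[OF adual_ip_self_lim[OF k X]] by (simp add: adual_norm_def)

lemma adual_norm_bound: assumes k: "k \<in> adual" shows "cmod (k b) \<le> adual_norm k * nrm b"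
proof (rule tendsto_le)
  have X: "repr (repseq k) k" by (rule repseq[OF k])
  show "(\<lambda>n. nrm (repseq k n) * nrm b) \<longlonglongrightarrow> adual_norm k * nrm b"
    by (intro tendsto_intros adual_norm_lim[OF k X])
  show "(\<lambda>n. cmod (ip (repseq k n) b)) \<longlonglongrightarrow> cmod (k b)"
    using X unfolding repr_def by (intro tendsto_intros) blast
qed (auto simp: cauchy_schwarz)

text \<open>With \<open>adual_norm_bound\<close> it identifies \<open>adual_norm\<close> as the
  operator norm, the form in which completeness and \<open>gns_rep\<close> use it.\<close>

lemma adual_norm_le:
  assumes k: "k \<in> adual" and B: "0 \<le> B" "\<And>b. cmod (k b) \<le> B * nrm b" shows "adual_norm k \<le> B"
proof -
  have X: "repr (repseq k) k" by (rule repseq[OF k])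
  have "cmod (adual_ip k k) \<le> B * adual_norm k"
  proof (rule tendsto_le)
    show "(\<lambda>n. B * nrm (repseq k n)) \<longlonglongrightarrow> B * adual_norm k"
      by (intro tendsto_intros adual_norm_lim[OF k X])
    show "(\<lambda>n. cmod (k (repseq k n))) \<longlonglongrightarrow> cmod (adual_ip k k)"
      by (intro tendsto_intros adual_ip_lim[OF k k X])
  qed (auto simp: B)
  then have "adual_norm k * adual_norm k \<le> B * adual_norm k" unfolding adual_ip_self[OF k] norm_of_real by (simp add: power2_eq_square)
  then show ?thesis using adual_norm_nonneg[OF k] B by (cases "adual_norm k = 0") auto
qed

lemma adual_ip_add: assumes "k \<in> adual" "l \<in> adual" "m \<in> adual" shows "adual_ip (\<lambda>b. k b + l b) m = adual_ip k m + adual_ip l m"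
  using tendsto_add[OF adual_ip_lim[OF assms(1,3) repseq[OF assms(3)]] adual_ip_lim[OF assms(2,3) repseq[OF assms(3)]]]
    adual_ip_lim[OF adual_plus[OF assms(1,2)] assms(3) repseq[OF assms(3)]] LIMSEQ_unique by blast

lemma adual_ip_times: assumes "k \<in> adual" "m \<in> adual" shows "adual_ip (\<lambda>b. c * k b) m = c * adual_ip k m"
  using tendsto_mult[OF tendsto_const adual_ip_lim[OF assms(1,2) repseq[OF assms(2)]], of c]
    adual_ip_lim[OF adual_times[OF assms(1)] assms(2) repseq[OF assms(2)]] LIMSEQ_unique by blast

lemma completion_simps [simp]:
  "vcarrier completion = adual" "vzero completion = (\<lambda>_. 0)"
  "vadd completion k l = (\<lambda>b. k b + l b)" "vscale completion c k = (\<lambda>b. c * k b)"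
  "hinner completion = adual_ip"
  by (simp_all add: completion_def)

lemma hnorm_completion: "hnorm completion k = adual_norm k" by (simp add: hnorm_def adual_norm_def)
lemma vdiff_completion: "vdiff completion k l = (\<lambda>b. k b - l b)" by (simp add: vdiff_def)

text \<open>Pointwise limits exist and are uniform on bounded sets by
  \<open>adual_norm_bound\<close>; \<open>adual_norm_le\<close> converts the uniform estimate back
  into norm convergence.\<close>

lemma completion_complete:
  fixes X :: "nat \<Rightarrow> 'v \<Rightarrow> complex"
  assumes XC: "\<And>n. X n \<in> adual" and cau: "\<forall>e>0. \<exists>M. \<forall>m\<ge>M. \<forall>n\<ge>M. adual_norm (\<lambda>b. X m b - X n b) < e"
  shows "\<exists>l\<in>adual. \<forall>e>0. \<exists>M. \<forall>n\<ge>M. adual_norm (\<lambda>b. X n b - l b) < e"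
proof -
  have le: "cmod (X m b - X n b) \<le> adual_norm (\<lambda>b. X m b - X n b) * nrm b" for m n b
    by (rule adual_norm_bound[OF adual_minus[OF XC XC]])
  have le': "cmod (X m b - X n b) \<le> e * nrm b" if "adual_norm (\<lambda>b. X m b - X n b) < e" for m n b e
    using le[of m b n] mult_right_mono[of "adual_norm (\<lambda>b. X m b - X n b)" e "nrm b"] that by simp
  have "Cauchy (\<lambda>n. X n b)" for b
    unfolding Cauchy_def dist_norm
  proof (intro allI impI)
    fix e :: real assume e: "e > 0"
    have nb: "0 \<le> nrm b" by simp
    have "e / (nrm b + 1) > 0" by (intro divide_pos_pos add_nonneg_pos e nb) simp
    then obtain M where M: "\<And>m n. m \<ge> M \<Longrightarrow> n \<ge> M \<Longrightarrow> adual_norm (\<lambda>b. X m b - X n b) < e / (nrm b + 1)"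
      using cau by blast
    have "cmod (X m b - X n b) < e" if "m \<ge> M" "n \<ge> M" for m n
    proof -
      have "cmod (X m b - X n b) \<le> e / (nrm b + 1) * nrm b" by (rule le'[OF M[OF that]])
      also have "\<dots> = e * (nrm b / (nrm b + 1))" by simp
      also have "\<dots> < e * 1"
        by (rule mult_strict_left_mono[OF _ e]) (use add_nonneg_pos[OF nb zero_less_one] in \<open>simp add: divide_less_eq\<close>)
      also have "\<dots> = e" by simp
      finally show ?thesis .
    qed
    then show "\<exists>M. \<forall>m\<ge>M. \<forall>n\<ge>M. cmod (X m b - X n b) < e" by blast
  qed
  then have "\<forall>b. \<exists>L. (\<lambda>n. X n b) \<longlonglongrightarrow> L" by (simp add: Cauchy_convergent_iff convergent_def)
  then obtain k where k: "\<And>b. (\<lambda>n. X n b) \<longlonglongrightarrow> k b" by metis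
  have near: "\<exists>M. \<forall>n\<ge>M. \<forall>b. cmod (X n b - k b) \<le> e * nrm b" if e: "e > 0" for e
  proof -
    obtain M where M: "\<And>m n. m \<ge> M \<Longrightarrow> n \<ge> M \<Longrightarrow> adual_norm (\<lambda>b. X m b - X n b) < e" using cau e by blast
    have "cmod (X n b - k b) \<le> e * nrm b" if n: "n \<ge> M" for n b
    proof (rule tendsto_upperbound)
      show "(\<lambda>m. cmod (X n b - X m b)) \<longlonglongrightarrow> cmod (X n b - k b)" by (intro tendsto_intros k)
      show "eventually (\<lambda>m. cmod (X n b - X m b) \<le> e * nrm b) sequentially"
        unfolding eventually_sequentially using le' M n by blast
    qed simp
    then show ?thesis by blast
  qed
  obtain M where M: "\<And>n b. n \<ge> M \<Longrightarrow> cmod (X n b - k b) \<le> 1 * nrm b" using near[of 1] by auto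
  obtain B where B: "\<And>b. cmod (X M b) \<le> B * nrm b" using adual_bound[OF XC] by blast
  have kC: "k \<in> adual"
  proof (rule adualI)
    fix b show "cmod (k b) \<le> (B + 1) * nrm b"
      using B[of b] M[of M b] norm_triangle_ineq4[of "X M b" "X M b - k b"] by (simp add: algebra_simps)
  next
    fix a b 
    have "(\<lambda>n. X n (a \<oplus> b)) = (\<lambda>n. X n a + X n b)" using adual_add[OF XC] by blast
    then show "k (a \<oplus> b) = k a + k b"
      using k[of "a \<oplus> b"] tendsto_add[OF k[of a] k[of b]] LIMSEQ_unique by metis
  next
    fix c a
    have "(\<lambda>n. X n (c \<odot> a)) = (\<lambda>n. cnj c * X n a)" using adual_scale[OF XC] by blast
    then show "k (c \<odot> a) = cnj c * k a"
      using k[of "c \<odot> a"] tendsto_mult[OF tendsto_const k[of a], of "cnj c"] LIMSEQ_unique by metis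
  qed
  have "\<exists>M. \<forall>n\<ge>M. adual_norm (\<lambda>b. X n b - k b) < e" if e: "e > 0" for e
  proof -
    obtain M where M: "\<And>n b. n \<ge> M \<Longrightarrow> cmod (X n b - k b) \<le> e/2 * nrm b" using near[of "e/2"] e by auto
    have "adual_norm (\<lambda>b. X n b - k b) \<le> e/2" if "n \<ge> M" for n
      by (rule adual_norm_le[OF adual_minus[OF XC kC]]) (use e M[OF that] in auto)
    moreover have "e/2 < e" using e by simp
    ultimately show ?thesis by (meson order_le_less_trans)
  qed
  then show ?thesis using kC by blast
qed

lemma completion_hilbert: "hilbert_space completion"
  unfolding hilbert_space_def complex_vector_space_def hnorm_completion vdiff_completion completion_simps
proof (intro conjI ballI allI impI)
  fix k assume k: "k \<in> adual" "adual_ip k k = 0"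
  then have "adual_norm k = 0" by (simp add: adual_norm_def)
  then have "cmod (k b) \<le> 0" for b using adual_norm_bound[OF k(1), of b] by simp
  then show "k = (\<lambda>_. 0)" by (simp add: fun_eq_iff)
next
  fix X :: "nat \<Rightarrow> 'v \<Rightarrow> complex"
  assume "(\<forall>n. X n \<in> adual) \<and> (\<forall>e>0. \<exists>N. \<forall>m\<ge>N. \<forall>n\<ge>N. adual_norm (\<lambda>b. X m b - X n b) < e)"
  then show "\<exists>l\<in>adual. \<forall>e>0. \<exists>N. \<forall>n\<ge>N. adual_norm (\<lambda>b. X n b - l b) < e" using completion_complete by blast
next
  show "\<And>k l. k \<in> adual \<Longrightarrow> l \<in> adual \<Longrightarrow> adual_ip l k = cnj (adual_ip k l)" by (rule adual_ip_cnj)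
qed (simp_all add: adual_zero adual_plus adual_times adual_ip_add adual_ip_times adual_ip_nonneg algebra_simps)

lemma inj_repseq: "inj_on repseq adual"
proof (rule inj_onI)
  fix k l assume k: "k \<in> adual" and l: "l \<in> adual" and eq: "repseq k = repseq l"
  have "k v = l v" for v using repseq[OF k] repseq[OF l] eq LIMSEQ_unique unfolding repr_def by metis
  then show "k = l" by blast
qed

end

text \<open>Moves a Hilbert space along an injection to another type. The completion lives on
  \<open>'a \<Rightarrow> complex\<close>, whereas the hypotheses of the theorem concern spaces on
  \<open>nat \<Rightarrow> 'a\<close>.\<close>

definition transport :: "('v \<Rightarrow> 'w) \<Rightarrow> 'v hilb \<Rightarrow> 'w hilb" where
  "transport j K = (let i = inv_into (vcarrier K) j in
    \<lparr>vcarrier = j ` vcarrier K, vzero = j (vzero K), vadd = (\<lambda>x y. j (vadd K (i x) (i y))),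
     vscale = (\<lambda>c x. j (vscale K c (i x))), hinner = (\<lambda>x y. hinner K (i x) (i y))\<rparr>)"

context
  fixes K :: "'v hilb" and j :: "'v \<Rightarrow> 'w"
  assumes K: "hilbert_space K" and j: "inj_on j (vcarrier K)"
begin

interpretation K: hilb K by (rule hilb.intro[OF K])

lemma transport_carrier: "vcarrier (transport j K) = j ` vcarrier K" "vzero (transport j K) = j (vzero K)"
  by (simp_all add: transport_def Let_def)

lemma transport_ops:
  "x \<in> vcarrier K \<Longrightarrow> y \<in> vcarrier K \<Longrightarrow> vadd (transport j K) (j x) (j y) = j (vadd K x y)"
  "x \<in> vcarrier K \<Longrightarrow> vscale (transport j K) c (j x) = j (vscale K c x)"
  "x \<in> vcarrier K \<Longrightarrow> y \<in> vcarrier K \<Longrightarrow> hinner (transport j K) (j x) (j y) = hinner K x y"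
  "x \<in> vcarrier K \<Longrightarrow> hnorm (transport j K) (j x) = hnorm K x"
  "x \<in> vcarrier K \<Longrightarrow> y \<in> vcarrier K \<Longrightarrow> vdiff (transport j K) (j x) (j y) = j (vdiff K x y)"
  using j by (simp_all add: transport_def Let_def inv_into_f_f hnorm_def vdiff_def)

lemma transport_hilbert: "hilbert_space (transport j K)"
proof -
  note [simp] = transport_ops
  note vs = K.vs[unfolded complex_vector_space_def]
  have zero: "j (vzero K) \<in> j ` vcarrier K" by simp
  have complete: "\<exists>l\<in>vcarrier K. \<forall>e>0. \<exists>N. \<forall>n\<ge>N. hnorm (transport j K) (vdiff (transport j K) (X n) (j l)) < e"
    if X: "\<forall>n. X n \<in> j ` vcarrier K"
      "\<forall>e>0. \<exists>N. \<forall>m\<ge>N. \<forall>n\<ge>N. hnorm (transport j K) (vdiff (transport j K) (X m) (X n)) < e" 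
    for X :: "nat \<Rightarrow> 'w"
  proof -
    from X(1) have "\<forall>n. \<exists>x\<in>vcarrier K. X n = j x" by auto
    then obtain Y where Y: "\<And>n. Y n \<in> vcarrier K" and XY: "\<And>n. X n = j (Y n)" by metis
    have n: "hnorm (transport j K) (vdiff (transport j K) (j x) (j y)) = hnorm K (vdiff K x y)"
      if "x \<in> vcarrier K" "y \<in> vcarrier K" for x y
      using that by (simp add: K.vdiff_eq)
    have "\<exists>l\<in>vcarrier K. \<forall>e>0. \<exists>N. \<forall>n\<ge>N. hnorm K (vdiff K (Y n) l) < e"
      using K.hilb_axioms(6)[rule_format, of Y] X(2) Y unfolding XY n[OF Y Y] by blast
    then show ?thesis using Y unfolding XY by (auto simp: K.vdiff_eq)
  qed
  have cvs: "complex_vector_space (transport j K)"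
    unfolding complex_vector_space_def transport_carrier ball_simps(9)
    using vs by (elim conjE) (intro conjI allI ballI; simp)
  show ?thesis
    unfolding hilbert_space_def transport_carrier ball_simps(9) bex_simps(7)
  proof (intro conjI cvs allI ballI impI)
    fix x y assume "x \<in> vcarrier K" "y \<in> vcarrier K"
    then show "hinner (transport j K) (j y) (j x) = cnj (hinner (transport j K) (j x) (j y))"
      using K.ip_cnj[of x y] by simp
  next
    fix X :: "nat \<Rightarrow> 'w"
    assume "(\<forall>n. X n \<in> j ` vcarrier K) \<and>
      (\<forall>e>0. \<exists>N. \<forall>m\<ge>N. \<forall>n\<ge>N. hnorm (transport j K) (vdiff (transport j K) (X m) (X n)) < e)"
    then show "\<exists>l\<in>vcarrier K. \<forall>e>0. \<exists>N. \<forall>n\<ge>N. hnorm (transport j K) (vdiff (transport j K) (X n) (j l)) < e"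
      using complete by blast
  next
    fix x assume "x \<in> vcarrier K" "hinner (transport j K) (j x) (j x) = 0"
    then show "j x = j (vzero K)" using K.ip_zero_imp[of x] by simp
  qed (simp_all add: K.ip_nonneg)
qed

lemma transport_rep:
  fixes A :: "'a cstar"
  assumes r: "is_rep A K \<pi>" and A: "vcarrier A = UNIV" and i: "\<And>x. x \<in> vcarrier K \<Longrightarrow> i (j x) = x"
  shows "is_rep A (transport j K) (\<lambda>a x. j (\<pi> a (i x)))"
proof -
  have cl: "\<forall>a\<in>vcarrier A. \<forall>x\<in>vcarrier K. \<pi> a x \<in> vcarrier K"
    using r unfolding is_rep_def by (rule conjunct1)
  show ?thesis
    using r cl unfolding is_rep_def transport_carrier ball_simps(9) A ball_UNIV
    by (elim conjE) (intro conjI; simp add: transport_ops i)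
qed

end

section \<open>The GNS construction\<close>

context cstar begin

context
  fixes \<phi> assumes \<phi>: "\<phi> \<in> quasi_states A"
begin

lemma qs_axioms:
  "\<forall>x y. \<phi> (x +. y) = \<phi> x + \<phi> y"
  "\<forall>c x. \<phi> (c \<cdot> x) = c * \<phi> x"
  "\<forall>b. Im (\<phi> (st b *. b)) = 0 \<and> 0 \<le> Re (\<phi> (st b *. b))"
  "\<forall>x. cmod (\<phi> x) \<le> N x"
  using \<phi> unfolding quasi_states_def univ ball_UNIV by auto

lemmas qs = qs_axioms[rule_format]

text \<open>Polarisation: positivity makes the form real on the diagonal, in particular at
  \<open>x + c y\<close>; \<open>c = 1\<close> and \<open>c = \<i>\<close> give imaginary and real
  parts.\<close>

lemma qs_form_cnj: "\<phi> (st x *. y) = cnj (\<phi> (st y *. x))"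
proof -
  have "Im (\<phi> (st (x +. c \<cdot> y) *. (x +. c \<cdot> y))) = 0" for c using qs(3) by blast
  then have *: "Im (c * \<phi> (st x *. y) + cnj c * \<phi> (st y *. x)) = 0" for c
    using qs(3)[of x] qs(3)[of y] by (simp add: R.distrib_left R.distrib_right qs algebra_simps scale_add)
  show ?thesis using *[of 1] *[of \<i>] by (simp add: complex_eq_iff)
qed

interpretation G: semi_inner_univ "vadd A" "vscale A" "\<lambda>a b. \<phi> (st b *. a)"
proof (unfold semi_inner_univ_def, unfold_locales)
  show "\<And>x y. \<phi> (st x *. y) = cnj (\<phi> (st y *. x))" by (rule qs_form_cnj)
qed (use qs in \<open>auto simp: R.distrib_left\<close>)

lemma qs_diff: "\<phi> (x -. y) = \<phi> x - \<phi> y"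
  using qs(1)[of "x -. y" y] by simp

text \<open>With a unit this would be Cauchy-Schwarz against \<open>1\<close>. Here
  \<open>\<phi> (u a)\<close>, the form at \<open>a\<close> and \<open>u\<close>, replaces
  \<open>\<phi> a\<close> up to \<open>e\<close>, and \<open>u\<close> has seminorm at most 1. It
  makes \<open>gns_vec\<close> a functional of norm at most 1.\<close>

lemma qs_nrm_le: "cmod (\<phi> a) \<le> G.nrm a"
proof (rule field_le_epsilon)
  fix e :: real assume "e > 0"
  then obtain u where u: "st u = u" "N u \<le> 1" "N (a -. u *. a) \<le> e" using approximate_unit by blast
  have "(G.nrm u)\<^sup>2 \<le> 1"
  proof -
    have "(G.nrm u)\<^sup>2 \<le> cmod (\<phi> (st u *. u))" using complex_Re_le_cmod G.nrm_sq[of u] by simp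
    also have "\<dots> \<le> N (st u *. u)" by (rule qs(4))
    also have "\<dots> \<le> 1" unfolding ax(20) using u(2) by (simp add: power_le_one)
    finally show ?thesis .
  qed
  then have nu: "G.nrm u \<le> 1" using power2_le_imp_le[of "G.nrm u" 1] by simp
  have "cmod (\<phi> (u *. a)) \<le> G.nrm a * G.nrm u"
    using G.cauchy_schwarz[of a u] u(1) by simp
  also have "\<dots> \<le> G.nrm a * 1" using nu by (intro mult_left_mono) auto
  finally have 1: "cmod (\<phi> (u *. a)) \<le> G.nrm a" by simp
  have "cmod (\<phi> a - \<phi> (u *. a)) \<le> e" using qs(4)[of "a -. u *. a"] u(3) by (simp add: qs_diff)
  then show "cmod (\<phi> a) \<le> G.nrm a + e" using 1 norm_triangle_sub[of "\<phi> a" "\<phi> (u *. a)"] by linarith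
qed

text \<open>Left multiplication is a star-preserving homomorphism on \<open>A\<close> with the GNS
  form, so the general contraction argument applies even if the form is degenerate.\<close>

lemma qs_mult_bound: "G.nrm (a *. b) \<le> N a * G.nrm b"
  by (rule star_rep_contractive[where C = UNIV and \<pi> = "amult A" and add = "vadd A" and scale = "vscale A"])
    (use G.semi_inner_axioms in \<open>simp_all add: R.distrib_left R.distrib_right qs ax(9)\<close>)

text \<open>Forced by \<open>\<langle>a k, b\<rangle> = \<langle>k, (st a) b\<rangle>\<close>, with
  \<open>k\<close> read as \<open>\<langle>k, -\<rangle>\<close>.\<close>

definition gns_op :: "'a \<Rightarrow> ('a \<Rightarrow> complex) \<Rightarrow> 'a \<Rightarrow> complex" where
  "gns_op a k = (\<lambda>b. k (st a *. b))"
text \<open>For unital \<open>A\<close> this is the functional of the class of \<open>1\<close>, as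
  then \<open>\<phi> (st b) = cnj (\<phi> b)\<close>.\<close>

definition gns_vec :: "'a \<Rightarrow> complex" where "gns_vec = (\<lambda>b. cnj (\<phi> b))"

lemma gns_op_bound:
  assumes k: "k \<in> G.adual" shows "cmod (gns_op a k b) \<le> (N a * G.adual_norm k) * G.nrm b"
proof -
  have "cmod (gns_op a k b) \<le> G.adual_norm k * G.nrm (st a *. b)" unfolding gns_op_def by (rule G.adual_norm_bound[OF k])
  also have "\<dots> \<le> G.adual_norm k * (N a * G.nrm b)"
    using qs_mult_bound[of "st a" b] G.adual_norm_nonneg[OF k] by (intro mult_left_mono) auto
  finally show ?thesis by (simp add: mult_ac)
qed

lemma gns_op_adual: assumes k: "k \<in> G.adual" shows "gns_op a k \<in> G.adual"
  by (rule G.adualI[OF gns_op_bound[OF k]]) (simp_all add: gns_op_def R.distrib_left G.adual_add[OF k] G.adual_scale[OF k])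

text \<open>If \<open>Y\<close> represents \<open>l\<close>, then the multiples
  \<open>a *. Y n\<close> represent \<open>gns_op a l\<close>; both sides are the limit of
  \<open>k (a *. Y n)\<close>.\<close>

lemma gns_op_adjoint:
  assumes k: "k \<in> G.adual" and l: "l \<in> G.adual"
  shows "G.adual_ip (gns_op (st a) k) l = G.adual_ip k (gns_op a l)"
proof -
  define Y where "Y = G.repseq l"
  have Y: "G.repr Y l" unfolding Y_def by (rule G.repseq[OF l])
  have "G.repr (\<lambda>n. a *. Y n) (gns_op a l)"
    unfolding G.repr_def
  proof (intro conjI allI)
    show "(\<lambda>n. \<phi> (st v *. (a *. Y n))) \<longlonglongrightarrow> gns_op a l v" for v
    proof -
      have "(\<lambda>n. \<phi> (st (st a *. v) *. Y n)) \<longlonglongrightarrow> l (st a *. v)" using Y unfolding G.repr_def by blast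
      then show ?thesis by (simp add: gns_op_def ax(9))
    qed
    show "G.Cauchy_seq (\<lambda>n. a *. Y n)"
      unfolding G.Cauchy_seq_def
    proof (intro conjI allI impI)
      fix e :: real assume e: "e > 0"
      have "e / (N a + 1) > 0" using e by (intro divide_pos_pos add_nonneg_pos) auto
      then obtain M where M: "\<And>m n. m \<ge> M \<Longrightarrow> n \<ge> M \<Longrightarrow> G.nrm (G.dif (Y m) (Y n)) < e / (N a + 1)"
        using Y unfolding G.repr_def G.Cauchy_seq_def by blast
      have "G.nrm (G.dif (a *. Y m) (a *. Y n)) < e" if "m \<ge> M" "n \<ge> M" for m n
      proof -
        have "G.dif (a *. Y m) (a *. Y n) = a *. G.dif (Y m) (Y n)"
          unfolding G.dif_def by (simp add: R.distrib_left R.right_diff_distrib)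
        then have "G.nrm (G.dif (a *. Y m) (a *. Y n)) \<le> N a * G.nrm (G.dif (Y m) (Y n))"
          using qs_mult_bound by simp
        also have "\<dots> \<le> N a * (e / (N a + 1))" using M[OF that] by (intro mult_left_mono) auto
        also have "\<dots> = e * (N a / (N a + 1))" by simp
        also have "\<dots> < e * 1"
          by (rule mult_strict_left_mono[OF _ e]) (use add_nonneg_pos[OF N_nonneg zero_less_one] in \<open>simp add: divide_less_eq\<close>)
        finally show ?thesis by simp
      qed
      then show "\<exists>M. \<forall>m\<ge>M. \<forall>n\<ge>M. G.nrm (G.dif (a *. Y m) (a *. Y n)) < e" by blast
    qed simp
  qed
  then have "(\<lambda>n. k (a *. Y n)) \<longlonglongrightarrow> G.adual_ip k (gns_op a l)" by (rule G.adual_ip_lim[OF k gns_op_adual[OF l]])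
  moreover have "(\<lambda>n. k (a *. Y n)) \<longlonglongrightarrow> G.adual_ip (gns_op (st a) k) l"
    using G.adual_ip_lim[OF gns_op_adual[OF k] l Y, of "st a"] by (simp add: gns_op_def)
  ultimately show ?thesis using LIMSEQ_unique by blast
qed

lemma gns_rep: "is_rep A G.completion gns_op"
  unfolding is_rep_def univ ball_UNIV G.completion_simps G.hnorm_completion
proof (intro conjI ballI allI)
  fix a
  show "\<exists>C. \<forall>k\<in>G.adual. G.adual_norm (gns_op a k) \<le> C * G.adual_norm k"
    by (intro exI[of _ "N a"] ballI G.adual_norm_le gns_op_adual gns_op_bound) (auto simp: G.adual_norm_nonneg)
qed (auto simp: gns_op_adual gns_op_adjoint, auto simp: gns_op_def R.distrib_right G.adual_add G.adual_scale ax(9))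

lemma gns_vec_adual: "gns_vec \<in> G.adual"
  by (rule G.adualI[where B = 1]) (auto simp: gns_vec_def qs qs_nrm_le)

text \<open>The orbit of \<open>gns_vec\<close> consists of the functionals coming from elements of
  \<open>A\<close>, the dense part of the completion.\<close>

lemma gns_op_vec: "gns_op a gns_vec = (\<lambda>b. \<phi> (st b *. a))"
  unfolding gns_op_def gns_vec_def by (simp only: qs_form_cnj[symmetric])

lemma gns_dense:
  assumes k: "k \<in> G.adual" and e: "e > 0"
  shows "\<exists>a. G.adual_norm (\<lambda>b. k b - gns_op a gns_vec b) < e"
proof -
  have "e / 2 > 0" using e by simp
  from G.repr_approx[OF G.repseq[OF k] this]
  obtain a where a: "\<And>b. cmod (k b - \<phi> (st b *. a)) \<le> e/2 * G.nrm b" by blast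
  have "G.adual_norm (\<lambda>b. k b - gns_op a gns_vec b) \<le> e/2"
    by (rule G.adual_norm_le[OF G.adual_minus[OF k gns_op_adual[OF gns_vec_adual]]]) (use e a in \<open>auto simp: gns_op_vec\<close>)
  then show ?thesis using e by (intro exI[of _ a]) simp
qed

theorem gns_exists:
  "\<exists>(K :: (nat \<Rightarrow> 'a) hilb) \<pi> \<eta>. hilbert_space K \<and> is_rep A K \<pi> \<and> \<eta> \<in> vcarrier K \<and> hnorm K \<eta> \<le> 1
    \<and> (\<forall>a. hinner K (\<pi> a \<eta>) \<eta> = \<phi> a)
    \<and> (\<forall>x\<in>vcarrier K. \<forall>e>0. \<exists>a. hnorm K (vdiff K x (\<pi> a \<eta>)) < e)"
proof -
  define j where "j = G.repseq"
  define i where "i = inv_into G.adual j"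
  have inj: "inj_on j (vcarrier G.completion)" using G.inj_repseq by (simp add: j_def)
  have i: "i (j x) = x" if "x \<in> G.adual" for x using inj that by (simp add: i_def)
  define K where "K = transport j G.completion"
  note ops = transport_ops[OF G.completion_hilbert inj, folded K_def]
    and car = transport_carrier[OF G.completion_hilbert inj, folded K_def]
  have "hilbert_space K" unfolding K_def by (rule transport_hilbert[OF G.completion_hilbert inj])
  moreover have "is_rep A K (\<lambda>a x. j (gns_op a (i x)))"
    unfolding K_def by (rule transport_rep[OF G.completion_hilbert inj gns_rep univ]) (simp add: i)
  moreover have "j gns_vec \<in> vcarrier K" by (simp add: car gns_vec_adual)
  moreover have "hnorm K (j gns_vec) \<le> 1"
    using G.adual_norm_le[OF gns_vec_adual, of 1] by (simp add: ops gns_vec_adual G.hnorm_completion) (simp add: gns_vec_def qs_nrm_le)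
  moreover have "hinner K (j (gns_op a (i (j gns_vec)))) (j gns_vec) = \<phi> a" for a
  proof -
    have "hinner K (j (gns_op a (i (j gns_vec)))) (j gns_vec) = G.adual_ip (gns_op a gns_vec) gns_vec"
      by (simp add: i gns_vec_adual ops gns_op_adual)
    also have "\<dots> = cnj (G.adual_ip gns_vec (gns_op a gns_vec))" using G.adual_ip_cnj gns_vec_adual gns_op_adual by blast
    also have "\<dots> = \<phi> a" unfolding gns_op_vec G.adual_ip_emb[OF gns_vec_adual] by (simp add: gns_vec_def)
    finally show ?thesis .
  qed
  moreover have "\<exists>a. hnorm K (vdiff K x (j (gns_op a (i (j gns_vec))))) < e" if "x \<in> vcarrier K" "e > 0" for x e
  proof -
    obtain k where k: "k \<in> G.adual" and x: "x = j k" using \<open>x \<in> vcarrier K\<close> by (auto simp: car)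
    obtain a where "G.adual_norm (\<lambda>b. k b - gns_op a gns_vec b) < e" using gns_dense[OF k \<open>e > 0\<close>] by blast
    then show ?thesis
      using k by (intro exI[of _ a])
        (simp add: x i gns_vec_adual ops gns_op_adual G.vdiff_completion G.adual_minus G.hnorm_completion)
  qed
  ultimately show ?thesis by (intro exI[of _ K] exI[of _ "\<lambda>a x. j (gns_op a (i x))"] exI[of _ "j gns_vec"]) auto
qed

end
end

section \<open>Orthonormal bases and isometries\<close>

context hilb begin

section \<open>Finite orthonormal systems and bases\<close>

definition orthonormal :: "'v set \<Rightarrow> bool" where
  "orthonormal E \<longleftrightarrow> E \<subseteq> vcarrier H \<and> (\<forall>x\<in>E. hinner H x x = 1) \<and> (\<forall>x\<in>E. \<forall>y\<in>E. x \<noteq> y \<longrightarrow> hinner H x y = 0)"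

lemma orthonormal_in: "orthonormal E \<Longrightarrow> e \<in> E \<Longrightarrow> e \<in> vcarrier H" by (auto simp: orthonormal_def)

lemma orthonormal_ip: "orthonormal E \<Longrightarrow> e \<in> E \<Longrightarrow> e' \<in> E \<Longrightarrow> hinner H e e' = (if e = e' then 1 else 0)"
  by (auto simp: orthonormal_def)

lemma orthonormal_subset: "orthonormal E \<Longrightarrow> F \<subseteq> E \<Longrightarrow> orthonormal F" unfolding orthonormal_def by (meson subsetD order_trans)

lemma orthonormal_sum_ip:
  assumes "orthonormal E" "finite F" "F \<subseteq> E" "e \<in> F"
  shows "(\<Sum>b\<in>F. c b * hinner H b e) = c e" "(\<Sum>b\<in>F. c b * hinner H e b) = c e"
proof -
  have "(\<Sum>b\<in>F. c b * hinner H b e) = (\<Sum>b\<in>F. if b = e then c e else 0)"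
    using assms by (intro sum.cong) (auto simp: orthonormal_ip subset_iff)
  then show "(\<Sum>b\<in>F. c b * hinner H b e) = c e" using assms by simp
  have "(\<Sum>b\<in>F. c b * hinner H e b) = (\<Sum>b\<in>F. if b = e then c e else 0)"
    using assms by (intro sum.cong) (auto simp: orthonormal_ip subset_iff)
  then show "(\<Sum>b\<in>F. c b * hinner H e b) = c e" using assms by simp
qed

text \<open>Stated inside a set \<open>S\<close> closed under the operations, so that it supports
  both the definition of \<open>lincomb\<close> and membership of \<open>lincomb\<close> in
  subspaces.\<close>

lemma lincomb_exists:
  assumes "finite E" "E \<subseteq> S" "S \<subseteq> vcarrier H" "vzero H \<in> S"
    and "\<And>x y. x \<in> S \<Longrightarrow> y \<in> S \<Longrightarrow> vadd H x y \<in> S" "\<And>c x. x \<in> S \<Longrightarrow> vscale H c x \<in> S"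
  shows "\<exists>p\<in>S. \<forall>v\<in>vcarrier H. hinner H p v = (\<Sum>e\<in>E. c e * hinner H e v)"
  using assms(1,2)
proof (induction E)
  case empty
  then show ?case using assms(4) by (intro bexI[of _ "vzero H"]) auto
next
  case (insert e E)
  then obtain p where p: "p \<in> S" "\<And>v. v \<in> vcarrier H \<Longrightarrow> hinner H p v = (\<Sum>e\<in>E. c e * hinner H e v)" by auto
  have e: "e \<in> S" using insert by simp
  have "vadd H (vscale H (c e) e) p \<in> S" using p(1) e assms(5,6) by blast
  moreover have "hinner H (vadd H (vscale H (c e) e) p) v = (\<Sum>e\<in>insert e E. c e * hinner H e v)"
    if "v \<in> vcarrier H" for v
    using that p e assms(3) insert.hyps by (simp add: subset_iff)
  ultimately show ?case by blast
qed

text \<open>The linear combination is specified by its inner products, as there is no sum operator for the records.\<close>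

definition lincomb :: "('v \<Rightarrow> complex) \<Rightarrow> 'v set \<Rightarrow> 'v" where
  "lincomb c E = (SOME p. p \<in> vcarrier H \<and> (\<forall>v\<in>vcarrier H. hinner H p v = (\<Sum>e\<in>E. c e * hinner H e v)))"

lemma lincomb:
  assumes "finite E" "E \<subseteq> vcarrier H"
  shows "lincomb c E \<in> vcarrier H" "v \<in> vcarrier H \<Longrightarrow> hinner H (lincomb c E) v = (\<Sum>e\<in>E. c e * hinner H e v)"
proof -
  have "\<exists>p. p \<in> vcarrier H \<and> (\<forall>v\<in>vcarrier H. hinner H p v = (\<Sum>e\<in>E. c e * hinner H e v))"
    using lincomb_exists[of E "vcarrier H" c] assms by auto
  from someI_ex[OF this] show "lincomb c E \<in> vcarrier H" 
    "v \<in> vcarrier H \<Longrightarrow> hinner H (lincomb c E) v = (\<Sum>e\<in>E. c e * hinner H e v)"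
    unfolding lincomb_def by blast+
qed

lemma lincomb_in_subspace:
  assumes "finite E" "E \<subseteq> S" "S \<subseteq> vcarrier H" "vzero H \<in> S"
    and "\<And>x y. x \<in> S \<Longrightarrow> y \<in> S \<Longrightarrow> vadd H x y \<in> S" "\<And>c x. x \<in> S \<Longrightarrow> vscale H c x \<in> S"
  shows "lincomb c E \<in> S"
proof -
  obtain p where p: "p \<in> S" "\<And>v. v \<in> vcarrier H \<Longrightarrow> hinner H p v = (\<Sum>e\<in>E. c e * hinner H e v)"
    using lincomb_exists[OF assms] by blast
  have E: "E \<subseteq> vcarrier H" using assms by blast
  have "lincomb c E = p" 
    using lincomb[OF assms(1) E, where c = c] p assms(3) by (intro ip_ext) auto
  then show ?thesis using p by simp
qed

lemma lincomb_ip_right: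
  assumes E: "finite E" "E \<subseteq> vcarrier H" and v: "v \<in> vcarrier H"
  shows "hinner H v (lincomb c E) = (\<Sum>e\<in>E. cnj (c e) * hinner H v e)"
proof -
  have "hinner H v (lincomb c E) = cnj (hinner H (lincomb c E) v)" using lincomb[OF E] v by (intro ip_cnj) auto
  also have "\<dots> = (\<Sum>e\<in>E. cnj (c e) * cnj (hinner H e v))" using lincomb[OF E] v by simp
  also have "\<dots> = (\<Sum>e\<in>E. cnj (c e) * hinner H v e)"
    by (intro sum.cong refl arg_cong2[of _ _ _ _ "(*)"] ip_cnj[symmetric]) (use E v in auto)
  finally show ?thesis .
qed

lemma bessel_eq:
  assumes E: "orthonormal E" "finite E" and x: "x \<in> vcarrier H"
  shows "(nrm (dif x (lincomb (hinner H x) E)))\<^sup>2 = (nrm x)\<^sup>2 - (\<Sum>e\<in>E. (cmod (hinner H x e))\<^sup>2)"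
    and "e \<in> E \<Longrightarrow> hinner H (dif x (lincomb (hinner H x) E)) e = 0"
proof -
  let ?p = "lincomb (hinner H x) E"
  have EC: "E \<subseteq> vcarrier H" using E by (simp add: orthonormal_def)
  note p = lincomb[OF E(2) EC, where c = "hinner H x"]
  have pe: "hinner H ?p e = hinner H x e" if "e \<in> E" for e
    using p(2)[of e] orthonormal_sum_ip(1)[OF E order_refl that, where c = "hinner H x"] that EC by auto
  then show "e \<in> E \<Longrightarrow> hinner H (dif x ?p) e = 0" using EC p(1) x by auto
  let ?s = "\<Sum>e\<in>E. (cmod (hinner H x e))\<^sup>2"
  have s: "(\<Sum>e\<in>E. cnj (hinner H x e) * hinner H x e) = of_real ?s"
    by (simp add: complex_norm_square mult.commute del: of_real_power)
  have xp: "hinner H x ?p = of_real ?s" using lincomb_ip_right[OF E(2) EC x] s by simp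
  have pp: "hinner H ?p ?p = of_real ?s"
    using lincomb_ip_right[OF E(2) EC p(1), where c = "hinner H x"] s pe by simp
  show "(nrm (dif x ?p))\<^sup>2 = (nrm x)\<^sup>2 - ?s"
    using x p(1) by (simp add: nrm_dif_sq xp nrm_sq[of ?p] pp)
qed

lemma bessel:
  assumes "orthonormal E" "finite E" "x \<in> vcarrier H"
  shows "(\<Sum>e\<in>E. (cmod (hinner H x e))\<^sup>2) \<le> (nrm x)\<^sup>2"
  using bessel_eq(1)[OF assms] zero_le_power2[of "nrm (dif x (lincomb (hinner H x) E))"] by linarith

lemma bessel_L2:
  assumes "orthonormal E" "finite E" "x \<in> vcarrier H"
  shows "L2_set (\<lambda>e. cmod (hinner H x e)) E \<le> nrm x"
  unfolding L2_set_def using bessel[OF assms] assms(3) by (intro real_le_lsqrt) auto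

lemma orthonormal_basis_iff:
  "orthonormal_basis H B \<longleftrightarrow> orthonormal B \<and> (\<forall>x\<in>vcarrier H. (\<forall>b\<in>B. hinner H x b = 0) \<longrightarrow> x = vzero H)"
  unfolding orthonormal_basis_def orthonormal_def by (simp only: conj_assoc)

lemma nrm_pos: "x \<in> vcarrier H \<Longrightarrow> x \<noteq> vzero H \<Longrightarrow> nrm x > 0"
  using nrm_zero_iff[of x] nrm_ge0[of x] by linarith

lemma normalize:
  assumes "x \<in> vcarrier H" "x \<noteq> vzero H"
  shows "hinner H (vscale H (of_real (1 / nrm x)) x) (vscale H (of_real (1 / nrm x)) x) = 1"
  using nrm_pos[OF assms] assms by (simp add: ip_self power2_eq_square norm_divide)

lemma orthonormal_insert_normalize:
  assumes "orthonormal E" "x \<in> vcarrier H" "x \<noteq> vzero H" "\<forall>b\<in>E. hinner H x b = 0"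
  shows "orthonormal (insert (vscale H (of_real (1 / nrm x)) x) E)"
  using assms normalize[OF assms(2,3)] ip_swap_0[of x] unfolding orthonormal_def by auto

lemma orthonormal_basis_exists: "\<exists>B. orthonormal_basis H B"
proof -
  have "\<exists>M\<in>{E. orthonormal E}. \<forall>X\<in>{E. orthonormal E}. M \<subseteq> X \<longrightarrow> X = M"
  proof (rule subset_Zorn')
    fix C assume C: "subset.chain {E. orthonormal E} C"
    then have onsC: "orthonormal E" if "E \<in> C" for E using that by (auto simp: subset_chain_def)
    have "hinner H x y = (if x = y then 1 else 0)" if "x \<in> \<Union>C" "y \<in> \<Union>C" for x y
    proof -
      obtain E F where EF: "E \<in> C" "x \<in> E" "F \<in> C" "y \<in> F" using \<open>x \<in> \<Union>C\<close> \<open>y \<in> \<Union>C\<close> by blast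
      then have "E \<subseteq> F \<or> F \<subseteq> E" using C by (auto simp: subset_chain_def)
      then show ?thesis using EF onsC orthonormal_ip by (metis subsetD)
    qed
    moreover have "\<Union>C \<subseteq> vcarrier H" using onsC orthonormal_in by blast
    ultimately have "orthonormal (\<Union>C)" by (simp add: orthonormal_def)
    then show "\<Union>C \<in> {E. orthonormal E}" by simp
  qed
  then obtain M where M: "orthonormal M" and max: "\<And>X. orthonormal X \<Longrightarrow> M \<subseteq> X \<Longrightarrow> X = M" by auto
  have "x = vzero H" if x: "x \<in> vcarrier H" and 0: "\<forall>b\<in>M. hinner H x b = 0" for x
  proof (rule ccontr)
    assume nz: "x \<noteq> vzero H"
    let ?y = "vscale H (of_real (1 / nrm x)) x"
    have "?y \<in> M" using max[OF orthonormal_insert_normalize[OF M x nz 0]] by blast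
    then have "hinner H x ?y = 0" using 0 by blast
    then have "hinner H ?y ?y = 0" using x by simp
    then show False using normalize[OF x nz] by simp
  qed
  then show ?thesis using M orthonormal_basis_iff by blast
qed

end

section \<open>Isometric extension of an injection between orthonormal systems\<close>

locale two_hilb = K: hilb K + H: hilb H for K :: "('k, 'b) hilb_scheme" and H :: "('h, 'c) hilb_scheme" +
  fixes B :: "'k set" and f :: "'k \<Rightarrow> 'h"
  assumes B: "K.orthonormal B" and fB: "H.orthonormal (f ` B)" and inj: "inj_on f B"
begin

text \<open>The terms of \<open>\<langle>v, W k\<rangle>\<close> for the map \<open>W\<close> to be
  built, which sends \<open>k\<close> to the sum of the \<open>\<langle>k, b\<rangle> f b\<close>.
  The series is scalar and \<open>W k\<close> comes from it by Riesz, so no infinite sum of vectors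
  is formed.\<close>

definition pairing_term :: "'h \<Rightarrow> 'k \<Rightarrow> 'k \<Rightarrow> complex" where "pairing_term v k b = hinner H v (f b) * hinner K b k"
definition pairing :: "'h \<Rightarrow> 'k \<Rightarrow> complex" where "pairing v k = infsum (pairing_term v k) B"

lemma pairing_term_finite:
  assumes v: "v \<in> vcarrier H" and k: "k \<in> vcarrier K" and F: "finite F" "F \<subseteq> B"
  shows "(\<Sum>b\<in>F. norm (pairing_term v k b)) \<le> H.nrm v * K.nrm k"
proof -
  have "(\<Sum>b\<in>F. norm (pairing_term v k b)) = (\<Sum>b\<in>F. \<bar>cmod (hinner H v (f b))\<bar> * \<bar>cmod (hinner K k b)\<bar>)"
  proof (intro sum.cong refl)
    fix b assume "b \<in> F"
    then have "b \<in> vcarrier K" using F B K.orthonormal_in by blast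
    then have "cmod (hinner K b k) = cmod (hinner K k b)" using K.ip_cnj[of k b] k by simp
    then show "norm (pairing_term v k b) = \<bar>cmod (hinner H v (f b))\<bar> * \<bar>cmod (hinner K k b)\<bar>"
      by (simp add: pairing_term_def norm_mult)
  qed
  also have "\<dots> \<le> L2_set (\<lambda>b. cmod (hinner H v (f b))) F * L2_set (\<lambda>b. cmod (hinner K k b)) F"
    by (rule L2_set_mult_ineq)
  also have "L2_set (\<lambda>b. cmod (hinner H v (f b))) F = L2_set (\<lambda>e. cmod (hinner H v e)) (f ` F)"
    using inj_on_subset[OF inj F(2)] unfolding L2_set_def by (simp add: sum.reindex)
  also have "L2_set (\<lambda>e. cmod (hinner H v e)) (f ` F) * L2_set (\<lambda>b. cmod (hinner K k b)) F \<le> H.nrm v * K.nrm k"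
  proof (intro mult_mono H.bessel_L2 K.bessel_L2)
    show "H.orthonormal (f ` F)" using H.orthonormal_subset[OF fB] F by blast
    show "K.orthonormal F" using K.orthonormal_subset[OF B] F by blast
  qed (use v k F in \<open>auto simp: L2_set_def intro: sum_nonneg\<close>)
  finally show ?thesis .
qed

lemma pairing_term_abs_summable:
  assumes v: "v \<in> vcarrier H" and k: "k \<in> vcarrier K"
  shows "(\<lambda>b. norm (pairing_term v k b)) summable_on B"
  using pairing_term_finite[OF v k] by (intro nonneg_bdd_above_summable_on bdd_aboveI2) auto

lemma pairing_term_summable: "v \<in> vcarrier H \<Longrightarrow> k \<in> vcarrier K \<Longrightarrow> pairing_term v k summable_on B"
  by (rule abs_summable_summable[OF pairing_term_abs_summable])

lemma pairing_bound:
  assumes v: "v \<in> vcarrier H" and k: "k \<in> vcarrier K"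
  shows "cmod (pairing v k) \<le> H.nrm v * K.nrm k"
proof -
  have "cmod (pairing v k) \<le> infsum (\<lambda>b. norm (pairing_term v k b)) B"
    unfolding pairing_def by (rule norm_infsum_bound[OF pairing_term_abs_summable[OF v k]])
  also have "\<dots> \<le> H.nrm v * K.nrm k"
    by (rule infsum_le_finite_sums[OF pairing_term_abs_summable[OF v k] pairing_term_finite[OF v k]])
  finally show ?thesis .
qed

lemma fB_in: "b \<in> B \<Longrightarrow> f b \<in> vcarrier H" using fB H.orthonormal_in by blast
lemma B_in: "b \<in> B \<Longrightarrow> b \<in> vcarrier K" using B K.orthonormal_in by blast

lemma pairing_linear:
  assumes k: "k \<in> vcarrier K" "l \<in> vcarrier K" and v: "v \<in> vcarrier H" "w \<in> vcarrier H"
  shows "pairing (vadd H v w) k = pairing v k + pairing w k" "pairing (vscale H c v) k = c * pairing v k"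
    "pairing v (vadd K k l) = pairing v k + pairing v l" "pairing v (vscale K c k) = cnj c * pairing v k"
proof -
  have "pairing (vadd H v w) k = infsum (\<lambda>b. pairing_term v k b + pairing_term w k b) B"
    unfolding pairing_def using v fB_in by (intro infsum_cong) (simp add: pairing_term_def algebra_simps)
  also have "\<dots> = pairing v k + pairing w k" unfolding pairing_def by (intro infsum_add pairing_term_summable v k)
  finally show "pairing (vadd H v w) k = pairing v k + pairing w k" .
  have "pairing v (vadd K k l) = infsum (\<lambda>b. pairing_term v k b + pairing_term v l b) B"
    unfolding pairing_def using k B_in by (intro infsum_cong) (simp add: pairing_term_def algebra_simps)
  also have "\<dots> = pairing v k + pairing v l" unfolding pairing_def by (intro infsum_add pairing_term_summable v k)
  finally show "pairing v (vadd K k l) = pairing v k + pairing v l" .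
  have "pairing (vscale H c v) k = infsum (\<lambda>b. c * pairing_term v k b) B"
    unfolding pairing_def using v fB_in by (intro infsum_cong) (simp add: pairing_term_def)
  then show "pairing (vscale H c v) k = c * pairing v k" by (simp add: pairing_def infsum_cmult_right')
  have "pairing v (vscale K c k) = infsum (\<lambda>b. cnj c * pairing_term v k b) B"
    unfolding pairing_def using k B_in by (intro infsum_cong) (simp add: pairing_term_def)
  then show "pairing v (vscale K c k) = cnj c * pairing v k" by (simp add: pairing_def infsum_cmult_right')
qed

lemma pairing_basis:
  assumes k: "k \<in> vcarrier K" and b: "b \<in> B" shows "pairing (f b) k = hinner K b k"
proof -
  have "pairing (f b) k = infsum (pairing_term (f b) k) {b}"
    unfolding pairing_def
  proof (rule infsum_cong_neutral)
    fix x assume "x \<in> B - {b}"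
    then have "hinner H (f b) (f x) = 0" using b inj H.orthonormal_ip[OF fB, of "f b" "f x"] by (auto simp: inj_on_def)
    then show "pairing_term (f b) k x = 0" by (simp add: pairing_term_def)
  qed (use b in auto)
  also have "\<dots> = hinner K b k" using b H.orthonormal_ip[OF fB, of "f b" "f b"] by (simp add: pairing_term_def)
  finally show ?thesis .
qed

definition W :: "'k \<Rightarrow> 'h" where
  "W k = (SOME h. h \<in> vcarrier H \<and> (\<forall>v\<in>vcarrier H. hinner H v h = pairing v k))"

lemma W:
  assumes k: "k \<in> vcarrier K"
  shows "W k \<in> vcarrier H" "v \<in> vcarrier H \<Longrightarrow> hinner H v (W k) = pairing v k"
proof -
  have "\<exists>h\<in>vcarrier H. \<forall>v\<in>vcarrier H. hinner H v h = pairing v k"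
    using pairing_linear[OF k k] pairing_bound[OF _ k] by (intro H.riesz[where B = "K.nrm k"]) (auto simp: mult.commute)
  then have "\<exists>h. h \<in> vcarrier H \<and> (\<forall>v\<in>vcarrier H. hinner H v h = pairing v k)" by blast
  from someI_ex[OF this] show "W k \<in> vcarrier H" "v \<in> vcarrier H \<Longrightarrow> hinner H v (W k) = pairing v k"
    unfolding W_def by blast+
qed

lemma W_orth:
  assumes k: "k \<in> vcarrier K" and e: "e \<in> vcarrier H" "\<And>b. b \<in> B \<Longrightarrow> hinner H e (f b) = 0"
  shows "hinner H (W k) e = 0"
proof -
  have "pairing e k = infsum (\<lambda>_. 0) B" unfolding pairing_def using e by (intro infsum_cong) (simp add: pairing_term_def)
  then have "hinner H e (W k) = 0" using W[OF k] e by simp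
  then show ?thesis using H.ip_swap_0 W[OF k] e by blast
qed

lemma W_basis:
  assumes k: "k \<in> vcarrier K" and b: "b \<in> B" shows "hinner H (W k) (f b) = hinner K k b"
  using W[OF k] pairing_basis[OF k b] fB_in[OF b] B_in[OF b] H.ip_cnj[of "f b" "W k"] K.ip_cnj[of b k] k by simp

lemma W_linear:
  assumes k: "k \<in> vcarrier K" and l: "l \<in> vcarrier K"
  shows "W (vadd K k l) = vadd H (W k) (W l)" "W (vscale K c k) = vscale H c (W k)"
proof -
  have ext: "x = y" if "x \<in> vcarrier H" "y \<in> vcarrier H" "\<And>v. v \<in> vcarrier H \<Longrightarrow> hinner H v x = hinner H v y" for x y
    using that H.ip_cnj by (intro H.ip_ext) metis+
  show "W (vadd K k l) = vadd H (W k) (W l)" using k l by (intro ext) (auto simp: W pairing_linear)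
  show "W (vscale K c k) = vscale H c (W k)" using k l by (intro ext) (auto simp: W pairing_linear)
qed

end

context hilb begin

text \<open>Extend the identity on \<open>B\<close>: \<open>W y - y\<close> is orthogonal to the
  basis, hence zero, and \<open>\<langle>x, W y\<rangle>\<close> is the series by
  construction.\<close>

lemma parseval:
  assumes B: "orthonormal_basis H B" and x: "x \<in> vcarrier H" and y: "y \<in> vcarrier H"
  shows "hinner H x y = infsum (\<lambda>b. hinner H x b * hinner H b y) B"
proof -
  interpret T: two_hilb H H B "\<lambda>x. x"
    by unfold_locales (use B in \<open>auto simp: orthonormal_basis_iff\<close>)
  have "dif (T.W y) y = vzero H"
  proof -
    have "hinner H (dif (T.W y) y) b = 0" if "b \<in> B" for b
      using T.W_basis[OF y that] T.W[OF y] y T.B_in[OF that] by simp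
    then show ?thesis using B T.W[OF y] y unfolding orthonormal_basis_iff by blast
  qed
  then have "hinner H x (dif (T.W y) y) = 0" using x by simp
  then have "hinner H x y = T.pairing x y" using T.W[OF y] x y by simp
  then show ?thesis by (simp add: T.pairing_def T.pairing_term_def[abs_def])
qed

end

context two_hilb begin

lemma W_isometry:
  assumes basis: "orthonormal_basis K B" and k: "k \<in> vcarrier K" and l: "l \<in> vcarrier K"
  shows "hinner H (W l) (W k) = hinner K l k"
proof -
  have "hinner H (W l) (W k) = infsum (\<lambda>b. hinner K l b * hinner K b k) B"
    using W[OF k] W[OF l] W_basis[OF l] by (simp add: pairing_def pairing_term_def cong: infsum_cong)
  then show ?thesis using K.parseval[OF basis l k] by simp
qed

end

lemma adjoint_exists:
  assumes "hilbert_space K" "hilbert_space H"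
    and W: "\<And>k. k \<in> vcarrier K \<Longrightarrow> W k \<in> vcarrier H"
    and add: "\<And>k l. k \<in> vcarrier K \<Longrightarrow> l \<in> vcarrier K \<Longrightarrow> W (vadd K k l) = vadd H (W k) (W l)"
    and scale: "\<And>c k. k \<in> vcarrier K \<Longrightarrow> W (vscale K c k) = vscale H c (W k)"
    and iso: "\<And>k l. k \<in> vcarrier K \<Longrightarrow> l \<in> vcarrier K \<Longrightarrow> hinner H (W k) (W l) = hinner K k l"
  shows "\<exists>V. \<forall>h\<in>vcarrier H. V h \<in> vcarrier K \<and> (\<forall>k\<in>vcarrier K. hinner H (W k) h = hinner K k (V h))"
proof -
  interpret K: hilb K by (rule hilb.intro) fact
  interpret H: hilb H by (rule hilb.intro) fact
  have "\<exists>l\<in>vcarrier K. \<forall>k\<in>vcarrier K. hinner K k l = hinner H (W k) h" if h: "h \<in> vcarrier H" for h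
  proof (rule K.riesz[where B = "H.nrm h"])
    fix x assume x: "x \<in> vcarrier K"
    have "H.nrm (W x) = K.nrm x" using iso[OF x x] by (simp add: H.nrm_def K.nrm_def)
    then show "cmod (hinner H (W x) h) \<le> H.nrm h * K.nrm x"
      using H.cauchy_schwarz[OF W[OF x] h] by (simp add: mult.commute)
  qed (use h W in \<open>auto simp: add scale\<close>)
  then have "\<forall>h\<in>vcarrier H. \<exists>l. l \<in> vcarrier K \<and> (\<forall>k\<in>vcarrier K. hinner H (W k) h = hinner K k l)" by metis
  then show ?thesis by (rule bchoice)
qed

section \<open>Lifting quasi-states to representations on a fixed space\<close>

text \<open>An infinite set splits into two copies of itself; map it onto one and leave the other
  free.\<close>

lemma infinite_injection_coinfinite:
  assumes "infinite S"
  shows "\<exists>p. inj_on p S \<and> p ` S \<subseteq> S \<and> infinite (S - p ` S)"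
proof -
  have "(card_of (S <+> S), card_of S) \<in> ordIso" by (intro card_of_Plus_infinite1 assms card_of_mono1 order_refl)
  then obtain h where h: "bij_betw h (S <+> S) S" using card_of_ordIso by blast
  have inj: "inj_on h (S <+> S)" using h by (rule bij_betw_imp_inj_on)
  have img: "h ` (S <+> S) = S" using h by (rule bij_betw_imp_surj_on)
  have "(h \<circ> Inr) ` S \<subseteq> S - (h \<circ> Inl) ` S"
    using img inj by (auto simp: inj_on_def)
  moreover have "infinite ((h \<circ> Inr) ` S)"
    using assms inj by (subst finite_image_iff) (auto simp: inj_on_def)
  ultimately have "infinite (S - (h \<circ> Inl) ` S)" using finite_subset by blast
  moreover have "inj_on (h \<circ> Inl) S" using inj by (auto simp: inj_on_def)
  moreover have "(h \<circ> Inl) ` S \<subseteq> S" using img by auto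
  ultimately show ?thesis by blast
qed

text \<open>The complement of the image is the room used in \<open>isometry_exists\<close>. In
  finite dimension the strict inequality provides it; otherwise the injection is followed by one of
  \<open>B'\<close> into itself that leaves infinitely many elements free.\<close>

lemma embedding_basis:
  assumes K: "hilbert_space K" and H: "hilbert_space H" and le: "hdim_le K H"
    and less: "(\<exists>B. orthonormal_basis H B \<and> finite B) \<longrightarrow> hdim_less K H"
  shows "\<exists>B B' f. orthonormal_basis K B \<and> orthonormal_basis H B' \<and> inj_on f B \<and> f ` B \<subseteq> B'
    \<and> B' - f ` B \<noteq> {} \<and> ((\<forall>B. orthonormal_basis H B \<longrightarrow> infinite B) \<longrightarrow> infinite (B' - f ` B))"
proof (cases "\<exists>B. orthonormal_basis H B \<and> finite B")
  case True
  then have "\<not> hdim_le H K" using less unfolding hdim_less_def by blast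
  \<comment> \<open>The bases are those witnessing the failure of \<open>hdim_le H K\<close>, so an
    injection of \<open>B\<close> into \<open>B'\<close> cannot be onto.\<close>
  then obtain B B' where B: "orthonormal_basis K B" "orthonormal_basis H B'"
    and no: "\<nexists>f. inj_on f B' \<and> f ` B' \<subseteq> B"
    unfolding hdim_le_def by blast
  then obtain f where f: "inj_on f B" "f ` B \<subseteq> B'" using le unfolding hdim_le_def by blast
  have "B' - f ` B \<noteq> {}"
  proof
    assume "B' - f ` B = {}"
    then have "B' = f ` B" using f by blast
    then have "inj_on (inv_into B f) B'" "inv_into B f ` B' \<subseteq> B"
      by (auto intro: inj_on_inv_into inv_into_into)
    then show False using no by blast
  qed
  then show ?thesis using B f True by blast
next
  case False
  interpret K: hilb K by (rule hilb.intro[OF K])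
  interpret H: hilb H by (rule hilb.intro[OF H])
  obtain B where B: "orthonormal_basis K B" using K.orthonormal_basis_exists by blast
  obtain B' where B': "orthonormal_basis H B'" using H.orthonormal_basis_exists by blast
  obtain f where f: "inj_on f B" "f ` B \<subseteq> B'" using le B B' unfolding hdim_le_def by blast
  have "infinite B'" using False B' by blast
  from infinite_injection_coinfinite[OF this]
  obtain p where p: "inj_on p B'" "p ` B' \<subseteq> B'" "infinite (B' - p ` B')" by blast
  have "inj_on (p \<circ> f) B" using f p inj_on_subset by (blast intro: comp_inj_on)
  moreover have sub: "(p \<circ> f) ` B \<subseteq> p ` B'" using f by auto
  moreover have "B' - p ` B' \<subseteq> B' - (p \<circ> f) ` B" using sub by blast
  then have "infinite (B' - (p \<circ> f) ` B)" using p(3) finite_subset by blast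
  moreover then have "B' - (p \<circ> f) ` B \<noteq> {}" by (metis finite.emptyI)
  ultimately show ?thesis using B B' p(2) by (intro exI[of _ B] exI[of _ B'] exI[of _ "p \<circ> f"]) auto
qed

locale hilb_univ = hilb H for H :: "'h hilb" +
  assumes HU [simp]: "vcarrier H = UNIV"
begin

abbreviation ip where "ip \<equiv> hinner H"

lemma ext: "(\<And>z. ip x z = ip y z) \<Longrightarrow> x = y" by (rule ip_ext) auto

lemma nrm0: "nrm x = 0 \<Longrightarrow> x = vzero H" by (simp add: nrm_zero_iff)

text \<open>The adjoint is carried as a second argument; linearity follows from the adjoint relation
  (\<open>unitary_linear\<close>).\<close>

definition unitary :: "('h \<Rightarrow> 'h) \<Rightarrow> ('h \<Rightarrow> 'h) \<Rightarrow> bool" where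
  "unitary U U' \<longleftrightarrow> (\<forall>x. U (U' x) = x) \<and> (\<forall>x. U' (U x) = x) \<and> (\<forall>x y. ip (U x) y = ip x (U' y))"

lemma unitaryD:
  assumes "unitary U U'"
  shows "U (U' x) = x" "U' (U x) = x" "ip (U x) y = ip x (U' y)" "ip (U' x) y = ip x (U y)"
    "ip (U x) (U y) = ip x y" "ip (U' x) (U' y) = ip x y" "nrm (U x) = nrm x" "nrm (U' x) = nrm x"
proof -
  note u = assms[unfolded unitary_def]
  show 1: "U (U' x) = x" "U' (U x) = x" "ip (U x) y = ip x (U' y)" for x y using u by auto
  show 2: "ip (U' x) y = ip x (U y)" for x y using 1(3)[of "U' x" "U y"] 1 by metis
  show 3: "ip (U x) (U y) = ip x y" for x y by (simp only: 1)
  show 4: "ip (U' x) (U' y) = ip x y" for x y by (simp only: 1 2)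
  show "nrm (U x) = nrm x" "nrm (U' x) = nrm x" by (simp_all add: nrm_def 3 4)
qed

lemma unitary_linear:
  assumes "unitary U U'"
  shows "U (vadd H x y) = vadd H (U x) (U y)" "U (vscale H c x) = vscale H c (U x)"
    "U (dif x y) = dif (U x) (U y)"
  by (rule ext, simp add: unitaryD(3)[OF assms])+

lemma unitary_sym: "unitary U U' \<Longrightarrow> unitary U' U"
  unfolding unitary_def by (metis)

lemma unitary_id: "unitary (\<lambda>x. x) (\<lambda>x. x)" by (simp add: unitary_def)

lemma unitary_comp: "unitary U U' \<Longrightarrow> unitary T T' \<Longrightarrow> unitary (\<lambda>x. T (U x)) (\<lambda>x. U' (T' x))"
  by (simp add: unitary_def)

text \<open>A complex Householder map \<open>x \<mapsto> x - (\<langle>x, d\<rangle> / \<langle>p, d\<rangle>) d\<close> with \<open>d = p - q\<close>.\<close>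

lemma unitary_transitive:
  assumes eq: "nrm p = nrm q"
  shows "\<exists>U U'. unitary U U' \<and> U p = q \<and> (\<forall>z. ip z p = 0 \<longrightarrow> ip z q = 0 \<longrightarrow> U z = z)"
proof (cases "p = q")
  case True
  then show ?thesis using unitary_id by blast
next
  case False
  define d where "d = dif p q"
  define c where "c = ip p d"
  have "d \<noteq> vzero H"
  proof
    assume "d = vzero H"
    then have "ip (dif p q) z = 0" for z by (simp add: d_def)
    then have "p = q" by (intro ext) simp
    then show False using False by simp
  qed
  then have D: "nrm d > 0" by (intro nrm_pos) auto
  \<comment> \<open>Equal norms give \<open>2 Re c = \<parallel>d\<parallel>^2\<close>. Hence
    \<open>c\<close> is nonzero, and \<open>c + cnj c = \<langle>d,d\<rangle>\<close> is exactly
    what makes \<open>U\<close> and \<open>U'\<close> inverse to each other; moreover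
    \<open>U p = p - d = q\<close>.\<close>
  have Re: "2 * Re c = (nrm d)\<^sup>2"
    using nrm_dif_sq[of p q] eq by (simp add: c_def d_def ip_self)
  then have c0: "c \<noteq> 0" using D by auto
  have cc: "c + cnj c = ip d d"
    using Re by (simp add: ip_self complex_eq_iff)
  define U where "U x = dif x (vscale H (ip x d / c) d)" for x
  define U' where "U' x = dif x (vscale H (ip x d / cnj c) d)" for x
  have adj: "ip (U x) y = ip x (U' y)" for x y
    using ip_cnj[of y d] by (simp add: U_def U'_def)
  have key: "a / cnj c + (a - a / cnj c * ip d d) / c = 0" "a / c + (a - a / c * ip d d) / cnj c = 0" for a
    using c0 unfolding cc[symmetric] by (simp_all add: field_simps)
  have UU': "U (U' x) = x" for x
  proof (rule ext)
    fix z
    have "ip (U (U' x)) z = ip x z - (ip x d / cnj c + (ip x d - ip x d / cnj c * ip d d) / c) * ip d z"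
      by (simp add: U_def U'_def algebra_simps)
    then show "ip (U (U' x)) z = ip x z" by (simp only: key) simp
  qed
  have U'U: "U' (U x) = x" for x
  proof (rule ext)
    fix z
    have "ip (U' (U x)) z = ip x z - (ip x d / c + (ip x d - ip x d / c * ip d d) / cnj c) * ip d z"
      by (simp add: U_def U'_def algebra_simps)
    then show "ip (U' (U x)) z = ip x z" by (simp only: key) simp
  qed
  have "U p = q" using c0 by (intro ext) (simp add: U_def c_def[symmetric], simp add: d_def)
  moreover have "U z = z" if "ip z p = 0" "ip z q = 0" for z
    using that by (intro ext) (simp add: U_def d_def)
  ultimately show ?thesis using adj UU' U'U unfolding unitary_def by blast
qed

text \<open>\<open>V\<close> is the adjoint of the isometry \<open>W\<close>. The point is
  \<open>V \<xi> = \<eta>\<close>: then \<open>W \<pi> V\<close> has at \<open>\<xi>\<close> the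
  vector functional that \<open>\<pi>\<close> has at \<open>\<eta>\<close>, and it annihilates
  \<open>Z\<close>.\<close>

lemma isometry_exists:
  fixes K :: "'k hilb"
  assumes K: "hilbert_space K" and le: "hdim_le K H"
    and less: "(\<exists>B. orthonormal_basis H B \<and> finite B) \<longrightarrow> hdim_less K H"
    and \<eta>: "\<eta> \<in> vcarrier K" "hnorm K \<eta> \<le> 1" and \<xi>: "nrm \<xi> = 1"
  shows "\<exists>W V. (\<forall>h. V h \<in> vcarrier K) \<and> (\<forall>h. \<forall>k\<in>vcarrier K. ip (W k) h = hinner K k (V h))
     \<and> (\<forall>k\<in>vcarrier K. V (W k) = k) \<and> V \<xi> = \<eta>
     \<and> ((\<forall>B. orthonormal_basis H B \<longrightarrow> infinite B) \<longrightarrow>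
         (\<exists>Z. infinite Z \<and> orthonormal Z \<and> (\<forall>z\<in>Z. ip z \<xi> = 0 \<and> V z = vzero K)))"
proof -
  interpret K: hilb K by (rule hilb.intro[OF K])
  from embedding_basis[OF K hilb le less] obtain B B' f where
    B: "orthonormal_basis K B" "orthonormal_basis H B'" and f: "inj_on f B" "f ` B \<subseteq> B'"
    and ne: "B' - f ` B \<noteq> {}"
    and inf: "(\<forall>B. orthonormal_basis H B \<longrightarrow> infinite B) \<Longrightarrow> infinite (B' - f ` B)" by metis
  have oB': "orthonormal B'" using B orthonormal_basis_iff by blast
  interpret T: two_hilb K H B f
    by unfold_locales (use B f oB' orthonormal_subset K.orthonormal_basis_iff in blast)+
  obtain V where V: "\<And>h. V h \<in> vcarrier K" "\<And>h k. k \<in> vcarrier K \<Longrightarrow> ip (T.W k) h = hinner K k (V h)"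
    using adjoint_exists[OF K hilb T.W(1) T.W_linear(1) T.W_linear(2)[OF _ K.zero_in] T.W_isometry[OF B(1)]] by auto
  have VW: "V (T.W k) = k" if k: "k \<in> vcarrier K" for k
  proof (rule K.ip_ext)
    fix l assume l: "l \<in> vcarrier K"
    have "hinner K l (V (T.W k)) = hinner K l k" using V(2)[OF l] T.W_isometry[OF B(1) k l] by simp
    then show "hinner K (V (T.W k)) l = hinner K k l" using K.ip_cnj V(1) k l by metis
  qed (use V k in auto)
  have V0: "V e = vzero K" if e: "e \<in> B' - f ` B" for e
  proof -
    have "ip (T.W k) e = 0" if k: "k \<in> vcarrier K" for k
    proof (rule T.W_orth[OF k])
      fix b assume "b \<in> B"
      then have "f b \<in> B'" "f b \<noteq> e" using f e by auto
      then show "ip e (f b) = 0" using orthonormal_ip[OF oB', of e "f b"] e by auto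
    qed simp
    then have "hinner K (V e) (V e) = 0" using V(2)[OF V(1), of e e] V(1) by simp
    then show ?thesis using V(1) K.ip_zero_imp by blast
  qed
  obtain e where e: "e \<in> B' - f ` B" using ne by blast
  \<comment> \<open>\<open>e\<close> is orthogonal to the range of \<open>T.W\<close>, so
    \<open>V\<close> kills it; adding \<open>s e\<close> brings \<open>T.W \<eta>\<close> to length
    1 without changing its image under \<open>V\<close>.\<close>
  define s where "s = sqrt (1 - (K.nrm \<eta>)\<^sup>2)"
  have "K.nrm \<eta> \<le> 1" using \<eta> by (simp add: K.hnorm_eq)
  then have s: "s\<^sup>2 = 1 - (K.nrm \<eta>)\<^sup>2" using \<eta> by (simp add: s_def power_le_one)
  define \<xi>0 where "\<xi>0 = vadd H (T.W \<eta>) (vscale H (of_real s) e)"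
  have We: "ip (T.W k) e = 0" if "k \<in> vcarrier K" for k using V(2)[OF that] V0[OF e] that by simp
  have ee: "ip e e = 1" using orthonormal_ip[OF oB', of e e] e by simp
  have "ip \<xi>0 \<xi>0 = of_real ((K.nrm \<eta>)\<^sup>2 + s\<^sup>2)"
    using We[OF \<eta>(1)] ip_swap_0[of "T.W \<eta>" e] ee T.W_isometry[OF B(1) \<eta>(1) \<eta>(1)] K.ip_self[OF \<eta>(1)]
    by (simp add: \<xi>0_def power2_eq_square)
  then have "ip \<xi>0 \<xi>0 = 1" by (simp add: s)
  then have "nrm \<xi>0 = nrm \<xi>" using \<xi> by (simp add: nrm_def)
  from unitary_transitive[OF this] obtain U U' where U: "unitary U U'" and U\<xi>: "U \<xi>0 = \<xi>" by blast
  have U'\<xi>: "U' \<xi> = \<xi>0" using unitaryD(2)[OF U] U\<xi> by metis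
  have V\<xi>0: "V \<xi>0 = \<eta>"
  proof (rule K.ip_ext)
    fix l assume l: "l \<in> vcarrier K"
    have "hinner K l (V \<xi>0) = ip (T.W l) \<xi>0" using V(2)[OF l] by simp
    also have "\<dots> = hinner K l \<eta>"
      using T.W_isometry[OF B(1) \<eta>(1) l] We[OF l] by (simp add: \<xi>0_def)
    finally show "hinner K (V \<xi>0) l = hinner K \<eta> l" using K.ip_cnj V(1) \<eta> l by metis
  qed (use V \<eta> in auto)
  show ?thesis
  proof (intro exI[of _ "\<lambda>k. U (T.W k)"] exI[of _ "\<lambda>h. V (U' h)"] conjI allI ballI impI)
    show "\<And>h k. k \<in> vcarrier K \<Longrightarrow> ip (U (T.W k)) h = hinner K k (V (U' h))"
      using V(2) unitaryD(3)[OF U] by simp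
    show "V (U' \<xi>) = \<eta>" by (simp add: U'\<xi> V\<xi>0)
    assume "\<forall>B. orthonormal_basis H B \<longrightarrow> infinite B"
    \<comment> \<open>\<open>e\<close> is dropped because it need not be orthogonal to
      \<open>\<xi>0\<close>.\<close>
    then have inf: "infinite (B' - f ` B - {e})" using inf by simp
    let ?Z = "U ` (B' - f ` B - {e})"
    have "inj U" using unitaryD(2)[OF U] by (metis injI)
    then have "infinite ?Z" using inf by (simp add: finite_image_iff inj_on_subset)
    moreover have "orthonormal ?Z" using orthonormal_ip[OF oB'] by (auto simp: orthonormal_def unitaryD(5)[OF U])
    moreover have "ip z \<xi> = 0 \<and> V (U' z) = vzero K" if "z \<in> ?Z" for z
    proof -
      obtain b where b: "z = U b" "b \<in> B' - f ` B" "b \<noteq> e" using \<open>z \<in> ?Z\<close> by blast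
      have "ip b (T.W \<eta>) = 0" using V(2)[OF \<eta>(1), of b] V0[OF b(2)] \<eta> ip_swap_0[of "T.W \<eta>" b] by simp
      moreover have "ip b e = 0" using orthonormal_ip[OF oB', of b e] b e by simp
      ultimately have "ip b \<xi>0 = 0" by (simp add: \<xi>0_def)
      then show ?thesis using b V0 by (simp add: unitaryD[OF U] U'\<xi>)
    qed
    ultimately show "\<exists>Z. infinite Z \<and> orthonormal Z \<and> (\<forall>z\<in>Z. ip z \<xi> = 0 \<and> V (U' z) = vzero K)" by blast
  qed (use V VW unitaryD(2)[OF U] in auto)
qed

end

section \<open>Representations on the fixed space and lifts of quasi-states\<close>

locale cstar_hilb = cstar A + hilb_univ H for A :: "'a cstar" and H :: "'h hilb"
begin

lemma rep_axioms:
  assumes "is_rep A H \<pi>"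
  shows "\<pi> a (vadd H x y) = vadd H (\<pi> a x) (\<pi> a y)" "\<pi> a (vscale H c x) = vscale H c (\<pi> a x)"
    "\<pi> (a +. b) x = vadd H (\<pi> a x) (\<pi> b x)" "\<pi> (c \<cdot> a) x = vscale H c (\<pi> a x)"
    "\<pi> (a *. b) x = \<pi> a (\<pi> b x)" "ip (\<pi> (st a) x) y = ip x (\<pi> a y)"
  using assms unfolding is_rep_def univ HU ball_UNIV by (elim conjE, simp)+

lemma is_repI:
  assumes "\<And>a. \<exists>C. \<forall>x. nrm (\<pi> a x) \<le> C * nrm x"
    and "\<And>a x y. \<pi> a (vadd H x y) = vadd H (\<pi> a x) (\<pi> a y)" "\<And>a c x. \<pi> a (vscale H c x) = vscale H c (\<pi> a x)"
    "\<And>a b x. \<pi> (a +. b) x = vadd H (\<pi> a x) (\<pi> b x)" "\<And>c a x. \<pi> (c \<cdot> a) x = vscale H c (\<pi> a x)"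
    "\<And>a b x. \<pi> (a *. b) x = \<pi> a (\<pi> b x)" "\<And>a x y. ip (\<pi> (st a) x) y = ip x (\<pi> a y)"
  shows "is_rep A H \<pi>"
  unfolding is_rep_def univ HU ball_UNIV hnorm_eq using assms by simp

lemma rep_contractive: assumes "is_rep A H \<pi>" shows "nrm (\<pi> a x) \<le> N a * nrm x"
  by (rule star_rep_contractive[where C = UNIV and add = "vadd H" and scale = "vscale H" and \<pi> = \<pi>])
    (use semi_inner_axioms in \<open>simp_all add: rep_axioms[OF assms]\<close>)

lemma rep_ip_bound: assumes "is_rep A H \<pi>" shows "cmod (ip (\<pi> a x) y) \<le> N a * nrm x * nrm y"
  using cauchy_schwarz[of "\<pi> a x" y] mult_right_mono[OF rep_contractive[OF assms, of a x], of "nrm y"] by simp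

lemma theta_quasi_state:
  assumes r: "is_rep A H \<pi>" and \<xi>: "nrm \<xi> = 1" shows "theta H \<xi> \<pi> \<in> quasi_states A"
proof -
  have "ip (\<pi> (st b *. b) \<xi>) \<xi> = ip (\<pi> b \<xi>) (\<pi> b \<xi>)" for b by (simp add: rep_axioms[OF r])
  then have "Im (ip (\<pi> (st b *. b) \<xi>) \<xi>) = 0 \<and> 0 \<le> Re (ip (\<pi> (st b *. b) \<xi>) \<xi>)" for b
    by (simp add: ip_self)
  then show ?thesis
    using rep_ip_bound[OF r, of _ \<xi> \<xi>] \<xi>
    unfolding quasi_states_def theta_def univ ball_UNIV by (simp add: rep_axioms(3,4)[OF r])
qed

lemma rep_conj:
  assumes r: "is_rep A H \<pi>" and U: "unitary U U'" shows "is_rep A H (\<lambda>a x. U (\<pi> a (U' x)))"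
proof (rule is_repI)
  fix a show "\<exists>C. \<forall>x. nrm (U (\<pi> a (U' x))) \<le> C * nrm x"
    using rep_contractive[OF r, of a] unitaryD(7,8)[OF U] by metis
qed (simp_all add: rep_axioms[OF r] unitary_linear[OF U] unitary_linear[OF unitary_sym[OF U]] unitaryD[OF U])

text \<open>The third clause makes \<open>\<sigma>\<close> a GNS representation extended by zero:
  everything orthogonal to \<open>\<sigma>(A)\<xi>\<close> is killed. Thus \<open>\<phi>\<close>
  controls all of \<open>\<sigma>\<close>, not only its action on the orbit of
  \<open>\<xi>\<close>.\<close>

definition tight_lift :: "'h \<Rightarrow> ('a \<Rightarrow> complex) \<Rightarrow> ('a \<Rightarrow> 'h \<Rightarrow> 'h) \<Rightarrow> bool" where
  "tight_lift \<xi> \<phi> \<sigma> \<longleftrightarrow> is_rep A H \<sigma> \<and> theta H \<xi> \<sigma> = \<phi> \<and>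
    (\<forall>x. (\<forall>a. ip x (\<sigma> a \<xi>) = 0) \<longrightarrow> (\<forall>a. \<sigma> a x = vzero H))"

text \<open>Room for counterparts of vectors orthogonal to the orbit of another lift. Null vectors
  orthogonal to \<open>\<xi>\<close> are orthogonal to all of
  \<open>\<sigma>(A)\<xi> + \<complex>\<xi>\<close>.\<close>

definition ample_null :: "'h \<Rightarrow> ('a \<Rightarrow> 'h \<Rightarrow> 'h) \<Rightarrow> bool" where
  "ample_null \<xi> \<sigma> \<longleftrightarrow>
    (\<exists>Z. infinite Z \<and> orthonormal Z \<and> (\<forall>z\<in>Z. ip z \<xi> = 0 \<and> (\<forall>a. \<sigma> a z = vzero H)))"

lemma quasi_state_lift:
  assumes \<phi>: "\<phi> \<in> quasi_states A" and \<xi>: "nrm \<xi> = 1"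
    and le: "\<And>(K :: (nat \<Rightarrow> 'a) hilb) \<pi>. hilbert_space K \<Longrightarrow> cyclic_rep A K \<pi> \<Longrightarrow> hdim_le K H"
    and less: "\<And>(K :: (nat \<Rightarrow> 'a) hilb) \<pi>. \<exists>B. orthonormal_basis H B \<and> finite B \<Longrightarrow>
      hilbert_space K \<Longrightarrow> cyclic_rep A K \<pi> \<Longrightarrow> hdim_less K H"
  shows "\<exists>\<sigma>. tight_lift \<xi> \<phi> \<sigma>
    \<and> ((\<forall>B. orthonormal_basis H B \<longrightarrow> infinite B) \<longrightarrow>
         ample_null \<xi> \<sigma>)"
proof -
  obtain K :: "(nat \<Rightarrow> 'a) hilb" and \<pi> \<eta> where K: "hilbert_space K" and \<pi>: "is_rep A K \<pi>"
    and \<eta>: "\<eta> \<in> vcarrier K" "hnorm K \<eta> \<le> 1" and st\<phi>: "\<And>a. hinner K (\<pi> a \<eta>) \<eta> = \<phi> a"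
    and dense: "\<And>x e. x \<in> vcarrier K \<Longrightarrow> e > 0 \<Longrightarrow> \<exists>a. hnorm K (vdiff K x (\<pi> a \<eta>)) < e"
    using gns_exists[OF \<phi>] by metis
  have cyc: "cyclic_rep A K \<pi>" unfolding cyclic_rep_def univ bex_UNIV using \<pi> \<eta>(1) dense by blast
  interpret K: hilb K by (rule hilb.intro[OF K])
  have less': "(\<exists>B. orthonormal_basis H B \<and> finite B) \<longrightarrow> hdim_less K H"
    using less[OF _ K cyc] by blast
  obtain W V where iso: "\<forall>h. V h \<in> vcarrier K"
      "\<forall>h. \<forall>k\<in>vcarrier K. ip (W k) h = hinner K k (V h)"
      "\<forall>k\<in>vcarrier K. V (W k) = k"
    and V\<xi>: "V \<xi> = \<eta>"
    and Z: "(\<forall>B. orthonormal_basis H B \<longrightarrow> infinite B) \<longrightarrow>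
         (\<exists>Z. infinite Z \<and> orthonormal Z \<and> (\<forall>z\<in>Z. ip z \<xi> = 0 \<and> V z = vzero K))"
    using isometry_exists[OF K le[OF K cyc] less' \<eta> \<xi>] by (elim exE conjE) rule
  note V = iso(1)[rule_format] and WV = iso(2)[rule_format] and VW = iso(3)[rule_format]
  have \<pi>r: "\<forall>a. \<forall>x\<in>vcarrier K. \<pi> a x \<in> vcarrier K"
    "\<forall>a. \<forall>x\<in>vcarrier K. \<forall>y\<in>vcarrier K. \<pi> a (vadd K x y) = vadd K (\<pi> a x) (\<pi> a y)"
    "\<forall>a. \<forall>c. \<forall>x\<in>vcarrier K. \<pi> a (vscale K c x) = vscale K c (\<pi> a x)"
    "\<forall>a. \<exists>C. \<forall>x\<in>vcarrier K. hnorm K (\<pi> a x) \<le> C * hnorm K x"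
    "\<forall>a b. \<forall>x\<in>vcarrier K. \<pi> (a +. b) x = vadd K (\<pi> a x) (\<pi> b x)"
    "\<forall>c a. \<forall>x\<in>vcarrier K. \<pi> (c \<cdot> a) x = vscale K c (\<pi> a x)"
    "\<forall>a b. \<forall>x\<in>vcarrier K. \<pi> (a *. b) x = \<pi> a (\<pi> b x)"
    "\<forall>a. \<forall>x\<in>vcarrier K. \<forall>y\<in>vcarrier K. hinner K (\<pi> (st a) x) y = hinner K x (\<pi> a y)"
    by (insert \<pi>, unfold is_rep_def univ ball_UNIV, (elim conjE, assumption)+)
  note cl = \<pi>r(1)[rule_format]
  have VW': "hinner K (V h) k = ip h (W k)" if "k \<in> vcarrier K" for h k
    using WV[OF that, of h] K.ip_cnj[of k "V h"] ip_cnj[of "W k" h] V that by simp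
  have Kext: "x = y" if "x \<in> vcarrier K" "y \<in> vcarrier K" "\<And>z. z \<in> vcarrier K \<Longrightarrow> hinner K x z = hinner K y z" for x y
    using that by (rule K.ip_ext)
  have Vadd: "V (vadd H x y) = vadd K (V x) (V y)" and Vsc: "V (vscale H c x) = vscale K c (V x)" for x y c
    by (rule Kext; simp add: V VW')+
  have Wadd: "W (vadd K x y) = vadd H (W x) (W y)" if "x \<in> vcarrier K" "y \<in> vcarrier K" for x y
    using that V by (intro ext) (simp add: WV)
  have Wsc: "W (vscale K c x) = vscale H c (W x)" if "x \<in> vcarrier K" for x c
    using that V by (intro ext) (simp add: WV)
  have Wn: "nrm (W k) = K.nrm k" if "k \<in> vcarrier K" for k
    using that by (simp add: nrm_def K.nrm_def WV VW)
  have Vn: "K.nrm (V h) \<le> nrm h" for h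
  proof -
    have "(K.nrm (V h))\<^sup>2 = Re (ip (W (V h)) h)" using V WV[OF V] by (simp add: K.nrm_sq)
    also have "\<dots> \<le> nrm (W (V h)) * nrm h" using cauchy_schwarz[of "W (V h)" h] complex_Re_le_cmod[of "ip (W (V h)) h"] by simp
    also have "nrm (W (V h)) = K.nrm (V h)" by (rule Wn[OF V])
    finally have "K.nrm (V h) * K.nrm (V h) \<le> K.nrm (V h) * nrm h" by (simp add: power2_eq_square)
    then show ?thesis using K.nrm_ge0[OF V, of h] nrm_ge0[of h] by (cases "K.nrm (V h) = 0") auto
  qed
  \<comment> \<open>\<open>V W = id\<close> makes this multiplicative, adjointness of
    \<open>V\<close> and \<open>W\<close> makes it star-preserving, and
    \<open>V \<xi> = \<eta>\<close> gives the functional \<open>\<phi>\<close>.\<close>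
  define \<sigma> where "\<sigma> a x = W (\<pi> a (V x))" for a x
  have rep: "is_rep A H \<sigma>"
  proof (rule is_repI)
    fix a
    obtain C where C: "\<And>x. x \<in> vcarrier K \<Longrightarrow> K.nrm (\<pi> a x) \<le> C * K.nrm x"
      using \<pi>r(4) unfolding K.hnorm_eq by blast
    have "nrm (\<sigma> a x) \<le> \<bar>C\<bar> * nrm x" for x
    proof -
      have "nrm (\<sigma> a x) \<le> C * K.nrm (V x)" unfolding \<sigma>_def using Wn[OF cl[OF V]] C[OF V] by simp
      also have "\<dots> \<le> \<bar>C\<bar> * K.nrm (V x)" by (intro mult_right_mono) (auto simp: V)
      also have "\<dots> \<le> \<bar>C\<bar> * nrm x" using Vn by (intro mult_left_mono) auto
      finally show ?thesis .
    qed
    then show "\<exists>C. \<forall>x. nrm (\<sigma> a x) \<le> C * nrm x" by blast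
  next
    fix a x y
    show "ip (\<sigma> (st a) x) y = ip x (\<sigma> a y)"
      using cl V \<pi>r(8) by (simp add: \<sigma>_def WV VW'[symmetric])
  qed (simp_all add: \<sigma>_def V cl Vadd Vsc Wadd Wsc \<pi>r VW)
  have th: "theta H \<xi> \<sigma> = \<phi>"
    by (rule HOL.ext) (simp add: theta_def \<sigma>_def WV cl V V\<xi> \<eta> st\<phi>)
  have kill: "\<sigma> a x = vzero H" if "V x = vzero K" for a x
  proof -
    obtain C where C: "\<And>x. x \<in> vcarrier K \<Longrightarrow> K.nrm (\<pi> a x) \<le> C * K.nrm x"
      using \<pi>r(4) unfolding K.hnorm_eq by blast
    have "K.nrm (\<pi> a (V x)) \<le> C * K.nrm (V x)" by (rule C[OF V])
    also have "K.nrm (V x) = 0" using that K.nrm_zero_iff by simp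
    finally have "nrm (\<sigma> a x) \<le> 0" by (simp add: \<sigma>_def Wn cl V)
    then have "nrm (\<sigma> a x) = 0" by (intro order_antisym) auto
    then show ?thesis by (rule nrm0)
  qed
  \<comment> \<open>A vector \<open>x\<close> orthogonal to the orbit of \<open>\<xi>\<close> has
    \<open>V x\<close> orthogonal to the orbit of \<open>\<eta>\<close>, which is dense in
    \<open>K\<close>.\<close>
  have orth: "V x = vzero K" if x: "\<And>a. ip x (\<sigma> a \<xi>) = 0" for x
  proof -
    have o: "hinner K (V x) (\<pi> a \<eta>) = 0" for a
      using x[of a] cl \<eta> by (simp add: \<sigma>_def V\<xi> VW'[symmetric])
    have "K.nrm (V x) \<le> 0 + e" if e: "e > 0" for e
    proof -
      obtain a where a: "K.nrm (K.dif (V x) (\<pi> a \<eta>)) < e"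
        using dense[OF V e, of x] unfolding K.hnorm_eq K.vdiff_eq by blast
      have p: "\<pi> a \<eta> \<in> vcarrier K" using cl \<eta> by blast
      have "(K.nrm (V x))\<^sup>2 = Re (hinner K (V x) (K.dif (V x) (\<pi> a \<eta>)))"
        using o p V by (simp add: K.nrm_sq)
      also have "\<dots> \<le> K.nrm (V x) * K.nrm (K.dif (V x) (\<pi> a \<eta>))"
        using K.cauchy_schwarz[of "V x" "K.dif (V x) (\<pi> a \<eta>)"] p V
          complex_Re_le_cmod[of "hinner K (V x) (K.dif (V x) (\<pi> a \<eta>))"] by (meson K.dif_closed order_trans)
      also have "\<dots> \<le> K.nrm (V x) * e" using a V by (intro mult_left_mono) auto
      finally have "K.nrm (V x) * K.nrm (V x) \<le> K.nrm (V x) * e" by (simp add: power2_eq_square)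
      then show ?thesis using K.nrm_ge0[OF V, of x] e by (cases "K.nrm (V x) = 0") auto
    qed
    then have "K.nrm (V x) \<le> 0" by (rule field_le_epsilon)
    then have "K.nrm (V x) = 0" using K.nrm_ge0[OF V, of x] by linarith
    then show ?thesis using K.nrm_zero_iff[OF V] by blast
  qed
  show ?thesis unfolding tight_lift_def ample_null_def using rep th kill orth Z by (intro exI[of _ \<sigma>]) blast
qed

end

section \<open>Gram matrices and unitaries\<close>

context hilb_univ begin

definition subspace :: "'h set \<Rightarrow> bool" where
  "subspace M \<longleftrightarrow> vzero H \<in> M \<and> (\<forall>x\<in>M. \<forall>y\<in>M. vadd H x y \<in> M) \<and> (\<forall>c. \<forall>x\<in>M. vscale H c x \<in> M)"
definition perp :: "'h set \<Rightarrow> 'h set" where "perp M = {x. \<forall>m\<in>M. ip x m = 0}"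
definition proj :: "'h set \<Rightarrow> 'h \<Rightarrow> 'h" where "proj E x = lincomb (ip x) E"

lemma subspace_dif: "subspace M \<Longrightarrow> x \<in> M \<Longrightarrow> y \<in> M \<Longrightarrow> dif x y \<in> M"
  by (simp add: subspace_def dif_def)

lemma subspace_perp: "subspace (perp M)"
  by (simp add: subspace_def perp_def)

lemma perp_swap: "x \<in> M \<Longrightarrow> y \<in> perp M \<Longrightarrow> ip x y = 0"
  using ip_swap_0[of y x] by (simp add: perp_def)

text \<open>\<open>M\<close> is not assumed closed: the Riesz sequence in \<open>M\<close> for the
  functional \<open>\<langle>-, x\<rangle>\<close> converges in \<open>H\<close> to the projection
  onto the closure, so \<open>p\<close> is only approximated from \<open>M\<close>.\<close>

lemma projection_exists:
  assumes M: "subspace M"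
  shows "\<exists>p. dif x p \<in> perp M \<and> (\<forall>e>0. \<exists>m\<in>M. nrm (dif m p) < e)"
proof -
  interpret S: semi_inner M "vadd H" "vscale H" ip
  proof
    show "\<And>x y. x \<in> M \<Longrightarrow> y \<in> M \<Longrightarrow> ip y x = cnj (ip x y)" by (rule ip_cnj) auto
  qed (use M in \<open>auto simp: subspace_def ip_nonneg\<close>)
  have "\<exists>X. S.Cauchy_seq X \<and> (\<forall>v\<in>M. (\<lambda>n. ip v (X n)) \<longlonglongrightarrow> ip v x)"
    by (rule S.riesz_sequence[where B = "nrm x"])
      (use cauchy_schwarz[of _ x] in \<open>auto simp: mult.commute\<close>)
  then obtain X where X: "S.Cauchy_seq X" and lim: "\<And>v. v \<in> M \<Longrightarrow> (\<lambda>n. ip v (X n)) \<longlonglongrightarrow> ip v x" by blast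
  have XM: "X n \<in> M" for n using X by (rule S.Cauchy_seqD)
  have "Cauchy_seq X" using X unfolding Cauchy_seq_def S.Cauchy_seq_def by simp
  from complete[OF this] obtain p where p: "\<And>e. e > 0 \<Longrightarrow> \<exists>N. \<forall>n\<ge>N. nrm (dif (X n) p) < e" by blast
  have 0: "ip m (dif x p) = 0" if m: "m \<in> M" for m
  proof -
    have "(\<lambda>n. ip m (X n)) \<longlonglongrightarrow> ip m p" by (rule Cauchy_seq_ip_limit) (use p in auto)
    then have "ip m p = ip m x" using lim[OF m] LIMSEQ_unique by blast
    then show ?thesis by simp
  qed
  have "ip (dif x p) m = 0" if m: "m \<in> M" for m
    by (rule ip_swap_0[OF _ _ 0[OF m]]) auto
  then have "dif x p \<in> perp M" unfolding perp_def by blast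
  moreover have "\<exists>m\<in>M. nrm (dif m p) < e" if "e > 0" for e using p[OF that] XM by blast
  ultimately show ?thesis by blast
qed

lemma proj_ip: "finite E \<Longrightarrow> ip (proj E x) v = (\<Sum>e\<in>E. ip x e * ip e v)"
  by (simp add: proj_def lincomb(2))

text \<open>Additivity of the remainder for \<open>x = (x - y) + y\<close>, in the form needed for
  triangle estimates.\<close>

lemma proj_dif: assumes "finite E" shows "dif x (proj E x) = vadd H (dif (dif x y) (proj E (dif x y))) (dif y (proj E y))"
  using assms by (intro ext) (simp add: proj_ip sum_subtractf algebra_simps)

lemma proj_orth: "orthonormal E \<Longrightarrow> finite E \<Longrightarrow> e \<in> E \<Longrightarrow> ip (dif x (proj E x)) e = 0"
  unfolding proj_def by (rule bessel_eq(2)) auto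

lemma proj_nrm: "orthonormal E \<Longrightarrow> finite E \<Longrightarrow> (nrm (dif x (proj E x)))\<^sup>2 = (nrm x)\<^sup>2 - (\<Sum>e\<in>E. (cmod (ip x e))\<^sup>2)"
  unfolding proj_def by (rule bessel_eq(1)) auto

lemma proj_res_le: assumes "orthonormal E" "finite E" shows "nrm (dif x (proj E x)) \<le> nrm x"
proof -
  have "(nrm (dif x (proj E x)))\<^sup>2 \<le> (nrm x)\<^sup>2" unfolding proj_nrm[OF assms] by (simp add: sum_nonneg)
  then show ?thesis by (rule power2_le_imp_le) simp
qed

lemma proj_res_mono:
  assumes "orthonormal E'" "finite E'" "E \<subseteq> E'" shows "nrm (dif x (proj E' x)) \<le> nrm (dif x (proj E x))"
proof -
  have E: "orthonormal E" "finite E" using assms orthonormal_subset finite_subset by blast+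
  have "(nrm (dif x (proj E' x)))\<^sup>2 \<le> (nrm (dif x (proj E x)))\<^sup>2"
    unfolding proj_nrm[OF E] proj_nrm[OF assms(1,2)] using assms by (simp add: sum_mono2)
  then show ?thesis by (rule power2_le_imp_le) simp
qed

lemma proj_self_orth:
  assumes "orthonormal E" "finite E" shows "ip x (dif x (proj E x)) = of_real ((nrm (dif x (proj E x)))\<^sup>2)"
proof -
  let ?r = "dif x (proj E x)"
  have "ip e ?r = 0" if "e \<in> E" for e by (rule ip_swap_0[OF _ _ proj_orth[OF assms that]]) auto
  then have "ip (proj E x) ?r = 0" using assms(2) by (simp add: proj_ip)
  then have "ip x ?r = ip ?r ?r" by simp
  then show ?thesis by (simp only: ip_self HU UNIV_I)
qed

lemma proj_in_subspace:
  assumes "subspace M" "finite E" "\<And>e. e \<in> E \<Longrightarrow> e \<notin> M \<Longrightarrow> ip x e = 0"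
  shows "proj E x \<in> M"
proof -
  have "proj E x = lincomb (ip x) (E \<inter> M)"
  proof (rule ext)
    fix z
    have "(\<Sum>e\<in>E. ip x e * ip e z) = (\<Sum>e\<in>E \<inter> M. ip x e * ip e z)"
      using assms by (intro sum.mono_neutral_right) auto
    then show "ip (proj E x) z = ip (lincomb (ip x) (E \<inter> M)) z" using assms(2) by (simp add: proj_ip lincomb(2))
  qed
  also have "\<dots> \<in> M" using assms(1,2) by (intro lincomb_in_subspace) (auto simp: subspace_def)
  finally show ?thesis .
qed

text \<open>A vector on one side of the splitting has components only along elements of
  \<open>E\<close> on the same side, so its remainder stays there too and the enlarged system
  remains adapted to \<open>M\<close>.\<close>

lemma gram_schmidt_step:
  assumes M: "subspace M" and E: "orthonormal E" "finite E" "E \<subseteq> M \<union> perp M" and x: "x \<in> M \<union> perp M"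
  shows "\<exists>E'. E \<subseteq> E' \<and> orthonormal E' \<and> finite E' \<and> E' \<subseteq> M \<union> perp M \<and> nrm (dif x (proj E' x)) = 0"
proof -
  define r where "r = dif x (proj E x)"
  show ?thesis
  proof (cases "r = vzero H")
    case True
    then have "nrm (dif x (proj E x)) = 0" using nrm_zero_iff r_def by simp
    then show ?thesis using E by blast
  next
    case False
    have rM: "r \<in> M \<union> perp M"
    proof (cases "x \<in> M")
      case True
      then have "proj E x \<in> M" using M E perp_swap by (intro proj_in_subspace) auto
      then show ?thesis using subspace_dif[OF M True] by (simp add: r_def)
    next
      case False
      then have xp: "x \<in> perp M" using x by blast
      then have "proj E x \<in> perp M" using subspace_perp E by (intro proj_in_subspace) (auto simp: perp_def)
      then show ?thesis using subspace_dif[OF subspace_perp xp] by (simp add: r_def)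
    qed
    define u where "u = vscale H (of_real (1 / nrm r)) r"
    have n: "nrm r > 0" using False by (intro nrm_pos) auto
    have orth: "\<forall>e\<in>E. ip r e = 0" unfolding r_def by (intro ballI proj_orth E(1,2))
    have orthonormal: "orthonormal (insert u E)" unfolding u_def using E(1) False orth by (intro orthonormal_insert_normalize) auto
    have "ip u u = 1" unfolding u_def using False by (intro normalize) auto
    moreover have "ip u e = 0" if "e \<in> E" for e using orth that by (simp add: u_def)
    ultimately have uE: "u \<notin> E" by force
    have fin: "finite (insert u E)" using E by simp
    have "ip x u = of_real (nrm r)"
      using proj_self_orth[OF E(1,2), of x] n by (simp add: u_def r_def[symmetric] power2_eq_square)
    then have "(nrm (dif x (proj (insert u E) x)))\<^sup>2 = (nrm r)\<^sup>2 - (nrm r)\<^sup>2"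
      unfolding proj_nrm[OF orthonormal fin] using E uE proj_nrm[OF E(1,2), of x] by (simp add: r_def[symmetric])
    then have "nrm (dif x (proj (insert u E) x)) = 0" by simp
    moreover have "u \<in> M \<union> perp M" using rM M subspace_perp by (auto simp: u_def subspace_def)
    ultimately show ?thesis using orthonormal fin E by (intro exI[of _ "insert u E"]) auto
  qed
qed

text \<open>Split \<open>x = p + q\<close> with \<open>q\<close> in \<open>perp M\<close>;
  \<open>q\<close> is captured exactly and \<open>p\<close> through a nearby \<open>m\<close> in
  \<open>M\<close>. The error remains because \<open>M\<close> may be smaller than its
  closure.\<close>

lemma gram_schmidt_approx:
  assumes M: "subspace M" and \<xi>: "\<xi> \<in> M" "nrm \<xi> = 1" and X: "finite X" and e: "e > 0"
  shows "\<exists>E. orthonormal E \<and> finite E \<and> \<xi> \<in> E \<and> E \<subseteq> M \<union> perp M \<and> (\<forall>x\<in>X. nrm (dif x (proj E x)) < e)"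
  using X
proof (induction X)
  case empty
  have "orthonormal {\<xi>}" using \<xi> by (simp add: orthonormal_def ip_self)
  then show ?case using \<xi> by (intro exI[of _ "{\<xi>}"]) auto
next
  case (insert x X)
  then obtain E where E: "orthonormal E" "finite E" "\<xi> \<in> E" "E \<subseteq> M \<union> perp M" "\<forall>x\<in>X. nrm (dif x (proj E x)) < e" by blast
  obtain p where p: "dif x p \<in> perp M" "\<And>e. e > 0 \<Longrightarrow> \<exists>m\<in>M. nrm (dif m p) < e"
    using projection_exists[OF M] by blast
  obtain m where m: "m \<in> M" "nrm (dif m p) < e" using p(2)[OF e] by blast
  define q where "q = dif x p"
  obtain E1 where E1: "E \<subseteq> E1" "orthonormal E1" "finite E1" "E1 \<subseteq> M \<union> perp M" "nrm (dif m (proj E1 m)) = 0"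
    using gram_schmidt_step[OF M E(1,2,4), of m] m by blast
  obtain E2 where E2: "E1 \<subseteq> E2" "orthonormal E2" "finite E2" "E2 \<subseteq> M \<union> perp M" "nrm (dif q (proj E2 q)) = 0"
    using gram_schmidt_step[OF M E1(2,3,4), of q] p(1) q_def by blast
  have mono: "nrm (dif y (proj E2 y)) \<le> nrm (dif y (proj F y))" if "F \<subseteq> E2" for y F
    by (rule proj_res_mono[OF E2(2,3) that])
  have m0: "nrm (dif m (proj E2 m)) = 0" using mono[OF E2(1), of m] E1(5) by (intro order_antisym) auto
  have "nrm (dif x (proj E2 x)) < e"
  proof -
    have "nrm (dif x (proj E2 x)) \<le> nrm (dif (dif x q) (proj E2 (dif x q))) + nrm (dif q (proj E2 q))"
      unfolding proj_dif[OF E2(3), of x q] by (rule nrm_triangle) auto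
    also have "\<dots> = nrm (dif (dif x q) (proj E2 (dif x q)))" using E2(5) by simp
    also have "dif x q = p" by (rule ext) (simp add: q_def)
    also have "nrm (dif p (proj E2 p)) \<le> nrm (dif (dif p m) (proj E2 (dif p m))) + nrm (dif m (proj E2 m))"
      unfolding proj_dif[OF E2(3), of p m] by (rule nrm_triangle) auto
    also have "\<dots> \<le> nrm (dif p m)" using m0 proj_res_le[OF E2(2,3)] by simp
    also have "\<dots> = nrm (dif m p)" by (rule nrm_dif_commute) auto
    finally show ?thesis using m(2) by linarith
  qed
  moreover have "nrm (dif y (proj E2 y)) < e" if "y \<in> X" for y
    using E(5) that mono[of E y] E1(1) E2(1) by fastforce
  ultimately show ?case using E(3) E1(1) E2 by (intro exI[of _ E2]) auto
qed

text \<open>In the induction step the image of the new vector is made orthogonal to the previous basis vectors, and the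
  normalised remainder is rotated onto the new basis vector.\<close>

lemma gram_unitary:
  assumes \<xi>: "nrm \<xi> = 1" and f\<xi>: "\<And>\<psi>. f \<psi> \<xi> = \<xi>"
    and "finite E" "\<xi> \<notin> E" "orthonormal (insert \<xi> E)"
    and "\<And>e e'. e \<in> insert \<xi> E \<Longrightarrow> e' \<in> insert \<xi> E \<Longrightarrow>
      ((\<lambda>\<psi>. ip (f \<psi> e) (f \<psi> e')) \<longlongrightarrow> (if e = e' then 1 else 0)) F"
  shows "\<exists>U U'. (\<forall>\<psi>. unitary (U \<psi>) (U' \<psi>) \<and> U \<psi> \<xi> = \<xi>) \<and>
    (\<forall>e\<in>insert \<xi> E. ((\<lambda>\<psi>. nrm (dif (U \<psi> (f \<psi> e)) e)) \<longlongrightarrow> 0) F)"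
  using assms(3-)
proof (induction E)
  case empty
  have "nrm (dif \<xi> \<xi>) = 0" by (simp add: nrm_def)
  then show ?case
    by (intro exI[of _ "\<lambda>_ x. x"]) (simp add: unitary_id f\<xi>)
next
  case (insert e E)
  let ?E1 = "insert \<xi> E"
  have E1: "orthonormal ?E1" "finite ?E1" using insert.prems insert.hyps orthonormal_subset[of _ ?E1] by auto
  have eE1: "e \<notin> ?E1" using insert by auto
  have gram: "((\<lambda>\<psi>. ip (f \<psi> a) (f \<psi> b)) \<longlongrightarrow> (if a = b then 1 else 0)) F"
    if "a \<in> insert e ?E1" "b \<in> insert e ?E1" for a b
    using that by (intro insert.prems(3)) auto
  have ee: "ip e e = 1" "\<And>i. i \<in> ?E1 \<Longrightarrow> ip i e = 0"
    using orthonormal_ip[OF insert.prems(2)] eE1 by auto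
  have "\<exists>U U'. (\<forall>\<psi>. unitary (U \<psi>) (U' \<psi>) \<and> U \<psi> \<xi> = \<xi>) \<and>
    (\<forall>e\<in>?E1. ((\<lambda>\<psi>. nrm (dif (U \<psi> (f \<psi> e)) e)) \<longlongrightarrow> 0) F)"
  proof (rule insert.IH)
    show "\<xi> \<notin> E" using insert.prems(1) by simp
    show "orthonormal ?E1" by (rule E1(1))
    show "((\<lambda>\<psi>. ip (f \<psi> a) (f \<psi> b)) \<longlongrightarrow> (if a = b then 1 else 0)) F" if "a \<in> ?E1" "b \<in> ?E1" for a b
      using that by (intro gram) auto
  qed
  then obtain U U' where UU: "\<forall>\<psi>. unitary (U \<psi>) (U' \<psi>) \<and> U \<psi> \<xi> = \<xi>"
    and limU: "\<forall>e\<in>?E1. ((\<lambda>\<psi>. nrm (dif (U \<psi> (f \<psi> e)) e)) \<longlongrightarrow> 0) F"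
    by (elim exE conjE) rule
  have U: "unitary (U \<psi>) (U' \<psi>)" "U \<psi> \<xi> = \<xi>" for \<psi> using UU by auto
  note lim = limU[rule_format]
  define t where "t \<psi> = U \<psi> (f \<psi> e)" for \<psi>
  define r where "r \<psi> = dif (t \<psi>) (proj ?E1 (t \<psi>))" for \<psi>
  define u where "u \<psi> = vscale H (of_real (1 / nrm (r \<psi>))) (r \<psi>)" for \<psi>
  \<comment> \<open>\<open>e\<close> and the normalised remainder are both orthogonal to the vectors
    already treated, so the rotation between them fixes those. A vanishing remainder gets the
    identity; along \<open>F\<close> this eventually does not occur.\<close>
  have "\<exists>V V'. unitary V V' \<and> (\<forall>i\<in>?E1. V i = i) \<and> (r \<psi> \<noteq> vzero H \<longrightarrow> V (u \<psi>) = e)" for \<psi>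
  proof (cases "r \<psi> = vzero H")
    case True then show ?thesis using unitary_id by blast
  next
    case False
    have "ip (u \<psi>) (u \<psi>) = ip e e" unfolding u_def ee(1) using False by (intro normalize) auto
    then have "nrm (u \<psi>) = nrm e" by (simp add: nrm_def)
    moreover have "ip i (u \<psi>) = 0" if "i \<in> ?E1" for i
      using proj_orth[OF E1 that, of "t \<psi>"] ip_swap_0[of "r \<psi>" i] by (simp add: u_def r_def)
    ultimately show ?thesis using unitary_transitive[of "u \<psi>" e] ee(2) by metis
  qed
  then obtain V V' where V: "\<And>\<psi>. unitary (V \<psi>) (V' \<psi>)" "\<And>\<psi> i. i \<in> ?E1 \<Longrightarrow> V \<psi> i = i"
    "\<And>\<psi>. r \<psi> \<noteq> vzero H \<Longrightarrow> V \<psi> (u \<psi>) = e" by metis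
  have tt: "((\<lambda>\<psi>. (nrm (t \<psi>))\<^sup>2) \<longlongrightarrow> 1) F"
    using tendsto_Re[OF gram[of e e]] by (simp add: t_def unitaryD(7)[OF U(1)] nrm_sq)
  have tn: "((\<lambda>\<psi>. nrm (t \<psi>)) \<longlongrightarrow> 1) F"
    using tendsto_real_sqrt[OF tt] by simp
  have ti: "((\<lambda>\<psi>. ip (t \<psi>) i) \<longlongrightarrow> 0) F" if i: "i \<in> ?E1" for i
  proof -
    have 1: "((\<lambda>\<psi>. ip (t \<psi>) (U \<psi> (f \<psi> i))) \<longlongrightarrow> 0) F"
    proof -
      have "e \<noteq> i" using i eE1 by blast
      then show ?thesis using gram[OF insertI1 insertI2[OF i]] by (simp add: t_def unitaryD(5)[OF U(1)])
    qed
    have 0: "((\<lambda>\<psi>. nrm (t \<psi>) * nrm (dif (U \<psi> (f \<psi> i)) i)) \<longlongrightarrow> 1 * 0) F"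
      by (intro tendsto_mult tn lim[OF i])
    have "((\<lambda>\<psi>. ip (t \<psi>) (dif (U \<psi> (f \<psi> i)) i)) \<longlongrightarrow> 0) F"
      by (rule Lim_null_comparison[OF always_eventually 0[simplified]]) (intro allI cauchy_schwarz; simp)
    from tendsto_diff[OF 1 this] show ?thesis by simp
  qed
  \<comment> \<open>In the limit the new image has length 1 and is orthogonal to the old basis
    vectors, so its remainder has norm tending to 1.\<close>
  have "((\<lambda>\<psi>. (nrm (t \<psi>))\<^sup>2 - (\<Sum>i\<in>?E1. (cmod (ip (t \<psi>) i))\<^sup>2)) \<longlongrightarrow> 1 - (\<Sum>i\<in>?E1. (cmod 0)\<^sup>2)) F"
    by (intro tendsto_intros tt ti) 
  then have "((\<lambda>\<psi>. (nrm (r \<psi>))\<^sup>2) \<longlongrightarrow> 1) F" by (simp add: r_def proj_nrm[OF E1])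
  then have rn: "((\<lambda>\<psi>. nrm (r \<psi>)) \<longlongrightarrow> 1) F" using tendsto_real_sqrt by fastforce
  have "eventually (\<lambda>\<psi>. nrm (r \<psi>) > 0) F" using rn by (rule order_tendstoD) simp
  \<comment> \<open>\<open>\<langle>t, u\<rangle> = nrm r\<close> gives \<open>\<parallel>t -
    u\<parallel>^2 = \<parallel>t\<parallel>^2 - 2 nrm r + 1\<close>, which tends to 0.\<close>
  then have matrix_coeff: "eventually (\<lambda>\<psi>. nrm (dif (V \<psi> (t \<psi>)) e) = sqrt ((nrm (t \<psi>))\<^sup>2 - 2 * nrm (r \<psi>) + 1)) F"
  proof eventually_elim
    case (elim \<psi>)
    then have nz: "r \<psi> \<noteq> vzero H" using nrm_zero_iff[of "r \<psi>"] by auto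
    have uu: "nrm (u \<psi>) = 1" using elim by (simp add: u_def norm_divide)
    have "ip (t \<psi>) (u \<psi>) = of_real (nrm (r \<psi>))"
      using proj_self_orth[OF E1, of "t \<psi>"] elim by (simp add: u_def r_def[symmetric] power2_eq_square)
    then have "(nrm (dif (t \<psi>) (u \<psi>)))\<^sup>2 = (nrm (t \<psi>))\<^sup>2 - 2 * nrm (r \<psi>) + 1"
      by (simp add: nrm_dif_sq uu)
    moreover have "nrm (dif (V \<psi> (t \<psi>)) e) = nrm (dif (t \<psi>) (u \<psi>))"
      using V(3)[OF nz] unitary_linear(3)[OF V(1)] unitaryD(7)[OF V(1)] by metis
    ultimately show ?case by (metis nrm_ge0 HU UNIV_I real_sqrt_unique)
  qed
  have "((\<lambda>\<psi>. sqrt ((nrm (t \<psi>))\<^sup>2 - 2 * nrm (r \<psi>) + 1)) \<longlongrightarrow> sqrt (1 - 2 * 1 + 1)) F"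
    by (intro tendsto_intros tt rn)
  then have new: "((\<lambda>\<psi>. nrm (dif (V \<psi> (t \<psi>)) e)) \<longlongrightarrow> 0) F"
    using tendsto_cong[OF matrix_coeff] by simp
  have old: "((\<lambda>\<psi>. nrm (dif (V \<psi> (U \<psi> (f \<psi> i))) i)) \<longlongrightarrow> 0) F" if i: "i \<in> ?E1" for i
  proof -
    have "nrm (dif (V \<psi> (U \<psi> (f \<psi> i))) i) = nrm (dif (U \<psi> (f \<psi> i)) i)" for \<psi>
      using V(2)[OF i] unitary_linear(3)[OF V(1)] unitaryD(7)[OF V(1)] by metis
    then show ?thesis using lim[OF i] by simp
  qed
  show ?case
    using U V(1,2) unitary_comp[OF U(1) V(1)] new old
    by (intro exI[of _ "\<lambda>\<psi> x. V \<psi> (U \<psi> x)"] exI[of _ "\<lambda>\<psi> x. U' \<psi> (V' \<psi> x)"]) (auto simp: t_def)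
qed

end

section \<open>Openness of the vector state map\<close>

lemma cmod_diff_third:
  "cmod (p - q) < e / 3 \<Longrightarrow> cmod (q - r) < e / 3 \<Longrightarrow> cmod (s - r) < e / 3 \<Longrightarrow> cmod (p - s) < e"
  using dist_triangle_third[of p q e r s] by (simp add: dist_norm norm_minus_commute)

lemma open_fun_finite_coordinates:
  fixes G0 :: "'i \<Rightarrow> complex"
  assumes "open V" "G0 \<in> V"
  shows "\<exists>I e. finite I \<and> e > 0 \<and> (\<forall>G. (\<forall>i\<in>I. cmod (G i - G0 i) < e) \<longrightarrow> G \<in> V)"
proof -
  have "openin (product_topology (\<lambda>_. euclidean) UNIV) V" using assms(1) by (simp only: open_fun_def)
  from product_topology_open_contains_basis[OF this assms(2)]
  obtain X where X: "G0 \<in> Pi\<^sub>E UNIV X" "\<And>i. open (X i)" "finite {i. X i \<noteq> UNIV}" "Pi\<^sub>E UNIV X \<subseteq> V"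
    by auto
  let ?I = "{i. X i \<noteq> UNIV}"
  have "\<exists>e>0. \<forall>y. cmod (y - G0 i) < e \<longrightarrow> y \<in> X i" for i
    using X(1) X(2)[of i] unfolding open_dist dist_norm by (auto simp: PiE_iff)
  then obtain e where e: "\<And>i. e i > 0" "\<And>i y. cmod (y - G0 i) < e i \<Longrightarrow> y \<in> X i" by metis
  define d where "d = Min (insert 1 (e ` ?I))"
  have d: "d > 0" "\<And>i. i \<in> ?I \<Longrightarrow> d \<le> e i" using X(3) e(1) by (auto simp: d_def)
  have "G \<in> V" if G: "\<forall>i\<in>?I. cmod (G i - G0 i) < d" for G
  proof -
    have "G i \<in> X i" for i
    proof (cases "i \<in> ?I")
      case True
      then show ?thesis using G d(2)[OF True] by (intro e(2)) fastforce
    qed auto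
    then show ?thesis using X(4) by (auto simp: PiE_iff)
  qed
  then show ?thesis using X(3) d(1) by blast
qed

context hilb_univ begin

lemma finite_ons_choice:
  assumes Z: "infinite Z" "orthonormal Z" and E: "finite E"
  shows "\<exists>z. (\<forall>e\<in>E. z e \<in> Z) \<and> (\<forall>e\<in>E. \<forall>e'\<in>E. ip (z e) (z e') = (if e = e' then 1 else 0))"
proof -
  obtain Y where Y: "Y \<subseteq> Z" "finite Y" "card Y = card E" using infinite_arbitrarily_large[OF Z(1)] by metis
  obtain z where z: "z ` E \<subseteq> Y" "inj_on z E" using card_le_inj[OF E Y(2)] Y(3) by auto
  have "ip (z e) (z e') = (if e = e' then 1 else 0)" if "e \<in> E" "e' \<in> E" for e e'
  proof -
    have "z e \<in> Z" "z e' \<in> Z" "z e = z e' \<longleftrightarrow> e = e'" using that z Y(1) by (auto simp: inj_on_def)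
    then show ?thesis using orthonormal_ip[OF Z(2)] by simp
  qed
  then show ?thesis using z(1) Y(1) by blast
qed

lemma proj_le:
  assumes "orthonormal E" "finite E" shows "nrm (proj E x) \<le> nrm x"
proof -
  let ?r = "dif x (proj E x)"
  have "proj E x = dif x ?r" by (rule ext) simp
  then have "(nrm (proj E x))\<^sup>2 = (nrm (dif x ?r))\<^sup>2" by simp
  also have "\<dots> = (nrm x)\<^sup>2 - (nrm ?r)\<^sup>2"
  proof -
    have "Re (ip x ?r) = (nrm ?r)\<^sup>2" by (simp only: proj_self_orth[OF assms] Re_complex_of_real)
    then show ?thesis using nrm_dif_sq[unfolded HU, OF UNIV_I UNIV_I, of x ?r] by linarith
  qed
  also have "\<dots> \<le> (nrm x)\<^sup>2" by simp
  finally show ?thesis by (rule power2_le_imp_le) simp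
qed

end

context cstar_hilb begin

section \<open>Matrix coefficients and the orbit of \<open>\<xi>\<close>\<close>

lemma rep_ip_diff:
  assumes r: "is_rep A H \<rho>"
  shows "cmod (ip (\<rho> a u) u' - ip (\<rho> a v) v') \<le> N a * nrm (dif u v) * nrm u' + N a * nrm v * nrm (dif u' v')"
proof -
  have d: "\<rho> a (dif u v) = dif (\<rho> a u) (\<rho> a v)" by (simp add: dif_def rep_axioms[OF r])
  have eq: "ip (\<rho> a u) u' - ip (\<rho> a v) v' = ip (\<rho> a (dif u v)) u' + ip (\<rho> a v) (dif u' v')"
    by (simp add: d)
  show ?thesis
    unfolding eq using rep_ip_bound[OF r, of a "dif u v" u'] rep_ip_bound[OF r, of a v "dif u' v'"]
      norm_triangle_ineq[of "ip (\<rho> a (dif u v)) u'" "ip (\<rho> a v) (dif u' v')"] by linarith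
qed

lemma rep_pr_expand:
  assumes r: "is_rep A H \<rho>" and E: "finite E"
  shows "ip (\<rho> a (proj E x)) (proj E y) = (\<Sum>e'\<in>E. cnj (ip y e') * (\<Sum>e\<in>E. ip x e * ip (\<rho> a e) e'))"
proof -
  have 1: "ip (\<rho> a (proj E x)) w = (\<Sum>e\<in>E. ip x e * ip (\<rho> a e) w)" for w
  proof -
    have s: "ip (\<rho> a p) w = ip p (\<rho> (st a) w)" for p
      using rep_axioms(6)[OF r, of "st a" p w] by simp
    show ?thesis unfolding s proj_ip[OF E] ..
  qed
  have "ip (\<rho> a (proj E x)) (proj E y) = (\<Sum>e'\<in>E. cnj (ip y e') * ip (\<rho> a (proj E x)) e')"
    unfolding proj_def[of E y] by (rule lincomb_ip_right) (use E in auto)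
  then show ?thesis by (simp only: 1)
qed

text \<open>The element \<open>c + l\<close> of the unitization applied to \<open>\<xi>\<close>. The
  coordinates do not mention the representation, so the same pair can be evaluated for all lifts at
  once.\<close>

definition vec :: "'h \<Rightarrow> ('a \<Rightarrow> 'h \<Rightarrow> 'h) \<Rightarrow> 'a \<Rightarrow> complex \<Rightarrow> 'h" where
  "vec \<xi> \<rho> c l = vadd H (\<rho> c \<xi>) (vscale H l \<xi>)"

text \<open>Each Gram entry is a continuous expression in finitely many values of
  \<open>\<psi>\<close>, so it varies weak-* continuously although the lifts are chosen without any
  continuity.\<close>

lemma vec_gram:
  assumes r: "is_rep A H \<rho>" and \<xi>: "nrm \<xi> = 1" and \<psi>: "theta H \<xi> \<rho> = \<psi>"
  shows "ip (vec \<xi> \<rho> c l) (vec \<xi> \<rho> d m) = \<psi> (st d *. c) + cnj m * \<psi> c + l * cnj (\<psi> d) + l * cnj m"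
proof -
  have t: "\<psi> b = ip (\<rho> b \<xi>) \<xi>" for b using \<psi> by (simp add: theta_def fun_eq_iff)
  have 1: "ip (\<rho> c \<xi>) (\<rho> d \<xi>) = \<psi> (st d *. c)" by (simp add: t rep_axioms[OF r])
  have 2: "ip \<xi> (\<rho> d \<xi>) = cnj (\<psi> d)" unfolding t by (rule ip_cnj) auto
  have "ip \<xi> \<xi> = 1" using \<xi> by (simp add: ip_self)
  then show ?thesis by (simp add: vec_def 1 2 t[symmetric] algebra_simps)
qed

lemma vec_op:
  assumes r: "is_rep A H \<rho>"
  shows "\<rho> a (vec \<xi> \<rho> c l) = vec \<xi> \<rho> (a *. c +. l \<cdot> a) 0"
  by (rule ext) (simp add: vec_def rep_axioms(1-5)[OF r])

lemma vec_subspace: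
  assumes r: "is_rep A H \<rho>" shows "subspace {v. \<exists>c l. v = vec \<xi> \<rho> c l}" (is "subspace ?M")
proof -
  have "vzero H = vec \<xi> \<rho> (0 \<cdot> vzero A) 0"
    by (rule ext) (simp only: vec_def rep_axioms(4)[OF r], simp)
  moreover have "vadd H (vec \<xi> \<rho> c l) (vec \<xi> \<rho> d m) = vec \<xi> \<rho> (c +. d) (l + m)" for c l d m
    by (rule ext) (simp add: vec_def rep_axioms[OF r] algebra_simps)
  moreover have "vscale H b (vec \<xi> \<rho> c l) = vec \<xi> \<rho> (b \<cdot> c) (b * l)" for b c l
    by (rule ext) (simp add: vec_def rep_axioms[OF r] algebra_simps)
  ultimately show ?thesis unfolding subspace_def by blast
qed

lemma vec_xi: assumes r: "is_rep A H \<rho>" shows "vec \<xi> \<rho> (vzero A) 1 = \<xi>"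
proof -
  have "vec \<xi> \<rho> (0 \<cdot> vzero A) 1 = \<xi>"
    by (rule ext) (simp only: vec_def rep_axioms(4)[OF r], simp)
  then show ?thesis by simp
qed

definition qnhds :: "('a \<Rightarrow> complex) \<Rightarrow> ('a \<Rightarrow> complex) filter" where
  "qnhds \<phi> = inf (nhds \<phi>) (principal (quasi_states A))"

lemma tendsto_qnhds: "((\<lambda>\<psi>. \<psi> c) \<longlongrightarrow> \<phi> c) (qnhds \<phi>)"
proof -
  have "((\<lambda>\<psi>. \<psi> c) \<longlongrightarrow> \<phi> c) (nhds \<phi>)"
    unfolding tendsto_def
  proof (intro allI impI)
    fix S :: "complex set" assume S: "open S" "\<phi> c \<in> S"
    have "open ((\<lambda>\<psi> :: 'a \<Rightarrow> complex. \<psi> c) -` S)" by (rule open_vimage[OF S(1) continuous_on_product_coordinates])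
    then show "eventually (\<lambda>\<psi>. \<psi> c \<in> S) (nhds \<phi>)"
      unfolding eventually_nhds using S(2) by (intro exI[of _ "(\<lambda>\<psi>. \<psi> c) -` S"]) auto
  qed
  then show ?thesis unfolding qnhds_def by (rule tendsto_mono[rotated]) simp
qed

lemma eventually_qnhds: "eventually (\<lambda>\<psi>. \<psi> \<in> quasi_states A) (qnhds \<phi>)"
  by (simp add: qnhds_def eventually_inf_principal)

text \<open>\<open>\<sigma> \<psi>\<close> is conjugated by unitaries fixing \<open>\<xi>\<close> that move finitely many vectors
  \<open>\<sigma> \<psi> c \<xi> + l \<xi>\<close> and null vectors of \<open>\<sigma> \<psi>\<close> close to the corresponding vectors for \<open>\<sigma> \<phi>\<close>.\<close>

lemma nearby_lift:
  fixes \<sigma> :: "('a \<Rightarrow> complex) \<Rightarrow> 'a \<Rightarrow> 'h \<Rightarrow> 'h"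
  assumes \<xi>: "nrm \<xi> = 1" and \<phi>: "\<phi> \<in> quasi_states A"
    and rep: "\<And>\<psi>. \<psi> \<in> quasi_states A \<Longrightarrow> is_rep A H (\<sigma> \<psi>)"
    and th: "\<And>\<psi>. \<psi> \<in> quasi_states A \<Longrightarrow> theta H \<xi> (\<sigma> \<psi>) = \<psi>"
    and kill: "\<And>x a. (\<And>a. ip x (\<sigma> \<phi> a \<xi>) = 0) \<Longrightarrow> \<sigma> \<phi> a x = vzero H"
    and Z: "\<And>\<psi>. \<psi> \<in> quasi_states A \<Longrightarrow>
       ample_null \<xi> (\<sigma> \<psi>)"
    and I: "finite I" and e0: "\<epsilon> > 0"
  shows "eventually (\<lambda>\<psi>. \<exists>\<rho>. is_rep A H \<rho> \<and> theta H \<xi> \<rho> = \<psi> \<and>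
     (\<forall>(a, x, y)\<in>I. cmod (ip (\<rho> a x) y - ip (\<sigma> \<phi> a x) y) < \<epsilon>)) (qnhds \<phi>)"
proof -
  define Q where "Q = quasi_states A"
  note rep = rep[folded Q_def] and th = th[folded Q_def] and Z = Z[folded Q_def] and \<phi> = \<phi>[folded Q_def]
  define \<pi> where "\<pi> = \<sigma> \<phi>"
  have \<pi>: "is_rep A H \<pi>" "theta H \<xi> \<pi> = \<phi>" using rep th \<phi> by (auto simp: \<pi>_def)
  define M where "M = {v. \<exists>c l. v = vec \<xi> \<pi> c l}"
  have M: "subspace M" unfolding M_def by (rule vec_subspace[OF \<pi>(1)])
  have \<xi>M: "\<xi> \<in> M" unfolding M_def mem_Collect_eq by (intro exI) (rule vec_xi[OF \<pi>(1), symmetric])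
  define R where "R = (\<Sum>(a, x, y)\<in>I. N a * (nrm x + nrm y))"
  have R: "N a * (nrm x + nrm y) \<le> R" if "(a, x, y) \<in> I" for a x y
    unfolding R_def using member_le_sum[OF that, of "\<lambda>(a, x, y). N a * (nrm x + nrm y)"] I by auto
  have R0: "R \<ge> 0" unfolding R_def by (intro sum_nonneg) auto
  \<comment> \<open>\<open>R \<tau> < \<epsilon> / 3\<close> bounds the cost of replacing
    \<open>x\<close> and \<open>y\<close> by their projections, once for
    \<open>\<rho> \<psi>\<close> and once for \<open>\<pi>\<close>; the last third is for the
    convergence on \<open>E\<close>.\<close>
  define \<tau> where "\<tau> = \<epsilon> / (3 * (R + 1))"
  have \<tau>: "\<tau> > 0" using e0 R0 by (simp add: \<tau>_def)
  have R\<tau>: "R * \<tau> < \<epsilon> / 3" using e0 R0 by (simp add: \<tau>_def field_simps)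
  obtain E where E: "orthonormal E" "finite E" "\<xi> \<in> E" "E \<subseteq> M \<union> perp M"
    and near: "\<forall>x\<in>(\<lambda>(a, x, y). x) ` I \<union> (\<lambda>(a, x, y). y) ` I. nrm (dif x (proj E x)) < \<tau>"
    using gram_schmidt_approx[OF M \<xi>M \<xi>, of "(\<lambda>(a, x, y). x) ` I \<union> (\<lambda>(a, x, y). y) ` I" \<tau>] I \<tau> by auto
  \<comment> \<open>Each vector of \<open>E\<close> in \<open>M\<close> gets coordinates to be
    evaluated in other representations; \<open>\<xi>\<close> must get \<open>0\<close> and
    \<open>1\<close>, so that its counterpart is \<open>\<xi>\<close> for every
    \<open>\<psi>\<close>.\<close>
  have "\<forall>e. \<exists>c l. (e \<in> M \<longrightarrow> e = vec \<xi> \<pi> c l) \<and> (e = \<xi> \<longrightarrow> c = vzero A \<and> l = 1)"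
  proof
    fix e
    show "\<exists>c l. (e \<in> M \<longrightarrow> e = vec \<xi> \<pi> c l) \<and> (e = \<xi> \<longrightarrow> c = vzero A \<and> l = 1)"
    proof (cases "e = \<xi>")
      case True
      then show ?thesis using vec_xi[OF \<pi>(1), of \<xi>]
        by (intro exI[of _ "vzero A"] exI[of _ 1]) simp
    next
      case False
      then show ?thesis unfolding M_def by simp
    qed
  qed
  then obtain cc ll where "\<forall>e. (e \<in> M \<longrightarrow> e = vec \<xi> \<pi> (cc e) (ll e)) \<and> (e = \<xi> \<longrightarrow> cc e = vzero A \<and> ll e = 1)"
    unfolding choice_iff by (elim exE) rule
  then have cl: "\<And>e. e \<in> M \<Longrightarrow> e = vec \<xi> \<pi> (cc e) (ll e)" and cl\<xi>: "cc \<xi> = vzero A" "ll \<xi> = 1"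
    by blast+
  have "\<forall>\<psi>\<in>Q. \<exists>z. (\<forall>e\<in>E. ip (z e) \<xi> = 0 \<and> (\<forall>a. \<sigma> \<psi> a (z e) = vzero H)) \<and>
     (\<forall>e\<in>E. \<forall>e'\<in>E. ip (z e) (z e') = (if e = e' then 1 else 0))"
  proof
    fix \<psi> assume "\<psi> \<in> Q"
    from Z[OF this, unfolded ample_null_def] obtain Y where Y: "infinite Y" "orthonormal Y"
      and Y0: "\<forall>z\<in>Y. ip z \<xi> = 0 \<and> (\<forall>a. \<sigma> \<psi> a z = vzero H)" by blast
    from finite_ons_choice[OF Y E(2)]
    show "\<exists>z. (\<forall>e\<in>E. ip (z e) \<xi> = 0 \<and> (\<forall>a. \<sigma> \<psi> a (z e) = vzero H)) \<and>
     (\<forall>e\<in>E. \<forall>e'\<in>E. ip (z e) (z e') = (if e = e' then 1 else 0))"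
      using Y0 by blast
  qed
  from bchoice[OF this] obtain z where z: "\<forall>\<psi>\<in>Q. (\<forall>e\<in>E. ip (z \<psi> e) \<xi> = 0 \<and> (\<forall>a. \<sigma> \<psi> a (z \<psi> e) = vzero H)) \<and>
     (\<forall>e\<in>E. \<forall>e'\<in>E. ip (z \<psi> e) (z \<psi> e') = (if e = e' then 1 else 0))" by blast
  \<comment> \<open>Counterpart of \<open>e\<close> for \<open>\<psi>\<close>: same coordinates if
    \<open>e\<close> lies in \<open>M\<close>, otherwise a null vector. Outside \<open>Q\<close> the
    value \<open>e\<close> is a default that keeps \<open>f \<psi> \<xi> = \<xi>\<close> for all
    \<open>\<psi>\<close>.\<close>
  define f where "f \<psi> e = (if \<psi> \<in> Q then if e \<in> M then vec \<xi> (\<sigma> \<psi>) (cc e) (ll e) else z \<psi> e else e)" for \<psi> e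
  have f\<xi>: "f \<psi> \<xi> = \<xi>" for \<psi>
    using \<xi>M vec_xi[OF rep] by (simp add: f_def cl\<xi>)
  have evQ: "eventually (\<lambda>\<psi>. \<psi> \<in> Q) (qnhds \<phi>)" unfolding Q_def by (rule eventually_qnhds)
  have ip_eE: "ip e e' = (if e = e' then 1 else 0)" if "e \<in> E" "e' \<in> E" for e e' using orthonormal_ip[OF E(1) that] .
  have perpE: "e \<in> perp M" if "e \<in> E" "e \<notin> M" for e using E(4) that by blast
  have \<pi>M: "\<pi> a \<xi> \<in> M" for a
  proof -
    have "\<pi> a \<xi> = vec \<xi> \<pi> a 0" by (rule ext) (simp add: vec_def)
    then show ?thesis unfolding M_def by blast
  qed
  \<comment> \<open>Here tightness of the lift enters: vectors orthogonal to \<open>M\<close> are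
    null vectors of \<open>\<pi>\<close>, like the \<open>z \<psi> e\<close> that replace
    them.\<close>
  have \<pi>0: "\<pi> a e = vzero H" if "e \<in> perp M" for a e
  proof -
    have "ip e (\<sigma> \<phi> b \<xi>) = 0" for b using that \<pi>M[of b] by (simp add: perp_def \<pi>_def)
    then show ?thesis unfolding \<pi>_def by (rule kill)
  qed
  have \<pi>vec: "\<pi> a e \<in> M" if "e \<in> M" for a e
    using vec_op[OF \<pi>(1)] that unfolding M_def by blast
  have z_vec: "ip (z \<psi> e) (vec \<xi> (\<sigma> \<psi>) c l) = 0" "ip (vec \<xi> (\<sigma> \<psi>) c l) (z \<psi> e) = 0" if "\<psi> \<in> Q" "e \<in> E" for \<psi> e c l
  proof -
    have z1: "ip (z \<psi> e) \<xi> = 0" "\<sigma> \<psi> (st c) (z \<psi> e) = vzero H" using z that by blast+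
    have "ip (z \<psi> e) (\<sigma> \<psi> c \<xi>) = ip (\<sigma> \<psi> (st c) (z \<psi> e)) \<xi>"
      by (simp only: rep_axioms(6)[OF rep[OF that(1)]])
    then show 1: "ip (z \<psi> e) (vec \<xi> (\<sigma> \<psi>) c l) = 0" using z1 by (simp add: vec_def)
    show "ip (vec \<xi> (\<sigma> \<psi>) c l) (z \<psi> e) = 0" by (rule ip_swap_0[OF _ _ 1]) auto
  qed
  have gram_lim: "((\<lambda>\<psi>. ip (vec \<xi> (\<sigma> \<psi>) c l) (vec \<xi> (\<sigma> \<psi>) d m)) \<longlongrightarrow> ip (vec \<xi> \<pi> c l) (vec \<xi> \<pi> d m)) (qnhds \<phi>)"
    for c l d m
  proof -
    have "((\<lambda>\<psi>. \<psi> (st d *. c) + cnj m * \<psi> c + l * cnj (\<psi> d) + l * cnj m) \<longlongrightarrow>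
      \<phi> (st d *. c) + cnj m * \<phi> c + l * cnj (\<phi> d) + l * cnj m) (qnhds \<phi>)"
      by (intro tendsto_intros tendsto_qnhds)
    moreover have "eventually (\<lambda>\<psi>. ip (vec \<xi> (\<sigma> \<psi>) c l) (vec \<xi> (\<sigma> \<psi>) d m)
        = \<psi> (st d *. c) + cnj m * \<psi> c + l * cnj (\<psi> d) + l * cnj m) (qnhds \<phi>)"
      using evQ by eventually_elim (rule vec_gram[OF rep \<xi> th])
    ultimately show ?thesis unfolding vec_gram[OF \<pi>(1) \<xi> \<pi>(2)] by (simp add: tendsto_cong)
  qed
  have gram: "((\<lambda>\<psi>. ip (f \<psi> e) (f \<psi> e')) \<longlongrightarrow> (if e = e' then 1 else 0)) (qnhds \<phi>)"
    if e: "e \<in> E" "e' \<in> E" for e e'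
  proof (cases "e \<in> M \<and> e' \<in> M")
    case True
    have "((\<lambda>\<psi>. ip (vec \<xi> (\<sigma> \<psi>) (cc e) (ll e)) (vec \<xi> (\<sigma> \<psi>) (cc e') (ll e'))) \<longlongrightarrow> ip e e') (qnhds \<phi>)"
      using gram_lim[of "cc e" "ll e" "cc e'" "ll e'"] cl[of e] cl[of e'] True by simp
    moreover have "eventually (\<lambda>\<psi>. ip (f \<psi> e) (f \<psi> e')
      = ip (vec \<xi> (\<sigma> \<psi>) (cc e) (ll e)) (vec \<xi> (\<sigma> \<psi>) (cc e') (ll e'))) (qnhds \<phi>)"
      using evQ by eventually_elim (simp add: f_def True)
    ultimately show ?thesis unfolding ip_eE[OF e] by (simp only: tendsto_cong)
  next
    case False
    have "eventually (\<lambda>\<psi>. ip (f \<psi> e) (f \<psi> e') = (if e = e' then 1 else 0)) (qnhds \<phi>)"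
      using evQ
    proof eventually_elim
      case (elim \<psi>)
      have "ip (z \<psi> e) (z \<psi> e') = (if e = e' then 1 else 0)" using z elim e by blast
      then show ?case using False elim z_vec[OF elim] e by (auto simp: f_def)
    qed
    then show ?thesis by (simp add: tendsto_eventually)
  qed
  have insE: "insert \<xi> (E - {\<xi>}) = E" using E(3) by blast
  have "\<exists>U U'. (\<forall>\<psi>. unitary (U \<psi>) (U' \<psi>) \<and> U \<psi> \<xi> = \<xi>) \<and>
    (\<forall>e\<in>insert \<xi> (E - {\<xi>}). ((\<lambda>\<psi>. nrm (dif (U \<psi> (f \<psi> e)) e)) \<longlongrightarrow> 0) (qnhds \<phi>))"
  proof (rule gram_unitary[where f = f and \<xi> = \<xi>])
    show "((\<lambda>\<psi>. ip (f \<psi> e) (f \<psi> e')) \<longlongrightarrow> (if e = e' then 1 else 0)) (qnhds \<phi>)"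
      if "e \<in> insert \<xi> (E - {\<xi>})" "e' \<in> insert \<xi> (E - {\<xi>})" for e e'
      using that unfolding insE by (rule gram)
  qed (use E in \<open>simp_all only: insE \<xi> f\<xi>, auto\<close>)
  then obtain U U' where UU: "\<forall>\<psi>. unitary (U \<psi>) (U' \<psi>) \<and> U \<psi> \<xi> = \<xi>"
    and limU: "\<forall>e\<in>E. ((\<lambda>\<psi>. nrm (dif (U \<psi> (f \<psi> e)) e)) \<longlongrightarrow> 0) (qnhds \<phi>)"
    unfolding insE by (elim exE conjE) rule
  have U: "unitary (U \<psi>) (U' \<psi>)" "U \<psi> \<xi> = \<xi>" for \<psi> using UU by auto
  have U'\<xi>: "U' \<psi> \<xi> = \<xi>" for \<psi> using U(2) unitaryD(2)[OF U(1)] by metis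
  define \<rho> where "\<rho> \<psi> a x = U \<psi> (\<sigma> \<psi> a (U' \<psi> x))" for \<psi> a x
  have \<rho>: "is_rep A H (\<rho> \<psi>)" "theta H \<xi> (\<rho> \<psi>) = \<psi>" if "\<psi> \<in> Q" for \<psi>
  proof -
    show "is_rep A H (\<rho> \<psi>)" unfolding \<rho>_def[abs_def] by (rule rep_conj[OF rep[OF that] U(1)])
    have "theta H \<xi> (\<rho> \<psi>) = theta H \<xi> (\<sigma> \<psi>)"
      by (simp add: theta_def \<rho>_def unitaryD(3)[OF U(1)] U'\<xi>)
    then show "theta H \<xi> (\<rho> \<psi>) = \<psi>" using th[OF that] by simp
  qed
  \<comment> \<open>On \<open>M\<close> an operator only changes the coordinates
    (\<open>vec_op\<close>), so this is again a Gram limit. As soon as one vector lies outside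
    \<open>M\<close>, the limit and the coefficients for \<open>\<psi>\<close> in \<open>Q\<close>
    are all zero.\<close>
  have op_f: "((\<lambda>\<psi>. ip (\<sigma> \<psi> a (f \<psi> e)) (f \<psi> e')) \<longlongrightarrow> ip (\<pi> a e) e') (qnhds \<phi>)" if e: "e \<in> E" "e' \<in> E" for a e e'
  proof (cases "e \<in> M \<and> e' \<in> M")
    case True
    have "((\<lambda>\<psi>. ip (vec \<xi> (\<sigma> \<psi>) (a *. cc e +. ll e \<cdot> a) 0) (vec \<xi> (\<sigma> \<psi>) (cc e') (ll e'))) \<longlongrightarrow> ip (\<pi> a e) e') (qnhds \<phi>)"
      using gram_lim[of "a *. cc e +. ll e \<cdot> a" 0 "cc e'" "ll e'"] cl[of e] cl[of e'] True
        vec_op[OF \<pi>(1), of a \<xi> "cc e" "ll e"] by simp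
    moreover have "eventually (\<lambda>\<psi>. ip (\<sigma> \<psi> a (f \<psi> e)) (f \<psi> e')
      = ip (vec \<xi> (\<sigma> \<psi>) (a *. cc e +. ll e \<cdot> a) 0) (vec \<xi> (\<sigma> \<psi>) (cc e') (ll e'))) (qnhds \<phi>)"
      using evQ by eventually_elim (simp add: f_def True vec_op[OF rep])
    ultimately show ?thesis by (simp only: tendsto_cong)
  next
    case False
    have 0: "ip (\<pi> a e) e' = 0"
    proof (cases "e \<in> M")
      case True
      then have "e' \<in> perp M" using False perpE e by blast
      then show ?thesis using perp_swap \<pi>vec[OF True] by blast
    next
      case False
      then show ?thesis using \<pi>0[OF perpE[OF e(1)]] by simp
    qed
    have "eventually (\<lambda>\<psi>. ip (\<sigma> \<psi> a (f \<psi> e)) (f \<psi> e') = 0) (qnhds \<phi>)"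
      using evQ
    proof eventually_elim
      case (elim \<psi>)
      have z0: "\<sigma> \<psi> a (z \<psi> e) = vzero H" using z elim e by blast
      show ?case using False elim z_vec(2)[OF elim e(2)] z0
        by (auto simp: f_def vec_op[OF rep[OF elim]])
    qed
    then show ?thesis unfolding 0 by (simp add: tendsto_eventually)
  qed
  \<comment> \<open>The coefficient of \<open>\<rho> \<psi>\<close> at \<open>e\<close>,
    \<open>e'\<close> is that of \<open>\<sigma> \<psi>\<close> at their images under
    \<open>U' \<psi>\<close>, which are close to the \<open>f\<close> vectors; contractivity makes
    the error uniform in the representation.\<close>
  have op_\<rho>: "((\<lambda>\<psi>. ip (\<rho> \<psi> a e) e') \<longlongrightarrow> ip (\<pi> a e) e') (qnhds \<phi>)" if e: "e \<in> E" "e' \<in> E" for a e e'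
  proof -
    define \<delta> where "\<delta> i \<psi> = nrm (dif (U \<psi> (f \<psi> i)) i)" for i \<psi>
    have \<delta>: "(\<delta> i \<longlongrightarrow> 0) (qnhds \<phi>)" if "i \<in> E" for i using limU that unfolding \<delta>_def by blast
    have d: "nrm (dif (U' \<psi> i) (f \<psi> i)) = \<delta> i \<psi>" for i \<psi>
    proof -
      have "dif (U' \<psi> i) (f \<psi> i) = U' \<psi> (dif i (U \<psi> (f \<psi> i)))"
        by (simp add: unitary_linear(3)[OF unitary_sym[OF U(1)]] unitaryD(2)[OF U(1)])
      then show ?thesis unfolding \<delta>_def by (simp add: unitaryD(8)[OF U(1)] nrm_dif_commute)
    qed
    have ne: "nrm i = 1" if "i \<in> E" for i using ip_eE[OF that that] by (simp add: nrm_def)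
    have fn: "nrm (f \<psi> i) \<le> 1 + \<delta> i \<psi>" if "i \<in> E" for i \<psi>
      using nrm_rev_triangle[of "U \<psi> (f \<psi> i)" i] ne[OF that] by (simp add: \<delta>_def unitaryD(7)[OF U(1)])
    have bnd: "eventually (\<lambda>\<psi>. norm (ip (\<rho> \<psi> a e) e' - ip (\<sigma> \<psi> a (f \<psi> e)) (f \<psi> e'))
        \<le> N a * \<delta> e \<psi> + N a * (1 + \<delta> e \<psi>) * \<delta> e' \<psi>) (qnhds \<phi>)"
      using evQ
    proof eventually_elim
      case (elim \<psi>)
      have "ip (\<rho> \<psi> a e) e' = ip (\<sigma> \<psi> a (U' \<psi> e)) (U' \<psi> e')"
        by (simp add: \<rho>_def unitaryD(3)[OF U(1)])
      then have "cmod (ip (\<rho> \<psi> a e) e' - ip (\<sigma> \<psi> a (f \<psi> e)) (f \<psi> e'))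
        \<le> N a * \<delta> e \<psi> * nrm (U' \<psi> e') + N a * nrm (f \<psi> e) * \<delta> e' \<psi>"
        using rep_ip_diff[OF rep[OF elim], of a "U' \<psi> e" "U' \<psi> e'" "f \<psi> e" "f \<psi> e'"] unfolding d by simp
      also have "\<dots> \<le> N a * \<delta> e \<psi> * 1 + N a * (1 + \<delta> e \<psi>) * \<delta> e' \<psi>"
        using fn[OF e(1), of \<psi>] ne[OF e(2)]
        by (intro add_mono mult_mono) (auto simp: unitaryD(8)[OF U(1)] \<delta>_def)
      finally show ?case by simp
    qed
    have "((\<lambda>\<psi>. N a * \<delta> e \<psi> + N a * (1 + \<delta> e \<psi>) * \<delta> e' \<psi>) \<longlongrightarrow> N a * 0 + N a * (1 + 0) * 0) (qnhds \<phi>)"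
      by (intro tendsto_intros \<delta> e)
    then have "((\<lambda>\<psi>. N a * \<delta> e \<psi> + N a * (1 + \<delta> e \<psi>) * \<delta> e' \<psi>) \<longlongrightarrow> 0) (qnhds \<phi>)" by simp
    from tendsto_add[OF Lim_null_comparison[OF bnd this] op_f[OF e, of a]] show ?thesis by simp
  qed
  have single: "eventually (\<lambda>\<psi>. cmod (ip (\<rho> \<psi> a x) y - ip (\<pi> a x) y) < \<epsilon>) (qnhds \<phi>)" if i: "(a, x, y) \<in> I" for a x y
  proof -
    let ?x = "proj E x" and ?y = "proj E y"
    have nx: "nrm (dif x ?x) < \<tau>" "nrm (dif y ?y) < \<tau>" using near i by force+
    have err: "cmod (ip (\<omega> a x) y - ip (\<omega> a ?x) ?y) < \<epsilon> / 3" if "is_rep A H \<omega>" for \<omega>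
    proof -
      have "cmod (ip (\<omega> a x) y - ip (\<omega> a ?x) ?y) \<le> N a * nrm (dif x ?x) * nrm y + N a * nrm ?x * nrm (dif y ?y)"
        by (rule rep_ip_diff[OF that])
      also have "\<dots> \<le> N a * \<tau> * nrm y + N a * nrm x * \<tau>"
        using nx proj_le[OF E(1,2), of x] \<tau> by (intro add_mono mult_mono mult_nonneg_nonneg) auto
      also have "\<dots> = N a * (nrm x + nrm y) * \<tau>" by (simp add: algebra_simps)
      also have "\<dots> \<le> R * \<tau>" using R[OF i] \<tau> by (intro mult_right_mono) auto
      finally show ?thesis using R\<tau> by linarith
    qed
    have "((\<lambda>\<psi>. \<Sum>e'\<in>E. cnj (ip y e') * (\<Sum>e\<in>E. ip x e * ip (\<rho> \<psi> a e) e')) \<longlongrightarrow>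
       (\<Sum>e'\<in>E. cnj (ip y e') * (\<Sum>e\<in>E. ip x e * ip (\<pi> a e) e'))) (qnhds \<phi>)"
      by (intro tendsto_intros op_\<rho>)
    then have "eventually (\<lambda>\<psi>. dist (\<Sum>e'\<in>E. cnj (ip y e') * (\<Sum>e\<in>E. ip x e * ip (\<rho> \<psi> a e) e'))
       (\<Sum>e'\<in>E. cnj (ip y e') * (\<Sum>e\<in>E. ip x e * ip (\<pi> a e) e')) < \<epsilon> / 3) (qnhds \<phi>)"
      using e0 by (intro tendstoD) auto
    with evQ show ?thesis
    proof eventually_elim
      case (elim \<psi>)
      have "cmod (ip (\<rho> \<psi> a ?x) ?y - ip (\<pi> a ?x) ?y) < \<epsilon> / 3"
        using elim(2) unfolding rep_pr_expand[OF \<rho>(1)[OF elim(1)] E(2)] rep_pr_expand[OF \<pi>(1) E(2)] dist_norm .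
      with err[OF \<rho>(1)[OF elim(1)]] show ?case
        using err[OF \<pi>(1)] by (rule cmod_diff_third)
    qed
  qed
  have "eventually (\<lambda>\<psi>. \<forall>i\<in>I. case i of (a, x, y) \<Rightarrow> cmod (ip (\<rho> \<psi> a x) y - ip (\<pi> a x) y) < \<epsilon>) (qnhds \<phi>)"
    using I single by (intro eventually_ball_finite) auto
  with evQ show ?thesis
  proof eventually_elim
    case (elim \<psi>)
    then show ?case using \<rho>[OF elim(1)] unfolding \<pi>_def by blast
  qed
qed

end

section \<open>The quotient map\<close>

context cstar_hilb begin

text \<open>Places \<open>rep A H\<close> in a product of copies of \<open>\<complex>\<close>, whose
  topology pulls back to \<open>rep_topology\<close>; the compactness argument takes place in this
  product.\<close>

definition matrix_coeff :: "('a \<Rightarrow> 'h \<Rightarrow> 'h) \<Rightarrow> 'a \<times> 'h \<times> 'h \<Rightarrow> complex" where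
  "matrix_coeff \<pi> = (\<lambda>(a, x, y). ip (\<pi> a x) y)"

lemma openin_rep_topology: "openin (rep_topology A H) S \<longleftrightarrow> (\<exists>V. open V \<and> S = matrix_coeff -` V \<inter> rep A H)"
  unfolding rep_topology_def openin_pullback_topology open_fun_def matrix_coeff_def[abs_def] ..

lemma openin_qs_topology: "openin (qs_topology A) D \<longleftrightarrow> (\<exists>V. open V \<and> D = V \<inter> quasi_states A)"
  unfolding qs_topology_def openin_subtopology open_fun_def ..

lemma topspace_rep: "topspace (rep_topology A H) = rep A H"
  by (simp add: rep_topology_def topspace_pullback_topology)

lemma topspace_qs: "topspace (qs_topology A) = quasi_states A"
  by (simp add: qs_topology_def)

lemma continuous_diag: "continuous_on UNIV (\<lambda>F a. (F :: 'a \<times> 'h \<times> 'h \<Rightarrow> complex) (a, \<xi>, \<xi>))"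
  by (intro continuous_on_coordinatewise_then_product continuous_on_product_coordinates)

lemma theta_matrix_coeff: "theta H \<xi> \<pi> = (\<lambda>a. matrix_coeff \<pi> (a, \<xi>, \<xi>))"
  by (simp add: theta_def matrix_coeff_def)

lemma theta_preimage_open:
  assumes "openin (qs_topology A) U" and "nrm \<xi> = 1"
  shows "openin (rep_topology A H) {\<pi> \<in> rep A H. theta H \<xi> \<pi> \<in> U}"
proof -
  obtain V where V: "open V" "U = V \<inter> quasi_states A" using assms(1) openin_qs_topology by blast
  have "open ((\<lambda>F a. F (a, \<xi>, \<xi>)) -` V :: ('a \<times> 'h \<times> 'h \<Rightarrow> complex) set)"
    by (rule open_vimage[OF V(1) continuous_diag])
  moreover have "{\<pi> \<in> rep A H. theta H \<xi> \<pi> \<in> U} = matrix_coeff -` ((\<lambda>F a. F (a, \<xi>, \<xi>)) -` V) \<inter> rep A H"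
    using theta_quasi_state[OF _ assms(2)] V(2) theta_matrix_coeff unfolding rep_def by auto
  ultimately show ?thesis using openin_rep_topology by blast
qed

text \<open>Openness at one good point per fibre suffices: for \<open>\<phi>\<close> in
  \<open>U\<close> the lift \<open>\<sigma> \<phi>\<close> lies in the open preimage, which by
  \<open>nearby_lift\<close> contains lifts of all nearby \<open>\<psi>\<close>; these
  \<open>\<psi>\<close> therefore lie in \<open>U\<close>.\<close>

lemma theta_image_open_infinite:
  assumes \<xi>: "nrm \<xi> = 1" and U: "U \<subseteq> quasi_states A"
    and op: "openin (rep_topology A H) {\<pi> \<in> rep A H. theta H \<xi> \<pi> \<in> U}"
    and lift: "\<forall>\<psi>\<in>quasi_states A. \<exists>\<sigma>. tight_lift \<xi> \<psi> \<sigma> \<and>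
      ample_null \<xi> \<sigma>"
  shows "openin (qs_topology A) U"
proof -
  from bchoice[OF lift] obtain \<sigma>
    where \<sigma>: "\<forall>\<psi>\<in>quasi_states A. tight_lift \<xi> \<psi> (\<sigma> \<psi>) \<and> ample_null \<xi> (\<sigma> \<psi>)" by (elim exE) rule
  have \<sigma>1: "is_rep A H (\<sigma> \<psi>)" "theta H \<xi> (\<sigma> \<psi>) = \<psi>"
    "\<forall>x. (\<forall>a. ip x (\<sigma> \<psi> a \<xi>) = 0) \<longrightarrow> (\<forall>a. \<sigma> \<psi> a x = vzero H)" "ample_null \<xi> (\<sigma> \<psi>)"
    if "\<psi> \<in> quasi_states A" for \<psi>
    by (insert bspec[OF \<sigma> that], unfold tight_lift_def, (elim conjE, assumption)+)
  obtain V where V: "open V" "{\<pi> \<in> rep A H. theta H \<xi> \<pi> \<in> U} = matrix_coeff -` V \<inter> rep A H"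
    using op openin_rep_topology by blast
  have in_V: "matrix_coeff \<pi> \<in> V \<longleftrightarrow> theta H \<xi> \<pi> \<in> U" if "is_rep A H \<pi>" for \<pi>
    using V(2) that unfolding rep_def by blast
  have "\<exists>S. open S \<and> \<phi> \<in> S \<and> S \<inter> quasi_states A \<subseteq> U" if \<phi>: "\<phi> \<in> U" for \<phi>
  proof -
    have \<phi>Q: "\<phi> \<in> quasi_states A" using \<phi> U by blast
    then have "matrix_coeff (\<sigma> \<phi>) \<in> V" using in_V[OF \<sigma>1(1)[OF \<phi>Q]] \<sigma>1(2)[OF \<phi>Q] \<phi> by simp
    from open_fun_finite_coordinates[OF V(1) this] obtain I e where I: "finite I" "e > 0"
      and near: "\<And>G. \<forall>i\<in>I. cmod (G i - matrix_coeff (\<sigma> \<phi>) i) < e \<Longrightarrow> G \<in> V" by blast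
    have "eventually (\<lambda>\<psi>. \<exists>\<rho>. is_rep A H \<rho> \<and> theta H \<xi> \<rho> = \<psi> \<and>
     (\<forall>(a, x, y)\<in>I. cmod (ip (\<rho> a x) y - ip (\<sigma> \<phi> a x) y) < e)) (qnhds \<phi>)"
      by (rule nearby_lift[OF \<xi> \<phi>Q \<sigma>1(1) \<sigma>1(2) _ \<sigma>1(4) I]) (use \<sigma>1(3)[OF \<phi>Q] in simp_all)
    then have "eventually (\<lambda>\<psi>. \<psi> \<in> U) (qnhds \<phi>)"
    proof eventually_elim
      case (elim \<psi>)
      then obtain \<rho> where \<rho>: "is_rep A H \<rho>" "theta H \<xi> \<rho> = \<psi>"
        and c: "\<forall>(a, x, y)\<in>I. cmod (ip (\<rho> a x) y - ip (\<sigma> \<phi> a x) y) < e" by blast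
      have "matrix_coeff \<rho> \<in> V" by (rule near) (use c in \<open>auto simp: matrix_coeff_def\<close>)
      then show ?case using in_V[OF \<rho>(1)] \<rho>(2) by simp
    qed
    then show ?thesis unfolding qnhds_def eventually_inf_principal eventually_nhds by blast
  qed
  then obtain S where S: "\<And>\<phi>. \<phi> \<in> U \<Longrightarrow> open (S \<phi>) \<and> \<phi> \<in> S \<phi> \<and> S \<phi> \<inter> quasi_states A \<subseteq> U" by metis
  have "open (\<Union>\<phi>\<in>U. S \<phi>)" using S by blast
  moreover have "U = (\<Union>\<phi>\<in>U. S \<phi>) \<inter> quasi_states A" using S U by blast
  ultimately show ?thesis using openin_qs_topology by blast
qed

text \<open>For finite-dimensional \<open>H\<close>, the functions \<open>(a, x, y) \<mapsto> \<langle>\<pi>(a) x, y\<rangle>\<close> form a closed subset of a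
  product of discs, since multiplicativity becomes a finite sum over an orthonormal basis.\<close>

lemma compact_matrix_coeff_rep:
  assumes B: "orthonormal_basis H B" "finite B"
  shows "compact (matrix_coeff ` rep A H)"
proof -
  define box where "box = Pi\<^sub>E UNIV (\<lambda>(a, x, y). cball 0 (N a * nrm x * nrm y) :: complex set)"
  \<comment> \<open>The last clause is \<open>\<langle>\<pi>(a b) x, y\<rangle> = \<langle>\<pi>(b)
    x, \<pi>(st a) y\<rangle>\<close> expanded over \<open>B\<close>; as a finite sum of products of
    coordinates it is a closed condition.\<close>
  define C where "C = {F :: 'a \<times> 'h \<times> 'h \<Rightarrow> complex.
    (\<forall>a x x' y. F (a, vadd H x x', y) = F (a, x, y) + F (a, x', y)) \<and>
    (\<forall>a c x y. F (a, vscale H c x, y) = c * F (a, x, y)) \<and>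
    (\<forall>a b x y. F (a +. b, x, y) = F (a, x, y) + F (b, x, y)) \<and>
    (\<forall>c a x y. F (c \<cdot> a, x, y) = c * F (a, x, y)) \<and>
    (\<forall>a x y. F (st a, x, y) = cnj (F (a, y, x))) \<and>
    (\<forall>a b x y. F (a *. b, x, y) = (\<Sum>e\<in>B. F (b, x, e) * cnj (F (st a, y, e))))}"
  have parseval: "ip x y = (\<Sum>e\<in>B. ip x e * ip e y)" for x y
    using parseval[OF B(1), of x y] B(2) by simp
  have "compactin (product_topology (\<lambda>_. euclidean) UNIV) box"
    unfolding box_def compactin_PiE by (auto simp: compactin_euclidean_iff)
  then have "compact box" by (simp add: euclidean_product_topology compactin_euclidean_iff)
  moreover have "closed C"
    unfolding C_def
    by (intro closed_Collect_conj closed_Collect_all closed_Collect_eq continuous_intros continuous_on_product_coordinates)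
  ultimately have cpt: "compact (box \<inter> C)" by (rule compact_Int_closed)
  have "matrix_coeff \<pi> \<in> box \<inter> C" if r: "is_rep A H \<pi>" for \<pi>
  proof -
    have "matrix_coeff \<pi> \<in> box" using rep_ip_bound[OF r] by (auto simp: box_def matrix_coeff_def)
    moreover have "ip (\<pi> (st a) x) y = cnj (ip (\<pi> a y) x)" for a x y
      unfolding rep_axioms(6)[OF r] by (rule ip_cnj) auto
    moreover have "ip (\<pi> (a *. b) x) y = (\<Sum>e\<in>B. ip (\<pi> b x) e * cnj (ip (\<pi> (st a) y) e))" for a b x y
    proof -
      have "ip (\<pi> (a *. b) x) y = ip (\<pi> b x) (\<pi> (st a) y)"
        using rep_axioms(6)[OF r, of "st a" "\<pi> b x" y] rep_axioms(5)[OF r] by simp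
      also have "\<dots> = (\<Sum>e\<in>B. ip (\<pi> b x) e * ip e (\<pi> (st a) y))" by (rule parseval)
      finally show ?thesis using ip_cnj[of "\<pi> (st a) y"] by simp
    qed
    ultimately show ?thesis by (simp add: C_def matrix_coeff_def rep_axioms(1-4)[OF r])
  qed
  moreover have "\<exists>\<pi>. is_rep A H \<pi> \<and> F = matrix_coeff \<pi>" if F: "F \<in> box \<inter> C" for F
  proof -
    have bnd: "cmod (F (a, x, y)) \<le> N a * nrm x * nrm y" for a x y
    proof -
      have "F (a, x, y) \<in> cball 0 (N a * nrm x * nrm y)" using F unfolding box_def by fastforce
      then show ?thesis by simp
    qed
    note FC = F[unfolded C_def Int_iff mem_Collect_eq]
    have F1: "F (a, vadd H x x', y) = F (a, x, y) + F (a, x', y)" for a x x' y using FC by (elim conjE) blast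
    have F2: "F (a, vscale H c x, y) = c * F (a, x, y)" for a c x y using FC by (elim conjE) blast
    have F3: "F (a +. b, x, y) = F (a, x, y) + F (b, x, y)" for a b x y using FC by (elim conjE) blast
    have F4: "F (c \<cdot> a, x, y) = c * F (a, x, y)" for a c x y using FC by (elim conjE) blast
    have F5: "F (st a, x, y) = cnj (F (a, y, x))" for a x y using FC by (elim conjE) blast
    have F6: "F (a *. b, x, y) = (\<Sum>e\<in>B. F (b, x, e) * cnj (F (st a, y, e)))" for a b x y
      using FC by (elim conjE) simp
    \<comment> \<open>Riesz recovers \<open>\<pi>(a) x\<close> from \<open>F\<close>; the adjoint
      \<open>st a\<close> appears because \<open>\<pi>(a) x\<close> stands on the right of the inner
      product.\<close>
    have "\<exists>l\<in>vcarrier H. \<forall>v\<in>vcarrier H. ip v l = F (st a, v, x)" for a x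
    proof (rule riesz[where B = "N a * nrm x"])
      show "cmod (F (st a, v, x)) \<le> N a * nrm x * nrm v" for v
        using bnd[of "st a" v x] by (simp add: mult_ac)
    qed (simp_all add: F1 F2)
    then have "\<forall>a x. \<exists>l. \<forall>v. ip v l = F (st a, v, x)" by simp
    then obtain \<pi> where "\<forall>a x v. ip v (\<pi> a x) = F (st a, v, x)" unfolding choice_iff by (elim exE) rule
    then have \<pi>: "ip v (\<pi> a x) = F (st a, v, x)" for a x v by blast
    have \<pi>F: "ip (\<pi> a x) v = F (a, x, v)" for a x v
    proof -
      have "ip (\<pi> a x) v = cnj (ip v (\<pi> a x))" by (rule ip_cnj) auto
      then show ?thesis unfolding \<pi> F5 by simp
    qed
    have "is_rep A H \<pi>"
    proof (rule is_repI)
      fix a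
      have "nrm (\<pi> a x) \<le> N a * nrm x" for x
      proof -
        have "(nrm (\<pi> a x))\<^sup>2 \<le> cmod (ip (\<pi> a x) (\<pi> a x))" using complex_Re_le_cmod by (simp add: nrm_sq)
        also have "\<dots> \<le> N a * nrm x * nrm (\<pi> a x)" unfolding \<pi>F by (rule bnd)
        finally have "nrm (\<pi> a x) * nrm (\<pi> a x) \<le> N a * nrm x * nrm (\<pi> a x)" by (simp add: power2_eq_square)
        moreover have "0 \<le> nrm (\<pi> a x)" "0 \<le> N a * nrm x" by auto
        ultimately show ?thesis by (cases "nrm (\<pi> a x) = 0") auto
      qed
      then show "\<exists>C. \<forall>x. nrm (\<pi> a x) \<le> C * nrm x" by blast
    next
      fix a b x
      show "\<pi> (a *. b) x = \<pi> a (\<pi> b x)"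
      proof (rule ext)
        fix z
        have "ip (\<pi> (a *. b) x) z = (\<Sum>e\<in>B. ip (\<pi> b x) e * cnj (ip (\<pi> (st a) z) e))" by (simp add: \<pi>F F6)
        also have "\<dots> = (\<Sum>e\<in>B. ip (\<pi> b x) e * ip e (\<pi> (st a) z))" using ip_cnj[of "\<pi> (st a) z"] by simp
        also have "\<dots> = ip (\<pi> b x) (\<pi> (st a) z)" by (rule parseval[symmetric])
        also have "\<dots> = ip (\<pi> a (\<pi> b x)) z" unfolding \<pi> \<pi>F by simp
        finally show "ip (\<pi> (a *. b) x) z = ip (\<pi> a (\<pi> b x)) z" .
      qed
    next
      show "\<And>a x y. ip (\<pi> (st a) x) y = ip x (\<pi> a y)" unfolding \<pi> \<pi>F ..
    qed (rule ext, simp add: \<pi>F F1 F2 F3 F4)+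
    moreover have "F = matrix_coeff \<pi>" by (simp add: matrix_coeff_def fun_eq_iff \<pi>F)
    ultimately show ?thesis by blast
  qed
  ultimately have "matrix_coeff ` rep A H = box \<inter> C" unfolding rep_def by blast
  then show ?thesis using cpt by simp
qed

text \<open>The representations outside the open preimage form a compact set in the product, so
  their image \<open>C\<close> is closed. Every quasi-state has a lift, so those missing
  \<open>C\<close> lie in \<open>U\<close>.\<close>

lemma theta_image_open_finite:
  assumes \<xi>: "nrm \<xi> = 1" and U: "U \<subseteq> quasi_states A"
    and op: "openin (rep_topology A H) {\<pi> \<in> rep A H. theta H \<xi> \<pi> \<in> U}"
    and lift: "\<forall>\<psi>\<in>quasi_states A. \<exists>\<sigma>. is_rep A H \<sigma> \<and> theta H \<xi> \<sigma> = \<psi>"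
    and B: "orthonormal_basis H B" "finite B"
  shows "openin (qs_topology A) U"
proof -
  obtain V where V: "open V" "{\<pi> \<in> rep A H. theta H \<xi> \<pi> \<in> U} = matrix_coeff -` V \<inter> rep A H"
    using op openin_rep_topology by blast
  define C where "C = (\<lambda>F a. F (a, \<xi>, \<xi>)) ` (matrix_coeff ` rep A H \<inter> - V)"
  have "compact (matrix_coeff ` rep A H \<inter> - V)"
    using compact_matrix_coeff_rep[OF B] V(1) by (intro compact_Int_closed) (auto simp: closed_def)
  then have "compact C" unfolding C_def
    by (rule compact_continuous_image[OF continuous_on_subset[OF continuous_diag subset_UNIV]])
  then have "compactin (product_topology (\<lambda>_. euclidean) UNIV) C"
    by (simp add: euclidean_product_topology compactin_euclidean_iff)
  moreover have "Hausdorff_space (product_topology (\<lambda>_. euclidean :: complex topology) (UNIV :: 'a set))"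
    by (simp add: Hausdorff_space_product_topology)
  ultimately have "closedin (product_topology (\<lambda>_. euclidean) UNIV) C" by (intro compactin_imp_closedin)
  then have "closed C" by (simp add: euclidean_product_topology)
  then have "open (- C)" by (rule open_Compl)
  moreover have "U = - C \<inter> quasi_states A"
  proof (intro equalityI subsetI)
    fix \<psi> assume \<psi>: "\<psi> \<in> U"
    have "\<psi> \<notin> C"
    proof
      assume "\<psi> \<in> C"
      then obtain \<pi> where "\<pi> \<in> rep A H" "matrix_coeff \<pi> \<notin> V" "\<psi> = theta H \<xi> \<pi>" unfolding C_def theta_matrix_coeff by blast
      then show False using V(2) \<psi> by blast
    qed
    then show "\<psi> \<in> - C \<inter> quasi_states A" using \<psi> U by blast
  next
    fix \<psi> assume \<psi>: "\<psi> \<in> - C \<inter> quasi_states A"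
    then obtain \<sigma> where \<sigma>: "is_rep A H \<sigma>" "theta H \<xi> \<sigma> = \<psi>" using lift by blast
    have "matrix_coeff \<sigma> \<in> V"
    proof (rule ccontr)
      assume "matrix_coeff \<sigma> \<notin> V"
      then have "\<psi> \<in> C" unfolding C_def \<sigma>(2)[symmetric] theta_matrix_coeff using \<sigma>(1) unfolding rep_def by blast
      then show False using \<psi> by blast
    qed
    then show "\<psi> \<in> U" using V(2) \<sigma> unfolding rep_def by blast
  qed
  ultimately show ?thesis using openin_qs_topology by blast
qed

end

theorem mainTheorem3:
  fixes A :: "'a cstar" and H :: "'h hilb" and \<xi> :: 'h
  assumes "cstar_algebra A" and "vcarrier A = UNIV"
    and "hilbert_space H" and "vcarrier H = UNIV"
    and "\<forall>(K :: (nat \<Rightarrow> 'a) hilb) \<pi>. hilbert_space K \<and> cyclic_rep A K \<pi> \<longrightarrow> hdim_le K H"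
    and "(\<exists>n::nat. \<forall>(K :: (nat \<Rightarrow> 'a) hilb) \<pi> B. hilbert_space K \<and> cyclic_rep A K \<pi>
             \<and> orthonormal_basis K B \<longrightarrow> finite B \<and> card B \<le> n)
         \<longrightarrow> (\<forall>(K :: (nat \<Rightarrow> 'a) hilb) \<pi>. hilbert_space K \<and> cyclic_rep A K \<pi> \<longrightarrow> hdim_less K H)"
    and "hnorm H \<xi> = 1"
  shows "quotient_map (rep_topology A H) (qs_topology A) (theta H \<xi>)"
proof -
  interpret cstar_hilb A H
    by unfold_locales (use assms in auto)
  have \<xi>: "nrm \<xi> = 1" using assms(7) by (simp add: hnorm_eq)
  have le: "hdim_le K H" if "hilbert_space K" "cyclic_rep A K \<pi>" for K :: "(nat \<Rightarrow> 'a) hilb" and \<pi>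
    using assms(5) that by blast
  \<comment> \<open>A finite basis of \<open>H\<close> bounds the dimensions of all cyclic
    representations by its cardinality, so their supremum is finite and the strict part of the
    hypothesis applies.\<close>
  have less: "hdim_less K H" if B: "\<exists>B. orthonormal_basis H B \<and> finite B"
    and K: "hilbert_space K" "cyclic_rep A K \<pi>" for K :: "(nat \<Rightarrow> 'a) hilb" and \<pi>
  proof -
    obtain B where B: "orthonormal_basis H B" "finite B" using B by blast
    have bound: "finite B' \<and> card B' \<le> card B"
      if K: "hilbert_space K" "cyclic_rep A K \<pi>" "orthonormal_basis K B'" for K :: "(nat \<Rightarrow> 'a) hilb" and \<pi> B'
    proof -
      obtain f where f: "inj_on f B'" "f ` B' \<subseteq> B"
        using le[OF K(1,2)] K(3) B(1) unfolding hdim_le_def by blast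
      show ?thesis using inj_on_finite[OF f B(2)] card_inj_on_le[OF f B(2)] by simp
    qed
    have "\<exists>n::nat. \<forall>(K :: (nat \<Rightarrow> 'a) hilb) \<pi> B. hilbert_space K \<and> cyclic_rep A K \<pi>
             \<and> orthonormal_basis K B \<longrightarrow> finite B \<and> card B \<le> n"
    proof (intro exI allI impI)
      fix K :: "(nat \<Rightarrow> 'a) hilb" and \<pi> B'
      assume K: "hilbert_space K \<and> cyclic_rep A K \<pi> \<and> orthonormal_basis K B'"
      show "finite B' \<and> card B' \<le> card B"
        by (rule bound) (use K in auto)
    qed
    from mp[OF assms(6) this] K show ?thesis by blast
  qed
  have lift: "\<exists>\<sigma>. tight_lift \<xi> \<psi> \<sigma> \<and>
      ((\<forall>B. orthonormal_basis H B \<longrightarrow> infinite B) \<longrightarrow>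
        ample_null \<xi> \<sigma>)"
    if "\<psi> \<in> quasi_states A" for \<psi>
    by (rule quasi_state_lift[OF that \<xi>]) (rule le, assumption+, rule less, assumption+)
  have surj: "\<exists>\<sigma>. is_rep A H \<sigma> \<and> theta H \<xi> \<sigma> = \<psi>" if "\<psi> \<in> quasi_states A" for \<psi>
    using lift[OF that] unfolding tight_lift_def by blast
  have image_open: "openin (qs_topology A) U"
    if U: "U \<subseteq> quasi_states A" "openin (rep_topology A H) {\<pi> \<in> rep A H. theta H \<xi> \<pi> \<in> U}" for U
  proof (cases "\<exists>B. orthonormal_basis H B \<and> finite B")
    case True
    then show ?thesis using theta_image_open_finite[OF \<xi> U] surj by blast
  next
    case False
    then have inf: "\<forall>B. orthonormal_basis H B \<longrightarrow> infinite B" by blast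
    show ?thesis
    proof (rule theta_image_open_infinite[OF \<xi> U], intro ballI)
      fix \<psi> assume "\<psi> \<in> quasi_states A"
      from lift[OF this] inf show "\<exists>\<sigma>. tight_lift \<xi> \<psi> \<sigma> \<and>
        ample_null \<xi> \<sigma>" by blast
    qed
  qed
  show ?thesis
    unfolding quotient_map_def topspace_rep topspace_qs
  proof (intro conjI allI impI iffI)
    show "theta H \<xi> ` rep A H = quasi_states A"
      using theta_quasi_state[OF _ \<xi>] surj unfolding rep_def by blast
    show "\<And>U. U \<subseteq> quasi_states A \<Longrightarrow> openin (rep_topology A H) {x \<in> rep A H. theta H \<xi> x \<in> U} \<Longrightarrow>
      openin (qs_topology A) U" by (rule image_open)
    show "\<And>U. U \<subseteq> quasi_states A \<Longrightarrow> openin (qs_topology A) U \<Longrightarrow>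
      openin (rep_topology A H) {x \<in> rep A H. theta H \<xi> x \<in> U}" by (rule theta_preimage_open[OF _ \<xi>])
  qed
qed

end
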